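(* The space $\mathrm{Lag}^-$ is weakly homotopy equivalent to $U(\infty)=\varinjlim_n U(n)$. The same is true of $\mathrm{Lag}^-_{\mathscr I}$ for every nontrivial two-sided symmetrically normed ideal $\mathscr I$ of compact operators on $H$.
   Context: $H$ is a separable infinite-dimensional complex Hilbert space, $\hat H=H\oplus H$, $H^-=0\oplus H$, $J(x,y)=(y,-x)$. A subspace $L\subset\hat H$ is lagrangian if $JL=L^\perp$; $\mathrm{Lag}$ is the set of lagrangians, topologized by $L\mapsto P_L$ (orthogonal projection) in $\mathcal B(\hat H)$ with the norm topology. $\mathrm{Lag}^-$ is the subspace of lagrangians $L$ with $\dim(L\cap H^-)<\infty$ and $L+H^-$ closed. $\mathscr I\subset\mathcal B(H)$ is a nontrivial two-sided ideal contained in the compact operators, with a (symmetric, Banach) norm whose topology is at least as strong as the operator norm topology (e.g. a Schatten ideal). The Palais group is $\mathscr U_{\mathscr I}=\{U\text{ unitary on }H\mid U-1\in\mathscr I\}$ with topology induced from $\mathscr I$ via $U\mapsto U-1$. The Cayley graph map is $\mathcal C(U)=\{((1+U)v,-i(1-U)v)\mid v\in H\}\subset\hat H$, and $\mathrm{Lag}^-_{\mathscr I}:=\mathcal C(\mathscr U_{\mathscr I})\subset\mathrm{Lag}^-$, with the topology making $\mathcal C:\mathscr U_{\mathscr I}\to\mathrm{Lag}^-_{\mathscr I}$ a homeomorphism. $U(n)\subset U(n+1)$ via $U\mapsto U\oplus1$. *)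

theory Defs
  imports "HOL-Analysis.Analysis"
begin

section \<open>Complex Hilbert spaces\<close>

text \<open>The Hermitian product is linear in its first argument. The norm and the topology are those of
  the underlying real Hilbert space, whose inner product is the real part of the Hermitian product.\<close>

class complex_hilbert = real_inner + complete_space +
  fixes scaleC :: "complex \<Rightarrow> 'a \<Rightarrow> 'a"  (infixr \<open>*\<^sub>C\<close> 75)
    and cinner :: "'a \<Rightarrow> 'a \<Rightarrow> complex"
  assumes scaleC_add_right: "c *\<^sub>C (x + y) = c *\<^sub>C x + c *\<^sub>C y"
    and scaleC_add_left: "(c + d) *\<^sub>C x = c *\<^sub>C x + d *\<^sub>C x"
    and scaleC_scaleC: "c *\<^sub>C d *\<^sub>C x = (c * d) *\<^sub>C x"
    and scaleR_scaleC: "r *\<^sub>R x = complex_of_real r *\<^sub>C x"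
    and cinner_commute: "cinner x y = cnj (cinner y x)"
    and cinner_add_left: "cinner (x + y) z = cinner x z + cinner y z"
    and cinner_scaleC_left: "cinner (c *\<^sub>C x) y = c * cinner x y"
    and inner_eq_Re_cinner: "inner x y = Re (cinner x y)"

lemma scaleC_one: "1 *\<^sub>C x = (x :: 'a::complex_hilbert)"
  using scaleR_scaleC[of 1 x] by simp

global_interpretation complex_vector: vector_space "scaleC :: complex \<Rightarrow> 'a \<Rightarrow> 'a::complex_hilbert"
  defines csubspace = complex_vector.subspace
    and cspan = complex_vector.span
  by unfold_locales
    (simp_all add: scaleC_add_right scaleC_add_left scaleC_scaleC scaleC_one)

definition finite_dimensional :: "'a::complex_hilbert set \<Rightarrow> bool"
  where "finite_dimensional L \<longleftrightarrow> (\<exists>B. finite B \<and> cspan B = L)"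

definition orth_compl :: "'a::complex_hilbert set \<Rightarrow> 'a set"
  where "orth_compl L = {x. \<forall>y\<in>L. cinner x y = 0}"

instantiation prod :: (complex_hilbert, complex_hilbert) complex_hilbert
begin

definition scaleC_prod :: "complex \<Rightarrow> 'a \<times> 'b \<Rightarrow> 'a \<times> 'b"
  where "scaleC_prod c p = (c *\<^sub>C fst p, c *\<^sub>C snd p)"

definition cinner_prod :: "'a \<times> 'b \<Rightarrow> 'a \<times> 'b \<Rightarrow> complex"
  where "cinner_prod p q = cinner (fst p) (fst q) + cinner (snd p) (snd q)"

instance
proof
  fix x y :: "'a \<times> 'b"
  show "cinner x y = cnj (cinner y x)"
    unfolding cinner_prod_def
    using cinner_commute[of "fst x" "fst y"] cinner_commute[of "snd x" "snd y"] by simp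
qed (simp_all add: scaleC_prod_def cinner_prod_def scaleC_add_right scaleC_add_left scaleC_scaleC
      scaleR_scaleC cinner_add_left cinner_scaleC_left inner_eq_Re_cinner inner_prod_def
      scaleR_prod_def algebra_simps)

end


section \<open>Lagrangians\<close>

definition J :: "'a::complex_hilbert \<times> 'a \<Rightarrow> 'a \<times> 'a"
  where "J = (\<lambda>(x, y). (y, - x))"

definition lagrangian :: "('a::complex_hilbert \<times> 'a) set \<Rightarrow> bool"
  where "lagrangian L \<longleftrightarrow> csubspace L \<and> J ` L = orth_compl L"

text \<open>Orthogonal projections exist only for closed subspaces. Lagrangians are closed, being the
  isometric preimage of an orthogonal complement.\<close>

definition orth_proj :: "'a::complex_hilbert set \<Rightarrow> 'a \<Rightarrow>\<^sub>L 'a"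
  where "orth_proj L = (THE P. \<forall>x. blinfun_apply P x \<in> L \<and> x - blinfun_apply P x \<in> orth_compl L)"

definition Lag_topology :: "('a::complex_hilbert \<times> 'a) set topology"
  where "Lag_topology = pullback_topology {L. lagrangian L} orth_proj euclidean"

definition H_minus :: "('a::complex_hilbert \<times> 'a) set"
  where "H_minus = {0} \<times> UNIV"

definition Lag_minus :: "('a::complex_hilbert \<times> 'a) set set"
  where "Lag_minus = {L. lagrangian L \<and> finite_dimensional (L \<inter> H_minus)
                          \<and> closed {x + y | x y. x \<in> L \<and> y \<in> H_minus}}"

definition Lag_minus_topology :: "('a::complex_hilbert \<times> 'a) set topology"
  where "Lag_minus_topology = subtopology Lag_topology Lag_minus"


section \<open>Operator ideals and the Palais group\<close>

text \<open>The type of bounded linear maps consists of the real-linear ones; \<open>bounded_ops\<close>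
  selects the complex-linear ones. The operator norm does not depend on the scalar field.\<close>

definition bounded_ops :: "('a::complex_hilbert \<Rightarrow>\<^sub>L 'a) set"
  where "bounded_ops = {A. \<forall>c x. blinfun_apply A (c *\<^sub>C x) = c *\<^sub>C blinfun_apply A x}"

definition compact_ops :: "('a::complex_hilbert \<Rightarrow>\<^sub>L 'a) set"
  where "compact_ops = {A \<in> bounded_ops. compact (closure (blinfun_apply A ` cball 0 1))}"

definition unitary_ops :: "('a::complex_hilbert \<Rightarrow>\<^sub>L 'a) set"
  where "unitary_ops = {U \<in> bounded_ops. surj (blinfun_apply U) \<and>
           (\<forall>x y. cinner (blinfun_apply U x) (blinfun_apply U y) = cinner x y)}"

definition two_sided_ideal :: "('a::complex_hilbert \<Rightarrow>\<^sub>L 'a) set \<Rightarrow> bool"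
  where "two_sided_ideal I \<longleftrightarrow>
           I \<subseteq> bounded_ops \<and> 0 \<in> I \<and> (\<forall>A\<in>I. \<forall>B\<in>I. A + B \<in> I) \<and>
           (\<forall>S\<in>bounded_ops. \<forall>A\<in>I. S o\<^sub>L A \<in> I \<and> A o\<^sub>L S \<in> I)"

definition norm_on :: "('a::complex_hilbert \<Rightarrow>\<^sub>L 'a) set \<Rightarrow> (('a \<Rightarrow>\<^sub>L 'a) \<Rightarrow> real) \<Rightarrow> bool"
  where "norm_on I N \<longleftrightarrow>
           (\<forall>A\<in>I. 0 \<le> N A \<and> (N A = 0 \<longleftrightarrow> A = 0)) \<and>
           (\<forall>A\<in>I. \<forall>B\<in>I. N (A + B) \<le> N A + N B) \<and>
           (\<forall>A\<in>I. \<forall>B\<in>I. \<forall>c. (\<forall>x. blinfun_apply B x = c *\<^sub>C blinfun_apply A x) \<longrightarrow> N B = cmod c * N A)"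

text \<open>Nothing is assumed about \<open>N\<close> outside \<open>I\<close>, whereas the locale
  \<^locale>\<open>Metric_space\<close> asks for a distance that is nonnegative and symmetric on the whole type.\<close>

definition ideal_dist ::
    "('a::complex_hilbert \<Rightarrow>\<^sub>L 'a) set \<Rightarrow> (('a \<Rightarrow>\<^sub>L 'a) \<Rightarrow> real) \<Rightarrow> ('a \<Rightarrow>\<^sub>L 'a) \<Rightarrow> ('a \<Rightarrow>\<^sub>L 'a) \<Rightarrow> real"
  where "ideal_dist I N A B = (if A \<in> I \<and> B \<in> I then N (A - B) else 0)"

definition ideal_topology ::
    "('a::complex_hilbert \<Rightarrow>\<^sub>L 'a) set \<Rightarrow> (('a \<Rightarrow>\<^sub>L 'a) \<Rightarrow> real) \<Rightarrow> ('a \<Rightarrow>\<^sub>L 'a) topology"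
  where "ideal_topology I N = Metric_space.mtopology I (ideal_dist I N)"

definition symmetrically_normed_ideal ::
    "('a::complex_hilbert \<Rightarrow>\<^sub>L 'a) set \<Rightarrow> (('a \<Rightarrow>\<^sub>L 'a) \<Rightarrow> real) \<Rightarrow> bool"
  where "symmetrically_normed_ideal I N \<longleftrightarrow>
           two_sided_ideal I \<and> I \<noteq> {0} \<and> I \<subseteq> compact_ops \<and>
           norm_on I N \<and> Metric_space.mcomplete I (ideal_dist I N) \<and>
           (\<forall>S\<in>bounded_ops. \<forall>A\<in>I. \<forall>T\<in>bounded_ops. N (S o\<^sub>L A o\<^sub>L T) \<le> norm S * N A * norm T) \<and>
           (\<forall>W. open W \<longrightarrow> openin (ideal_topology I N) (I \<inter> W))"

definition Palais_group :: "('a::complex_hilbert \<Rightarrow>\<^sub>L 'a) set \<Rightarrow> ('a \<Rightarrow>\<^sub>L 'a) set"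
  where "Palais_group I = {U \<in> unitary_ops. U - id_blinfun \<in> I}"

definition Palais_topology ::
    "('a::complex_hilbert \<Rightarrow>\<^sub>L 'a) set \<Rightarrow> (('a \<Rightarrow>\<^sub>L 'a) \<Rightarrow> real) \<Rightarrow> ('a \<Rightarrow>\<^sub>L 'a) topology"
  where "Palais_topology I N =
           pullback_topology (Palais_group I) (\<lambda>U. U - id_blinfun) (ideal_topology I N)"

definition Cayley :: "('a::complex_hilbert \<Rightarrow>\<^sub>L 'a) \<Rightarrow> ('a \<times> 'a) set"
  where "Cayley U = {(v + blinfun_apply U v, - (\<i> *\<^sub>C (v - blinfun_apply U v))) | v. True}"

definition Lag_minus_ideal_topology ::
    "('a::complex_hilbert \<Rightarrow>\<^sub>L 'a) set \<Rightarrow> (('a \<Rightarrow>\<^sub>L 'a) \<Rightarrow> real) \<Rightarrow> ('a \<times> 'a) set topology"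
  where "Lag_minus_ideal_topology I N =
           pullback_topology (Cayley ` Palais_group I) (inv_into (Palais_group I) Cayley)
             (Palais_topology I N)"

lemma Metric_space_ideal_dist:
  assumes "two_sided_ideal I" "norm_on I N"
  shows "Metric_space I (ideal_dist I N)"
proof -
  have homog: "N B = cmod c * N A"
    if "A \<in> I" "B \<in> I" "\<forall>x. blinfun_apply B x = c *\<^sub>C blinfun_apply A x" for A B c
    using assms(2)[unfolded norm_on_def, THEN conjunct2, THEN conjunct2, rule_format, OF that(1,2)] that(3)
    by simp
  have tri: "N (A + B) \<le> N A + N B" if "A \<in> I" "B \<in> I" for A B
    using assms(2)[unfolded norm_on_def, THEN conjunct2, THEN conjunct1] that by simp
  have sums: "A + B \<in> I" if "A \<in> I" "B \<in> I" for A B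
    using assms(1)[unfolded two_sided_ideal_def] that by simp
  have pos: "0 \<le> N A" "N A = 0 \<longleftrightarrow> A = 0" if "A \<in> I" for A
    using assms(2)[unfolded norm_on_def, THEN conjunct1] that by simp_all
  have neg: "- A \<in> I \<and> N (- A) = N A" if "A \<in> I" for A
  proof -
    have "- id_blinfun \<in> (bounded_ops :: ('a \<Rightarrow>\<^sub>L 'a) set)"
      by (simp add: bounded_ops_def uminus_blinfun.rep_eq complex_vector.scale_minus_right)
    then have "A o\<^sub>L - id_blinfun \<in> I"
      using assms(1) that by (simp add: two_sided_ideal_def)
    moreover have "A o\<^sub>L - id_blinfun = - A"
      by (rule blinfun_eqI) (simp add: uminus_blinfun.rep_eq blinfun.minus_right)
    ultimately have mem: "- A \<in> I" by simp
    have "blinfun_apply (- A) x = (- 1) *\<^sub>C blinfun_apply A x" for x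
      by (simp add: uminus_blinfun.rep_eq)
    then have "N (- A) = cmod (- 1) * N A"
      by (intro homog[OF that mem] allI)
    with mem show ?thesis by simp
  qed
  have diff: "A - B \<in> I" if "A \<in> I" "B \<in> I" for A B
    using sums[of A "- B"] that neg[of B] by simp
  show ?thesis
  proof
    show "0 \<le> ideal_dist I N A B" for A B
      using pos(1)[OF diff] by (simp add: ideal_dist_def)
    show "ideal_dist I N A B = ideal_dist I N B A" for A B
      using neg[OF diff[of A B]] by (simp add: ideal_dist_def)
    show "ideal_dist I N A B = 0 \<longleftrightarrow> A = B" if "A \<in> I" "B \<in> I" for A B
      using pos(2)[OF diff] that by (simp add: ideal_dist_def)
    show "ideal_dist I N A C \<le> ideal_dist I N A B + ideal_dist I N B C"
      if "A \<in> I" "B \<in> I" "C \<in> I" for A B C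
    proof -
      have "N ((A - B) + (B - C)) \<le> N (A - B) + N (B - C)"
        by (intro tri diff that)
      then show ?thesis using that by (simp add: ideal_dist_def)
    qed
  qed
qed

lemma inj_Cayley: "inj_on Cayley S"
proof (rule inj_onI)
  fix U V :: "'a \<Rightarrow>\<^sub>L 'a"
  assume eq: "Cayley U = Cayley V"
  show "U = V"
  proof (rule blinfun_eqI)
    fix v
    have "(v + blinfun_apply U v, - (\<i> *\<^sub>C (v - blinfun_apply U v))) \<in> Cayley V"
      unfolding eq[symmetric] by (auto simp: Cayley_def)
    then obtain w where w: "v + blinfun_apply U v = w + blinfun_apply V w"
      "\<i> *\<^sub>C (v - blinfun_apply U v) = \<i> *\<^sub>C (w - blinfun_apply V w)"
      by (auto simp: Cayley_def)
    then have d: "v - blinfun_apply U v = w - blinfun_apply V w"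
      by (simp add: complex_vector.scale_left_imp_eq)
    have "2 *\<^sub>R v = (v + blinfun_apply U v) + (v - blinfun_apply U v)"
      by (simp add: scaleR_2)
    also have "\<dots> = 2 *\<^sub>R w" unfolding w d by (simp add: scaleR_2)
    finally have "v = w" by simp
    with d show "blinfun_apply U v = blinfun_apply V v" by simp
  qed
qed

lemma topspace_Palais_topology:
  assumes "two_sided_ideal I" "norm_on I N"
  shows "topspace (Palais_topology I N) = Palais_group I"
  using Metric_space.topspace_mtopology[OF Metric_space_ideal_dist[OF assms]]
  by (auto simp: Palais_topology_def ideal_topology_def topspace_pullback_topology Palais_group_def)

lemma homeomorphic_map_Cayley:
  assumes "two_sided_ideal I" "norm_on I N"
  shows "homeomorphic_map (Palais_topology I N) (Lag_minus_ideal_topology I N) Cayley"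
proof -
  let ?P = "Palais_topology I N" and ?L = "Lag_minus_ideal_topology I N"
  let ?g = "inv_into (Palais_group I) (Cayley :: ('a \<Rightarrow>\<^sub>L 'a) \<Rightarrow> _)"
  have inv: "?g (Cayley U) = U" if "U \<in> Palais_group I" for U
    using that by (simp add: inv_into_f_f[OF inj_Cayley])
  have topL: "topspace ?L = Cayley ` Palais_group I"
    using inv by (auto simp: Lag_minus_ideal_topology_def topspace_pullback_topology
        topspace_Palais_topology[OF assms])
  have "continuous_map ?P ?L Cayley"
    unfolding Lag_minus_ideal_topology_def
  proof (rule continuous_map_pullback')
    show "continuous_map ?P ?P (?g \<circ> Cayley)"
      by (rule continuous_map_eq[OF continuous_map_id])
        (simp add: inv topspace_Palais_topology[OF assms])
    show "topspace ?P \<subseteq> Cayley -` Cayley ` Palais_group I"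
      by (auto simp: topspace_Palais_topology[OF assms])
  qed
  moreover have "continuous_map ?L ?P ?g"
    unfolding Lag_minus_ideal_topology_def
    using continuous_map_pullback[OF continuous_map_id] by (simp add: o_def)
  ultimately have "homeomorphic_maps ?P ?L Cayley ?g"
    using inv by (auto simp: homeomorphic_maps_def topL topspace_Palais_topology[OF assms])
  then show ?thesis by (rule homeomorphic_maps_map[THEN iffD1, THEN conjunct1])
qed


section \<open>The stable unitary group\<close>

text \<open>A matrix in $U(n)$ is identified with its stabilisation $U \oplus 1 \oplus 1 \oplus \dots$, an
  infinite matrix, so that the maps $U(n) \to U(n+1)$ become inclusions. The function type carries
  the topology of entrywise convergence, which induces the usual topology on each $U(n)$;
  the colimit has the final topology with respect to all $U(n)$, which is finer.\<close>

definition U_fin :: "nat \<Rightarrow> (nat \<Rightarrow> nat \<Rightarrow> complex) set"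
  where "U_fin n = {A.
           (\<forall>i j. \<not> (i < n \<and> j < n) \<longrightarrow> A i j = (if i = j then 1 else 0)) \<and>
           (\<forall>i<n. \<forall>j<n. (\<Sum>k<n. cnj (A k i) * A k j) = (if i = j then 1 else 0)) \<and>
           (\<forall>i<n. \<forall>j<n. (\<Sum>k<n. A i k * cnj (A j k)) = (if i = j then 1 else 0))}"

definition U_infinity_topology :: "(nat \<Rightarrow> nat \<Rightarrow> complex) topology"
  where "U_infinity_topology = topology (\<lambda>S. S \<subseteq> (\<Union>n. U_fin n) \<and>
           (\<forall>n. openin (top_of_set (U_fin n)) (S \<inter> U_fin n)))"

lemma openin_U_infinity_topology:
  "openin U_infinity_topology S \<longleftrightarrow>
     S \<subseteq> (\<Union>n. U_fin n) \<and> (\<forall>n. openin (top_of_set (U_fin n)) (S \<inter> U_fin n))"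
proof -
  have "istopology (\<lambda>S. S \<subseteq> (\<Union>n. U_fin n) \<and>
           (\<forall>n. openin (top_of_set (U_fin n)) (S \<inter> U_fin n)))"
    unfolding istopology_def
  proof (intro conjI allI impI)
    fix S T :: "(nat \<Rightarrow> nat \<Rightarrow> complex) set" and n
    assume S: "S \<subseteq> (\<Union>n. U_fin n) \<and> (\<forall>n. openin (top_of_set (U_fin n)) (S \<inter> U_fin n))"
      and T: "T \<subseteq> (\<Union>n. U_fin n) \<and> (\<forall>n. openin (top_of_set (U_fin n)) (T \<inter> U_fin n))"
    show "S \<inter> T \<subseteq> (\<Union>n. U_fin n)"
      by (rule le_infI1) (rule S[THEN conjunct1])
    have "openin (top_of_set (U_fin n)) ((S \<inter> U_fin n) \<inter> (T \<inter> U_fin n))"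
      by (intro openin_Int S[THEN conjunct2, THEN spec] T[THEN conjunct2, THEN spec])
    moreover have "(S \<inter> U_fin n) \<inter> (T \<inter> U_fin n) = S \<inter> T \<inter> U_fin n" by blast
    ultimately show "openin (top_of_set (U_fin n)) (S \<inter> T \<inter> U_fin n)" by simp
  next
    fix K :: "(nat \<Rightarrow> nat \<Rightarrow> complex) set set" and n
    assume K: "\<forall>S\<in>K. S \<subseteq> (\<Union>n. U_fin n) \<and> (\<forall>n. openin (top_of_set (U_fin n)) (S \<inter> U_fin n))"
    show "\<Union>K \<subseteq> (\<Union>n. U_fin n)"
      by (rule Sup_least) (rule K[THEN bspec, THEN conjunct1])
    have "openin (top_of_set (U_fin n)) (\<Union>((\<lambda>S. S \<inter> U_fin n) ` K))"
      by (intro openin_Union, erule imageE) (simp add: K[THEN bspec, THEN conjunct2, THEN spec])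
    moreover have "\<Union>((\<lambda>S. S \<inter> U_fin n) ` K) = \<Union>K \<inter> U_fin n" by blast
    ultimately show "openin (top_of_set (U_fin n)) (\<Union>K \<inter> U_fin n)" by simp
  qed
  then show ?thesis by (simp add: U_infinity_topology_def)
qed


section \<open>Weak homotopy equivalence\<close>

definition sphere_base :: "nat \<Rightarrow> real"
  where "sphere_base = (\<lambda>i. if i = 0 then 1 else 0)"

definition based_maps :: "nat \<Rightarrow> 'a topology \<Rightarrow> 'a \<Rightarrow> ((nat \<Rightarrow> real) \<Rightarrow> 'a) set"
  where "based_maps n X a = {g. continuous_map (nsphere n) X g \<and> g sphere_base = a}"

definition based_homotopy ::
    "nat \<Rightarrow> 'a topology \<Rightarrow> 'a \<Rightarrow> (((nat \<Rightarrow> real) \<Rightarrow> 'a) \<times> ((nat \<Rightarrow> real) \<Rightarrow> 'a)) set"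
  where "based_homotopy n X a = {(g, h). g \<in> based_maps n X a \<and> h \<in> based_maps n X a \<and>
           homotopic_with (\<lambda>k. k sphere_base = a) (nsphere n) X g h}"

text \<open>The underlying set of the \<open>n\<close>-th homotopy group.\<close>

definition homotopy_classes :: "nat \<Rightarrow> 'a topology \<Rightarrow> 'a \<Rightarrow> ((nat \<Rightarrow> real) \<Rightarrow> 'a) set set"
  where "homotopy_classes n X a = based_maps n X a // based_homotopy n X a"

definition induced_map ::
    "nat \<Rightarrow> 'b topology \<Rightarrow> ('a \<Rightarrow> 'b) \<Rightarrow> 'a \<Rightarrow> ((nat \<Rightarrow> real) \<Rightarrow> 'a) set \<Rightarrow> ((nat \<Rightarrow> real) \<Rightarrow> 'b) set"
  where "induced_map n Y f a c = based_homotopy n Y (f a) `` ((\<lambda>g. f \<circ> g) ` c)"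

text \<open>A map induces homomorphisms on homotopy groups in positive degrees, so that bijectivity of
  the induced map is the same as its being an isomorphism.\<close>

definition weak_homotopy_equivalence :: "'a topology \<Rightarrow> 'b topology \<Rightarrow> ('a \<Rightarrow> 'b) \<Rightarrow> bool"
  where "weak_homotopy_equivalence X Y f \<longleftrightarrow>
           continuous_map X Y f \<and>
           bij_betw (\<lambda>C. {y. \<exists>x\<in>C. path_component_of Y (f x) y})
             (path_components_of X) (path_components_of Y) \<and>
           (\<forall>n\<ge>1. \<forall>a\<in>topspace X.
              bij_betw (induced_map n Y f a) (homotopy_classes n X a) (homotopy_classes n Y (f a)))"

text \<open>\<open>weakly_homotopy_equivalent X Y\<close> asks for a single weak equivalence from \<open>Y\<close> to \<open>X\<close>.
  When \<open>Y\<close> has the homotopy type of a CW complex, as $U(\infty)$ does, this is the same as the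
  existence of a zigzag of weak equivalences between \<open>X\<close> and \<open>Y\<close>.\<close>

definition weakly_homotopy_equivalent :: "'a topology \<Rightarrow> 'b topology \<Rightarrow> bool"
  where "weakly_homotopy_equivalent X Y \<longleftrightarrow> (\<exists>f. weak_homotopy_equivalence Y X f)"

end

theory Submission
  imports Defs
begin

text \<open>By the Cayley transform, the Lagrangians in question correspond to unitary operators \<open>W\<close> for which
  \<open>1 + W\<close> is Fredholm. Fix an orthonormal basis and let \<open>Q\<close> be the projection onto the closed span of
  all but the first \<open>n\<close> basis vectors. The operators for which \<open>1 + W\<close> is bounded below on the range of
  \<open>Q\<close> form an open set (the \<open>n\<close>-th stage); the stages increase with \<open>n\<close> and exhaust the space.
  Symplectic reduction retracts the \<open>n\<close>-th stage onto \<open>U(n)\<close>, and it is joined to the identity by an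
  explicit path: feed the \<open>Q\<close>-component of the output of \<open>W\<close> back into its input through a beam
  splitter whose reflection coefficient \<open>s\<close> runs from 0 to 1. The resulting operator is unitary, exists
  because $2\,\mathrm{Re}\langle (1+W)y, y\rangle = \|(1+W)y\|^2$ makes the feedback equation coercive,
  equals \<open>W\<close> if \<open>W\<close> lies in \<open>U(n)\<close>, and differs from 1 by a two-sided multiple of \<open>W - 1\<close>, so that
  it is also continuous for the norm of an operator ideal.
  Since a compact subset lies in a single stage, the inclusion of $U(\infty)$ is a weak equivalence.\<close>

section \<open>Complex Hilbert spaces\<close>

text \<open>The retractions of different stages do not agree where both are defined, so they do not
  glue to a homotopy inverse; hence the argument treats one compact set at a time. Linear
  interpolation towards \<open>U(n)\<close> would leave the unitary operators. Feedback does not: a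
  beam splitter rotates the pair of incoming and returning signals, so that energy is conserved, and
  eliminating the loop only requires inverting \<open>1 + s Q W Q\<close>. For \<open>y\<close> in
  the range of \<open>Q\<close> the real part of its quadratic form is affine in \<open>s\<close>,
  with value the squared norm of \<open>y\<close> at \<open>s = 0\<close> and half that of
  \<open>(1 + W) y\<close> at \<open>s = 1\<close>. The bound defining a stage therefore makes it
  coercive uniformly in \<open>s\<close>. The path has to fix \<open>U(n)\<close> pointwise, not
  merely end there: then deformations of spheres respect every base point. That the stages exhaust
  the space is shown by contradiction. An operator outside all of them has unit vectors
  \<open>y n\<close> in the ranges of the successive projections with \<open>(1 + W) (y n)\<close>
  tending to 0. They converge weakly to 0, which is impossible if \<open>W - 1\<close> is compact or
  if \<open>1 + W\<close> has finite-dimensional kernel and closed range.\<close>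

lemma cinner_zero_left [simp]: "cinner 0 y = 0"
  using cinner_add_left[of 0 0 y] by simp

lemma cinner_minus_left: "cinner (- x) y = - cinner x y"
  using cinner_add_left[of x "- x" y] by (simp add: add_eq_0_iff)

lemma cinner_diff_left: "cinner (x - y) z = cinner x z - cinner y z"
  using cinner_add_left[of x "- y" z] by (simp add: cinner_minus_left)

lemma cinner_add_right: "cinner x (y + z) = cinner x y + cinner x z"
  using cinner_commute[of x "y + z"] cinner_commute[of x y] cinner_commute[of x z]
  by (simp add: cinner_add_left)

lemma cinner_zero_right [simp]: "cinner x 0 = 0"
  using cinner_add_right[of x 0 0] by simp

lemma cinner_minus_right: "cinner x (- y) = - cinner x y"
  using cinner_add_right[of x y "- y"] by (simp add: add_eq_0_iff)

lemma cinner_diff_right: "cinner x (y - z) = cinner x y - cinner x z"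
  using cinner_add_right[of x y "- z"] by (simp add: cinner_minus_right)

lemma cinner_scaleC_right: "cinner x (c *\<^sub>C y) = cnj c * cinner x y"
  using cinner_commute[of x "c *\<^sub>C y"] cinner_commute[of x y] by (simp add: cinner_scaleC_left)

lemma cinner_scaleR_left: "cinner (r *\<^sub>R x) y = r * cinner x y"
  by (simp add: scaleR_scaleC cinner_scaleC_left)

lemma cinner_scaleR_right: "cinner x (r *\<^sub>R y) = r * cinner x y"
  by (simp add: scaleR_scaleC cinner_scaleC_right)

lemma cinner_sum_left: "cinner (\<Sum>i\<in>A. f i) y = (\<Sum>i\<in>A. cinner (f i) y)"
  by (induction A rule: infinite_finite_induct) (auto simp: cinner_add_left)

lemma cinner_sum_right: "cinner y (\<Sum>i\<in>A. f i) = (\<Sum>i\<in>A. cinner y (f i))"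
  by (induction A rule: infinite_finite_induct) (auto simp: cinner_add_right)

lemmas cinner_simps = cinner_add_left cinner_add_right cinner_diff_left cinner_diff_right
  cinner_minus_left cinner_minus_right cinner_scaleC_left cinner_scaleC_right
  cinner_scaleR_left cinner_scaleR_right cinner_sum_left cinner_sum_right

lemma Im_cinner: "Im (cinner x y) = inner x (\<i> *\<^sub>C y)"
  by (simp add: inner_eq_Re_cinner cinner_scaleC_right)

text \<open>Transfers real results to the Hermitian product: it suffices to test against
  \<open>y\<close> and \<open>\<i> *\<^sub>C y\<close>.\<close>

lemma cinner_eq_inner: "cinner x y = Complex (inner x y) (inner x (\<i> *\<^sub>C y))"
  by (simp add: complex_eq_iff Im_cinner inner_eq_Re_cinner)

lemma cinner_self: "cinner x x = complex_of_real ((norm x)\<^sup>2)"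
proof -
  have "Im (cinner x x) = 0"
    using cinner_commute[of x x] by (simp add: complex_eq_iff)
  then show ?thesis
    by (simp add: complex_eq_iff power2_norm_eq_inner inner_eq_Re_cinner)
qed

lemma norm_eq_cinner: "(norm x)\<^sup>2 = Re (cinner x x)"
  by (simp add: cinner_self)

lemma cinner_self_eq_0 [simp]: "cinner x x = 0 \<longleftrightarrow> x = 0"
  by (simp add: cinner_self)

lemma norm_scaleC: "norm (c *\<^sub>C x) = cmod c * norm x"
proof (rule power2_eq_imp_eq)
  have "cnj c * c = complex_of_real ((cmod c)\<^sup>2)"
    by (metis complex_norm_square mult.commute)
  then show "(norm (c *\<^sub>C x))\<^sup>2 = (cmod c * norm x)\<^sup>2"
    unfolding norm_eq_cinner cinner_simps mult.assoc[symmetric]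
    by (simp add: cinner_self power_mult_distrib)
qed auto

lemma cmod_cinner_le: "cmod (cinner x y) \<le> norm x * norm y"
proof (cases "cinner x y = 0")
  case False
  \<comment> \<open>The phase that turns \<open>cinner x y\<close> into its modulus, so that the
    real Cauchy-Schwarz inequality applies to \<open>c *\<^sub>C x\<close>.\<close>
  define c where "c = cnj (cinner x y) / cmod (cinner x y)"
  have c: "cmod c = 1" using False by (simp add: c_def norm_divide)
  have "cnj (cinner x y) * cinner x y = complex_of_real ((cmod (cinner x y))\<^sup>2)"
    by (metis complex_norm_square mult.commute)
  then have "cinner (c *\<^sub>C x) y = complex_of_real (cmod (cinner x y))"
    using False by (simp add: cinner_simps c_def power2_eq_square)
  then have "cmod (cinner x y) = inner (c *\<^sub>C x) y"
    by (simp add: inner_eq_Re_cinner)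
  also have "\<dots> \<le> norm (c *\<^sub>C x) * norm y" by (rule norm_cauchy_schwarz)
  finally show ?thesis by (simp add: norm_scaleC c)
qed auto

lemma bounded_bilinear_cinner: "bounded_bilinear cinner"
proof
  show "\<exists>K. \<forall>a b. norm (cinner a b) \<le> norm a * norm b * K"
    by (rule exI[of _ 1]) (simp add: cmod_cinner_le)
qed (simp_all add: cinner_simps scaleR_conv_of_real)

lemma bounded_bilinear_scaleC: "bounded_bilinear scaleC"
proof
  show "\<exists>K. \<forall>a b. norm (a *\<^sub>C b) \<le> norm a * norm b * K"
    by (rule exI[of _ 1]) (simp add: norm_scaleC)
qed (simp_all add: scaleC_add_left scaleC_add_right scaleR_scaleC scaleC_scaleC scaleR_conv_of_real mult.commute)

lemmas continuous_on_cinner [continuous_intros] = bounded_bilinear.continuous_on[OF bounded_bilinear_cinner]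
lemmas continuous_on_scaleC [continuous_intros] = bounded_bilinear.continuous_on[OF bounded_bilinear_scaleC]
lemmas tendsto_cinner = bounded_bilinear.tendsto[OF bounded_bilinear_cinner]
lemmas tendsto_scaleC = bounded_bilinear.tendsto[OF bounded_bilinear_scaleC]

text \<open>Polarization recovers the real inner product from norms; complex linearity of
  \<open>f\<close> then gives the imaginary part.\<close>

lemma cinner_eq_of_norm_eq:
  fixes f :: "'a::complex_hilbert \<Rightarrow> 'b::complex_hilbert"
  assumes add: "\<And>x y. f (x + y) = f x + f y" and scale: "\<And>c x. f (c *\<^sub>C x) = c *\<^sub>C f x"
    and norm: "\<And>x. norm (f x) = norm x"
  shows "cinner (f x) (f y) = cinner x y"
proof -
  have "inner (f x) (f y) = inner x y" for x y
    using norm[of x] norm[of y] norm[of "x + y"] dot_norm[of x y] dot_norm[of "f x" "f y"]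
    by (simp add: add)
  then show ?thesis by (simp add: cinner_eq_inner scale[symmetric])
qed

lemma scaleC_of_real: "complex_of_real r *\<^sub>C x = r *\<^sub>R x"
  by (simp add: scaleR_scaleC)

section \<open>Closed subspaces, orthogonal projection and uniform boundedness\<close>

lemma csubspace_imp_subspace: "csubspace M \<Longrightarrow> subspace M"
  unfolding subspace_def by (simp add: complex_vector.subspace_def scaleR_scaleC)

lemma csubspace_orth_compl: "csubspace (orth_compl M)"
  by (auto simp: complex_vector.subspace_def orth_compl_def cinner_simps)

lemma closed_orth_compl: "closed (orth_compl M)"
proof -
  have "orth_compl M = (\<Inter>y\<in>M. {x. cinner x y = 0})" by (auto simp: orth_compl_def)
  then show ?thesis by (auto intro!: closed_INT closed_Collect_eq continuous_intros)
qed

lemma closed_subspace_projection: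
  fixes M :: "'a::{real_inner, complete_space} set"
  assumes M: "subspace M" "closed M"
  shows "\<exists>m\<in>M. \<forall>n\<in>M. inner (x - m) n = 0"
proof -
  define D where "D = Inf ((\<lambda>m. (norm (x - m))\<^sup>2) ` M)"
  have M0: "M \<noteq> {}" using subspace_0[OF M(1)] by auto
  have bdd: "bdd_below ((\<lambda>m. (norm (x - m))\<^sup>2) ` M)"
    by (rule bdd_belowI2[of _ 0]) auto
  have D_le: "D \<le> (norm (x - m))\<^sup>2" if "m \<in> M" for m
    unfolding D_def using that bdd by (rule cINF_lower[rotated])
  have "\<exists>m\<in>M. (norm (x - m))\<^sup>2 < D + 1 / (real k + 1)" for k
    using cINF_less_iff[OF M0 bdd, of "D + 1 / (real k + 1)"] by (simp add: D_def)
  then obtain m where m: "\<And>k. m k \<in> M" "\<And>k. (norm (x - m k))\<^sup>2 < D + 1 / (real k + 1)" by metis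
  \<comment> \<open>Parallelogram law for \<open>x - m k\<close> and \<open>x - m l\<close>: the
    midpoint of \<open>m k\<close> and \<open>m l\<close> lies in \<open>M\<close>, so its squared
    distance to \<open>x\<close> is at least \<open>D\<close>. This makes the minimizing sequence
    Cauchy.\<close>
  have par: "(norm (m k - m l))\<^sup>2 \<le> 2 / (real k + 1) + 2 / (real l + 1)" for k l
  proof -
    have "(1/2) *\<^sub>R (m k + m l) \<in> M"
      using M(1) m(1) by (simp add: subspace_add subspace_scale)
    from D_le[OF this] have "4 * D \<le> 4 * (norm (x - (1/2) *\<^sub>R (m k + m l)))\<^sup>2" by simp
    also have "\<dots> = (norm (2 *\<^sub>R (x - (1/2) *\<^sub>R (m k + m l))))\<^sup>2"
      by (simp add: power_mult_distrib)
    also have "2 *\<^sub>R (x - (1/2) *\<^sub>R (m k + m l)) = (x - m k) + (x - m l)"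
      by (simp add: algebra_simps scaleR_2)
    finally have 1: "4 * D \<le> (norm ((x - m k) + (x - m l)))\<^sup>2" .
    have "(norm ((x - m k) + (x - m l)))\<^sup>2 + (norm ((x - m k) - (x - m l)))\<^sup>2
         = 2 * (norm (x - m k))\<^sup>2 + 2 * (norm (x - m l))\<^sup>2"
      unfolding power2_norm_eq_inner by (simp add: inner_simps inner_commute)
    moreover have "(x - m k) - (x - m l) = m l - m k" by simp
    ultimately show ?thesis using 1 m(2)[of k] m(2)[of l] norm_minus_commute[of "m k" "m l"] by simp
  qed
  have "Cauchy m"
  proof (rule CauchyI)
    fix e :: real assume e: "e > 0"
    obtain N where N: "real N > 4 / e\<^sup>2" using reals_Archimedean2 by blast
    have "norm (m k - m l) < e" if kl: "k \<ge> N" "l \<ge> N" for k l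
    proof -
      have f: "2 / (real k + 1) < e\<^sup>2 / 2" if "k \<ge> N" for k
      proof -
        have "4 / e\<^sup>2 < real k + 1" using N that by linarith
        then have "4 < (real k + 1) * e\<^sup>2" using e by (simp add: field_simps)
        then show ?thesis by (simp add: field_simps)
      qed
      have "(norm (m k - m l))\<^sup>2 < e\<^sup>2" using par[of k l] f[OF kl(1)] f[OF kl(2)] by linarith
      then show ?thesis using e by (simp add: power_less_imp_less_base)
    qed
    then show "\<exists>N. \<forall>k\<ge>N. \<forall>l\<ge>N. norm (m k - m l) < e" by blast
  qed
  then obtain a where a: "m \<longlonglongrightarrow> a" using Cauchy_convergent convergent_def by blast
  have aM: "a \<in> M" using closed_sequentially[OF M(2)] m(1) a by blast
  have "(norm (x - a))\<^sup>2 \<le> D"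
  proof (rule LIMSEQ_le)
    show "(\<lambda>k. (norm (x - m k))\<^sup>2) \<longlonglongrightarrow> (norm (x - a))\<^sup>2" by (intro tendsto_intros a)
    have "(\<lambda>k. 1 / (real k + 1)) \<longlonglongrightarrow> 0"
      using LIMSEQ_inverse_real_of_nat by (simp add: inverse_eq_divide add.commute)
    then show "(\<lambda>k. D + 1 / (real k + 1)) \<longlonglongrightarrow> D" using tendsto_add[OF tendsto_const] by fastforce
  qed (use m(2) less_imp_le in blast)
  then have min: "(norm (x - a))\<^sup>2 \<le> (norm (x - n))\<^sup>2" if "n \<in> M" for n
    using D_le[OF that] by linarith
  have "inner (x - a) n = 0" if n: "n \<in> M" for n
  proof (cases "n = 0")
    case False
    \<comment> \<open>Moving \<open>a\<close> by \<open>t *\<^sub>R n\<close> lowers the squared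
      distance to \<open>x\<close> by \<open>t * inner (x - a) n\<close>, which is nonnegative for
      this \<open>t\<close>; minimality forces it to be 0.\<close>
    define t where "t = inner (x - a) n / inner n n"
    have "a + t *\<^sub>R n \<in> M" using aM n M(1) by (simp add: subspace_add subspace_scale)
    from min[OF this] have "(norm (x - a))\<^sup>2 \<le> (norm ((x - a) - t *\<^sub>R n))\<^sup>2"
      by (simp add: diff_diff_eq)
    also have "\<dots> = (norm (x - a))\<^sup>2 - 2 * t * inner (x - a) n + t\<^sup>2 * inner n n"
      unfolding power2_norm_eq_inner
      by (simp add: inner_diff_left inner_diff_right inner_commute power2_eq_square algebra_simps)
    finally have "2 * t * inner (x - a) n \<le> t\<^sup>2 * inner n n" by simp
    moreover have "t * inner n n = inner (x - a) n" using False by (simp add: t_def)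
    then have "t\<^sup>2 * inner n n = t * inner (x - a) n" by (simp add: power2_eq_square mult.assoc)
    ultimately have "t * inner (x - a) n \<le> 0" by simp
    then have "(inner (x - a) n)\<^sup>2 / inner n n \<le> 0" by (simp add: t_def power2_eq_square)
    then show ?thesis using False inner_gt_zero_iff[of n] by (simp add: divide_le_0_iff del: inner_gt_zero_iff)
  qed auto
  then show ?thesis using aM by blast
qed

lemma closed_csubspace_projection:
  assumes M: "csubspace M" "closed M"
  shows "\<exists>m\<in>M. x - m \<in> orth_compl M"
proof -
  obtain m where m: "m \<in> M" "\<And>n. n \<in> M \<Longrightarrow> inner (x - m) n = 0"
    using closed_subspace_projection[OF csubspace_imp_subspace[OF M(1)] M(2), of x] by blast
  have "cinner (x - m) n = 0" if "n \<in> M" for n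
    using m(2)[OF that] m(2)[of "\<i> *\<^sub>C n"] that M(1)
    by (simp add: cinner_eq_inner complex_vector.subspace_scale complex_eq_iff)
  then show ?thesis using m(1) by (auto simp: orth_compl_def)
qed

text \<open>Let \<open>w\<close> be the part of \<open>v\<close> orthogonal to \<open>M\<close>. The
  sum is the preimage of \<open>M\<close> under the continuous map that removes the
  \<open>w\<close>-component. If \<open>v\<close> lies in \<open>M\<close>, then
  \<open>w = 0\<close>, division by zero returns 0 and that map is the identity, as it should
  be.\<close>

lemma closed_add_line:
  assumes M: "csubspace M" "closed M"
  shows "closed {m + c *\<^sub>C v | m c. m \<in> M}"
proof -
  obtain p where p: "p \<in> M" "v - p \<in> orth_compl M" using closed_csubspace_projection[OF M] by blast
  define w where "w = v - p"
  have w: "cinner w m = 0" "cinner m w = 0" if "m \<in> M" for m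
    using p(2) that cinner_commute[of m w] by (auto simp: orth_compl_def w_def)
  have "{m + c *\<^sub>C v | m c. m \<in> M} = (\<lambda>z. z - (cinner z w / cinner w w) *\<^sub>C w) -` M"
  proof (intro set_eqI iffI)
    fix z assume "z \<in> {m + c *\<^sub>C v | m c. m \<in> M}"
    then obtain m c where z: "m \<in> M" "z = m + c *\<^sub>C v" by blast
    have v: "v = w + p" by (simp add: w_def)
    have "cinner z w = c * cinner w w"
      by (simp add: z(2) v cinner_add_left cinner_scaleC_left w z(1) p(1))
    then have "(cinner z w / cinner w w) *\<^sub>C w = c *\<^sub>C w"
      by (cases "w = 0") auto
    then have "z - (cinner z w / cinner w w) *\<^sub>C w = z - c *\<^sub>C w" by (simp only:)
    also have "\<dots> = m + c *\<^sub>C p" by (simp add: z(2) v complex_vector.scale_right_distrib)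
    finally have "z - (cinner z w / cinner w w) *\<^sub>C w = m + c *\<^sub>C p" .
    moreover have "m + c *\<^sub>C p \<in> M"
      using z(1) p(1) M(1) by (simp add: complex_vector.subspace_add complex_vector.subspace_scale)
    ultimately show "z \<in> (\<lambda>z. z - (cinner z w / cinner w w) *\<^sub>C w) -` M" by simp
  next
    fix z assume z: "z \<in> (\<lambda>z. z - (cinner z w / cinner w w) *\<^sub>C w) -` M"
    define c where "c = cinner z w / cinner w w"
    have "z = (z - c *\<^sub>C w - c *\<^sub>C p) + c *\<^sub>C v"
      by (simp add: w_def complex_vector.scale_right_diff_distrib)
    moreover have "z - c *\<^sub>C w - c *\<^sub>C p \<in> M"
      using z p(1) M(1) by (simp add: c_def complex_vector.subspace_diff complex_vector.subspace_scale)
    ultimately show "z \<in> {m + c *\<^sub>C v | m c. m \<in> M}" by blast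
  qed
  also have "closed \<dots>"
    unfolding divide_inverse by (intro closed_vimage M(2) continuous_intros)
  finally show ?thesis .
qed

text \<open>The uniform boundedness principle for functionals represented by vectors. By Baire some
  closed set \<open>C n\<close> contains a ball; comparing its center \<open>f\<close> with the
  point displaced by \<open>e\<close> in the direction of \<open>x\<close> bounds
  \<open>norm x\<close>.\<close>

lemma pointwise_bounded_imp_bounded:
  fixes B :: "'a::{real_inner, complete_space} set"
  assumes "\<And>f. \<exists>c. \<forall>x\<in>B. \<bar>inner x f\<bar> \<le> c"
  shows "\<exists>c. \<forall>x\<in>B. norm x \<le> c"
proof -
  define C where "C n = {f. \<forall>x\<in>B. \<bar>inner x f\<bar> \<le> real n}" for n
  have closed: "closed (C n)" for n
  proof -
    have "C n = (\<Inter>x\<in>B. {f. \<bar>inner x f\<bar> \<le> real n})" by (auto simp: C_def)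
    then show ?thesis by (auto intro!: closed_INT closed_Collect_le continuous_intros)
  qed
  have "f \<in> (\<Union>n. C n)" for f
  proof -
    obtain c where "\<forall>x\<in>B. \<bar>inner x f\<bar> \<le> c" using assms by blast
    moreover obtain n where "c \<le> real n" using real_arch_simple by blast
    ultimately have "f \<in> C n" by (force simp: C_def)
    then show ?thesis by blast
  qed
  then have cover: "(\<Union>n. C n) = UNIV" by blast
  have mc: "Met_TC.mcomplete (TYPE('a))"
    by (simp add: complete_UNIV)
  have "\<exists>n. interior (C n) \<noteq> {}"
  proof (rule ccontr)
    assume "\<not> ?thesis"
    then have "Met_TC.mtopology interior_of \<Union>(range C) = {}"
      using closed by (intro Met_TC.metric_Baire_category_alt[OF mc]) (auto simp: interior_of_def interior_def)
    then show False using cover by simp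
  qed
  then obtain n f where "f \<in> interior (C n)" by blast
  then obtain e where e: "e > 0" "cball f e \<subseteq> C n"
    by (meson mem_interior_cball)
  have "norm x \<le> 2 * real n / e" if x: "x \<in> B" for x
  proof (cases "x = 0")
    case False
    have "f + (e / norm x) *\<^sub>R x \<in> C n" using e False by (auto intro!: subsetD[OF e(2)] simp: dist_norm)
    then have "\<bar>inner x (f + (e / norm x) *\<^sub>R x)\<bar> \<le> real n" using x by (simp add: C_def)
    moreover have "f \<in> C n" using e by auto
    then have "\<bar>inner x f\<bar> \<le> real n" using x by (simp add: C_def)
    ultimately have "(e / norm x) * inner x x \<le> 2 * real n" by (simp add: inner_right_distrib)
    moreover have "(e / norm x) * inner x x = e * norm x"
      using False by (simp add: dot_square_norm power2_eq_square)
    ultimately show ?thesis using e by (simp add: field_simps)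
  qed (use e in simp)
  then show ?thesis by blast
qed

section \<open>Orthonormal systems\<close>

definition orthonormal :: "'a::complex_hilbert set \<Rightarrow> bool"
  where "orthonormal S \<longleftrightarrow> (\<forall>u\<in>S. \<forall>v\<in>S. cinner u v = (if u = v then 1 else 0))"

text \<open>One Gram-Schmidt step; no vector is added if \<open>b\<close> already lies in the
  span.\<close>

lemma orthonormal_extend:
  assumes S: "finite S" "orthonormal S"
  shows "\<exists>T. S \<subseteq> T \<and> finite T \<and> orthonormal T \<and> cspan T = cspan (insert b S)"
proof -
  define r where "r = b - (\<Sum>u\<in>S. cinner b u *\<^sub>C u)"
  have sumS: "(\<Sum>u\<in>S. cinner b u *\<^sub>C u) \<in> cspan S"
    by (intro complex_vector.span_sum complex_vector.span_scale complex_vector.span_base)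
  have rv: "cinner r v = 0" if v: "v \<in> S" for v
  proof -
    have "(\<Sum>u\<in>S. cinner b u * cinner u v) = (\<Sum>u\<in>S. if u = v then cinner b u else 0)"
      using S(2) v by (intro sum.cong) (auto simp: orthonormal_def)
    then show ?thesis using S(1) v by (simp add: r_def cinner_simps)
  qed
  show ?thesis
  proof (cases "r = 0")
    case True
    then have "b \<in> cspan S" using sumS by (simp add: r_def)
    then show ?thesis using S complex_vector.span_redundant[of b S] by (intro exI[of _ S]) simp
  next
    case False
    define w where "w = complex_of_real (1 / norm r) *\<^sub>C r"
    have "norm w = 1" using False unfolding w_def scaleC_of_real by simp
    then have ww: "cinner w w = 1" by (simp add: cinner_self)
    have wv: "cinner w v = 0" "cinner v w = 0" if "v \<in> S" for v
      using rv[OF that] cinner_commute[of v w] by (auto simp: w_def cinner_simps)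
    have "orthonormal (insert w S)"
      using S(2) ww wv by (auto simp: orthonormal_def)
    moreover have "cspan (insert w S) = cspan (insert b S)"
    proof -
      have "r \<in> cspan (insert b S)"
        unfolding r_def using sumS complex_vector.span_mono[of S "insert b S"]
        by (intro complex_vector.span_diff) (auto intro: complex_vector.span_base)
      then have 1: "w \<in> cspan (insert b S)" by (simp add: w_def complex_vector.span_scale)
      have "r = complex_of_real (norm r) *\<^sub>C w" using False by (simp add: w_def scaleC_scaleC scaleC_one)
      moreover have "b = r + (\<Sum>u\<in>S. cinner b u *\<^sub>C u)" by (simp add: r_def)
      ultimately have 2: "b \<in> cspan (insert w S)"
        using sumS complex_vector.span_mono[of S "insert w S"]
        by (metis complex_vector.span_add complex_vector.span_base complex_vector.span_scale insertI1 subset_insertI subsetD)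
      show ?thesis unfolding complex_vector.span_eq
        using 1 2 by (auto intro: complex_vector.span_base)
    qed
    ultimately show ?thesis using S(1) by (intro exI[of _ "insert w S"]) auto
  qed
qed

lemma finite_dimensional_orthonormal:
  assumes "finite_dimensional E"
  shows "\<exists>S. finite S \<and> orthonormal S \<and> cspan S = E"
proof -
  obtain B where B: "finite B" "cspan B = E" using assms by (auto simp: finite_dimensional_def)
  from B(1) have "\<exists>S. finite S \<and> orthonormal S \<and> cspan S = cspan B"
  proof (induction B)
    case empty
    show ?case by (rule exI[of _ "{}"]) (simp add: orthonormal_def)
  next
    case (insert b B)
    then obtain S where S: "finite S" "orthonormal S" "cspan S = cspan B" by blast
    then have "cspan (insert b S) = cspan (insert b B)" by (simp add: complex_vector.span_insert)
    then show ?case using orthonormal_extend[OF S(1,2), of b] by auto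
  qed
  then show ?thesis using B by simp
qed

lemma orthonormal_expansion_residual:
  assumes S: "finite S" "orthonormal S" and v: "v \<in> cspan S"
  shows "cinner (x - (\<Sum>u\<in>S. cinner x u *\<^sub>C u)) v = 0"
proof -
  have base: "cinner (x - (\<Sum>u\<in>S. cinner x u *\<^sub>C u)) w = 0" if w: "w \<in> S" for w
  proof -
    have "(\<Sum>u\<in>S. cinner x u * cinner u w) = (\<Sum>u\<in>S. if u = w then cinner x u else 0)"
      using S(2) w by (intro sum.cong) (auto simp: orthonormal_def)
    then show ?thesis using S(1) w by (simp add: cinner_simps)
  qed
  show ?thesis using v
    by (induction rule: complex_vector.span_induct_alt) (simp_all add: cinner_add_right cinner_scaleC_right base)
qed

text \<open>Gram-Schmidt along a dense sequence. A vector orthogonal to the resulting system is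
  orthogonal to the dense set, hence 0; a finite system would span the whole space.\<close>

lemma orthonormal_basis_exists:
  assumes sep: "separable_space (euclidean :: 'a::complex_hilbert topology)"
    and inf: "\<not> finite_dimensional (UNIV :: 'a set)"
  shows "\<exists>e :: nat \<Rightarrow> 'a. (\<forall>i j. cinner (e i) (e j) = (if i = j then 1 else 0)) \<and>
            (\<forall>x. (\<forall>i. cinner x (e i) = 0) \<longrightarrow> x = 0)"
proof -
  obtain D :: "'a set" where D: "countable D" "closure D = UNIV"
    using sep by (auto simp: separable_space_def)
  define d where "d = from_nat_into D"
  have "D \<noteq> {}" using D(2) by auto
  then have d: "range d = D" using D(1) by (simp add: d_def range_from_nat_into)
  have "\<exists>S. \<forall>n. (finite (S n) \<and> orthonormal (S n)) \<and> (S n \<subseteq> S (Suc n) \<and> d n \<in> cspan (S (Suc n)))"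
  proof (rule dependent_nat_choice)
    show "\<exists>S :: 'a set. finite S \<and> orthonormal S" by (rule exI[of _ "{}"]) (simp add: orthonormal_def)
  next
    fix S :: "'a set" and n assume "finite S \<and> orthonormal S"
    then obtain T where "S \<subseteq> T" "finite T" "orthonormal T" "cspan T = cspan (insert (d n) S)"
      using orthonormal_extend by blast
    then show "\<exists>T. (finite T \<and> orthonormal T) \<and> (S \<subseteq> T \<and> d n \<in> cspan T)"
      by (auto intro: complex_vector.span_base)
  qed
  then obtain S where S: "\<And>n. finite (S n)" "\<And>n. orthonormal (S n)" "\<And>n. S n \<subseteq> S (Suc n)"
    "\<And>n. d n \<in> cspan (S (Suc n))" by blast
  have mono: "S m \<subseteq> S n" if "m \<le> n" for m n using that by (rule lift_Suc_mono_le[of S, OF S(3)])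
  define M where "M = (\<Union>n. S n)"
  have orth: "orthonormal M"
    unfolding orthonormal_def
  proof (intro ballI)
    fix u v assume "u \<in> M" "v \<in> M"
    then obtain m n where "u \<in> S m" "v \<in> S n" by (auto simp: M_def)
    then have "u \<in> S (max m n)" "v \<in> S (max m n)" using mono[of m "max m n"] mono[of n "max m n"] by auto
    then show "cinner u v = (if u = v then 1 else 0)" using S(2) by (auto simp: orthonormal_def)
  qed
  have total: "x = 0" if x: "\<And>u. u \<in> M \<Longrightarrow> cinner x u = 0" for x
  proof -
    have "cinner x (d n) = 0" for n
      using S(4)[of n]
    proof (induction rule: complex_vector.span_induct_alt)
      case (step c y z)
      then show ?case using x[of y] by (auto simp: M_def cinner_add_right cinner_scaleC_right)
    qed simp
    then have "D \<subseteq> {y. cinner x y = 0}" using d by auto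
    moreover have "closed {y. cinner x y = 0}" by (intro closed_Collect_eq continuous_intros)
    ultimately have "closure D \<subseteq> {y. cinner x y = 0}" by (rule closure_minimal)
    then have "cinner x x = 0" unfolding D(2) by blast
    then show ?thesis by simp
  qed
  have "infinite M"
  proof
    assume fin: "finite M"
    have "x \<in> cspan M" for x
    proof -
      let ?p = "\<Sum>u\<in>M. cinner x u *\<^sub>C u"
      have "x - ?p = 0"
        using fin orth by (intro total orthonormal_expansion_residual complex_vector.span_base)
      moreover have "?p \<in> cspan M"
        by (intro complex_vector.span_sum complex_vector.span_scale complex_vector.span_base)
      ultimately show ?thesis by simp
    qed
    then show False using fin inf by (auto simp: finite_dimensional_def)
  qed
  moreover have "countable M" unfolding M_def using S(1) by (auto intro: countable_finite)
  ultimately have bij: "bij_betw (from_nat_into M) UNIV M" by (intro bij_betw_from_nat_into)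
  show ?thesis
  proof (intro exI[of _ "from_nat_into M"] conjI allI impI)
    fix i j
    have "from_nat_into M i = from_nat_into M j \<longleftrightarrow> i = j"
      using bij by (auto simp: bij_betw_def inj_def)
    moreover have "from_nat_into M i \<in> M" "from_nat_into M j \<in> M" using bij by (auto simp: bij_betw_def)
    ultimately show "cinner (from_nat_into M i) (from_nat_into M j) = (if i = j then 1 else 0)"
      using orth by (auto simp: orthonormal_def)
  next
    fix x assume "\<forall>i. cinner x (from_nat_into M i) = 0"
    then show "x = 0" using bij by (intro total) (metis bij_betw_imp_surj_on imageE)
  qed
qed

section \<open>Coercive operators and inversion\<close>

lemma coercive_surj:
  fixes T :: "'a::{real_inner, complete_space} \<Rightarrow>\<^sub>L 'a"
  assumes k: "k > 0" and coercive: "\<And>x. k * (norm x)\<^sup>2 \<le> inner (T x) x"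
  shows "\<exists>x. T x = y"
proof -
  \<comment> \<open>Solutions of \<open>T x = y\<close> are the fixed points of
    \<open>x - p *\<^sub>R (T x - y)\<close>. For a bound \<open>C\<close> of \<open>norm T\<close>
    the squared Lipschitz constant of this map is at most
    \<open>1 - 2 * p * k + p\<^sup>2 * C\<^sup>2\<close>, which \<open>p = k / C\<^sup>2\<close>
    minimizes to \<open>1 - k * p\<close>. Taking \<open>C\<close> above \<open>k\<close> keeps this
    value nonnegative.\<close>
  define C where "C = norm T + k + 1"
  define p where "p = k / C\<^sup>2"
  have C: "C > 0" "norm T \<le> C" "k \<le> C" using k by (auto simp: C_def add_nonneg_pos)
  have p: "p > 0" using k C by (simp add: p_def)
  define q where "q = 1 - k * p"
  have "k * k \<le> C * C" using C k by (intro mult_mono) auto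
  then have kp: "k * p \<le> 1" using C by (simp add: p_def divide_le_eq power2_eq_square)
  have q: "0 \<le> q" "q < 1" using k p kp by (auto simp: q_def)
  have contr: "norm (x - p *\<^sub>R T x) \<le> sqrt q * norm x" for x
  proof (rule power2_le_imp_le)
    have "(norm (x - p *\<^sub>R T x))\<^sup>2 = (norm x)\<^sup>2 - 2 * p * inner (T x) x + p\<^sup>2 * (norm (T x))\<^sup>2"
      unfolding power2_norm_eq_inner
      by (simp add: inner_diff_left inner_diff_right inner_commute power2_eq_square algebra_simps)
    also have "\<dots> \<le> (norm x)\<^sup>2 - 2 * p * (k * (norm x)\<^sup>2) + p\<^sup>2 * (C * norm x)\<^sup>2"
    proof -
      have "norm (T x) \<le> C * norm x"
        using norm_blinfun[of T x] C(2) mult_right_mono[OF C(2) norm_ge_zero[of x]] by linarith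
      then have "(norm (T x))\<^sup>2 \<le> (C * norm x)\<^sup>2" by (intro power_mono) auto
      then have "p\<^sup>2 * (norm (T x))\<^sup>2 \<le> p\<^sup>2 * (C * norm x)\<^sup>2" by (intro mult_left_mono) auto
      moreover have "2 * p * (k * (norm x)\<^sup>2) \<le> 2 * p * inner (T x) x"
        using coercive[of x] p by (intro mult_left_mono) auto
      ultimately show ?thesis by linarith
    qed
    also have "p\<^sup>2 * (C * norm x)\<^sup>2 = p * k * (norm x)\<^sup>2"
      using C by (simp add: p_def power2_eq_square field_simps)
    also have "(norm x)\<^sup>2 - 2 * p * (k * (norm x)\<^sup>2) + p * k * (norm x)\<^sup>2 = q * (norm x)\<^sup>2"
      by (simp add: q_def algebra_simps)
    also have "\<dots> = (sqrt q * norm x)\<^sup>2" using q by (simp add: power_mult_distrib)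
    finally show "(norm (x - p *\<^sub>R T x))\<^sup>2 \<le> (sqrt q * norm x)\<^sup>2" .
  qed (use q in auto)
  have "\<exists>!x. x - p *\<^sub>R (T x - y) = x"
  proof (rule banach_fix_type)
    show "0 \<le> sqrt q" "sqrt q < 1" using q by auto
    show "\<forall>x z. dist (x - p *\<^sub>R (T x - y)) (z - p *\<^sub>R (T z - y)) \<le> sqrt q * dist x z"
    proof (intro allI)
      fix x z
      have "(x - p *\<^sub>R (T x - y)) - (z - p *\<^sub>R (T z - y)) = (x - z) - p *\<^sub>R T (x - z)"
        by (simp add: blinfun.diff_right algebra_simps)
      then show "dist (x - p *\<^sub>R (T x - y)) (z - p *\<^sub>R (T z - y)) \<le> sqrt q * dist x z"
        using contr[of "x - z"] by (simp only: dist_norm)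
    qed
  qed
  then obtain x where "x - p *\<^sub>R (T x - y) = x" by blast
  then have "T x = y" using p by simp
  then show ?thesis by blast
qed

definition bounded_below :: "('a::real_normed_vector \<Rightarrow>\<^sub>L 'b::real_normed_vector) \<Rightarrow> bool"
  where "bounded_below T \<longleftrightarrow> (\<exists>k>0. \<forall>x. k * norm x \<le> norm (T x))"

text \<open>Total, so that inversion can enter continuity statements; it inverts \<open>T\<close> if
  \<open>T\<close> is bounded below and surjective, and its value is arbitrary otherwise.\<close>

definition blinfun_inv :: "('a::real_normed_vector \<Rightarrow>\<^sub>L 'b::real_normed_vector) \<Rightarrow> 'b \<Rightarrow>\<^sub>L 'a"
  where "blinfun_inv T = Blinfun (inv (blinfun_apply T))"

lemma coercive_imp_bounded_below:
  fixes T :: "'a::{real_inner, complete_space} \<Rightarrow>\<^sub>L 'a"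
  assumes k: "k > 0" and coercive: "\<And>x. k * (norm x)\<^sup>2 \<le> inner (T x) x"
  shows "bounded_below T"
proof -
  have "k * norm x \<le> norm (T x)" for x
  proof (cases "x = 0")
    case False
    have "k * (norm x)\<^sup>2 \<le> norm (T x) * norm x"
      using coercive[of x] norm_cauchy_schwarz[of "T x" x] by linarith
    then show ?thesis using False by (simp add: power2_eq_square)
  qed simp
  then show ?thesis using k by (auto simp: bounded_below_def)
qed

lemma bounded_below_inj: "bounded_below T \<Longrightarrow> inj (blinfun_apply T)"
proof (rule injI)
  fix x y assume T: "bounded_below T" and "T x = T y"
  then have "T (x - y) = 0" by (simp add: blinfun.diff_right)
  moreover obtain k where "k > 0" "k * norm (x - y) \<le> norm (T (x - y))"
    using T by (auto simp: bounded_below_def)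
  ultimately have "norm (x - y) \<le> 0" by (simp add: mult_le_0_iff)
  then show "x = y" by simp
qed

lemma blinfun_inv_apply:
  assumes T: "bounded_below T" "surj (blinfun_apply T)"
  shows "blinfun_apply (blinfun_inv T) = inv (blinfun_apply T)"
  unfolding blinfun_inv_def
proof (rule bounded_linear_Blinfun_apply)
  obtain k where k: "k > 0" "\<And>x. k * norm x \<le> norm (T x)"
    using T(1) by (auto simp: bounded_below_def)
  have T_inv: "T (inv (blinfun_apply T) y) = y" for y by (rule surj_f_inv_f[OF T(2)])
  have inv_T: "inv (blinfun_apply T) (T x) = x" for x by (rule inv_f_f[OF bounded_below_inj[OF T(1)]])
  show "bounded_linear (inv (blinfun_apply T))"
  proof (rule bounded_linear_intro[of _ "1 / k"])
    show "inv (blinfun_apply T) (x + y) = inv (blinfun_apply T) x + inv (blinfun_apply T) y" for x y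
      using inv_T[of "inv (blinfun_apply T) x + inv (blinfun_apply T) y"] by (simp add: blinfun.add_right T_inv)
    show "inv (blinfun_apply T) (r *\<^sub>R x) = r *\<^sub>R inv (blinfun_apply T) x" for r x
      using inv_T[of "r *\<^sub>R inv (blinfun_apply T) x"] by (simp add: blinfun.scaleR_right T_inv)
    show "norm (inv (blinfun_apply T) x) \<le> norm x * (1 / k)" for x
      using k(2)[of "inv (blinfun_apply T) x"] k(1) by (simp add: T_inv field_simps)
  qed
qed

lemma blinfun_inv_right: "bounded_below T \<Longrightarrow> surj (blinfun_apply T) \<Longrightarrow> T (blinfun_inv T y) = y"
  by (simp add: blinfun_inv_apply surj_f_inv_f)

lemma blinfun_inv_left: "bounded_below T \<Longrightarrow> surj (blinfun_apply T) \<Longrightarrow> blinfun_inv T (T x) = x"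
  by (simp add: blinfun_inv_apply inv_f_f bounded_below_inj)

lemma norm_blinfun_inv_le:
  assumes "surj (blinfun_apply T)" "k > 0" "\<And>x. k * norm x \<le> norm (T x)"
  shows "norm (blinfun_inv T) \<le> 1 / k"
proof (rule norm_blinfun_bound)
  have "bounded_below T" using assms by (auto simp: bounded_below_def)
  then show "norm (blinfun_inv T y) \<le> 1 / k * norm y" for y
    using assms(3)[of "blinfun_inv T y"] assms(1,2) by (simp add: blinfun_inv_right field_simps)
qed (use assms in simp)

lemma continuous_on_blinfun_inv:
  "continuous_on {T :: 'a::real_normed_vector \<Rightarrow>\<^sub>L 'b::real_normed_vector.
      bounded_below T \<and> surj (blinfun_apply T)} blinfun_inv"
  unfolding continuous_on_iff
proof (intro ballI allI impI)
  fix T :: "'a \<Rightarrow>\<^sub>L 'b" and e :: real assume T: "T \<in> {T. bounded_below T \<and> surj (blinfun_apply T)}" and e: "e > 0"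
  obtain k where k: "k > 0" "\<And>x. k * norm x \<le> norm (T x)"
    using T by (auto simp: bounded_below_def)
  \<comment> \<open>With \<open>d \<le> k / 2\<close>, every \<open>S\<close> within
    \<open>d\<close> of \<open>T\<close> is bounded below by \<open>k / 2\<close>, so its inverse
    has norm at most \<open>2 / k\<close>. The inverses differ by
    \<open>blinfun_inv S o\<^sub>L (T - S) o\<^sub>L blinfun_inv T\<close>, whose norm is below
    \<open>2 / k\<^sup>2 * d\<close>; the other bound on \<open>d\<close> makes this at most
    \<open>e / 2\<close>.\<close>
  define d where "d = min (k / 2) (e * k\<^sup>2 / 4)"
  have d: "d > 0" using k e by (simp add: d_def)
  have "dist (blinfun_inv S) (blinfun_inv T) < e"
    if S: "S \<in> {T. bounded_below T \<and> surj (blinfun_apply T)}" and near: "dist S T < d" for S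
  proof -
    have SxTx: "norm (S x - T x) \<le> norm (S - T) * norm x" for x
      using norm_blinfun[of "S - T" x] by (simp add: blinfun.diff_left)
    have nST: "norm (S - T) < d" using near by (simp add: dist_norm)
    have "k / 2 * norm x \<le> norm (S x)" for x
    proof -
      have "norm (S - T) * norm x \<le> k / 2 * norm x"
        using nST by (intro mult_right_mono) (auto simp: d_def)
      then show ?thesis using k(2)[of x] SxTx[of x] norm_triangle_ineq2[of "T x" "S x"] norm_minus_commute[of "S x" "T x"]
        by (simp add: field_simps)
    qed
    then have nS: "norm (blinfun_inv S) \<le> 2 / k"
      using norm_blinfun_inv_le[of S "k / 2"] S k(1) by simp
    have nT: "norm (blinfun_inv T) \<le> 1 / k" using T k by (intro norm_blinfun_inv_le) auto
    have "norm (blinfun_inv S - blinfun_inv T) \<le> 2 / k\<^sup>2 * norm (S - T)"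
    proof (rule norm_blinfun_bound)
      fix y
      have "(blinfun_inv S - blinfun_inv T) y = blinfun_inv S (T (blinfun_inv T y) - S (blinfun_inv T y))"
        using S T by (simp add: blinfun.diff_left blinfun.diff_right blinfun_inv_left blinfun_inv_right)
      then have "norm ((blinfun_inv S - blinfun_inv T) y) \<le> norm (blinfun_inv S) * norm (T (blinfun_inv T y) - S (blinfun_inv T y))"
        by (simp add: norm_blinfun)
      also have "\<dots> \<le> 2 / k * (norm (S - T) * (1 / k * norm y))"
      proof (intro mult_mono nS)
        have "norm (T (blinfun_inv T y) - S (blinfun_inv T y)) \<le> norm (S - T) * norm (blinfun_inv T y)"
          using SxTx[of "blinfun_inv T y"] by (simp add: norm_minus_commute)
        also have "norm (blinfun_inv T y) \<le> 1 / k * norm y"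
          using norm_blinfun[of "blinfun_inv T" y] mult_right_mono[OF nT norm_ge_zero[of y]] by linarith
        finally show "norm (T (blinfun_inv T y) - S (blinfun_inv T y)) \<le> norm (S - T) * (1 / k * norm y)"
          by (simp add: mult_left_mono)
      qed (use k in auto)
      finally show "norm ((blinfun_inv S - blinfun_inv T) y) \<le> 2 / k\<^sup>2 * norm (S - T) * norm y"
        by (simp add: power2_eq_square mult.assoc)
    qed (use k in auto)
    also have "\<dots> < 2 / k\<^sup>2 * d" using nST k(1) by (intro mult_strict_left_mono) auto
    also have "\<dots> \<le> 2 / k\<^sup>2 * (e * k\<^sup>2 / 4)" using k(1) by (intro mult_left_mono) (auto simp: d_def)
    also have "\<dots> = e / 2" using k(1) by simp
    also have "\<dots> < e" using e by simp
    finally show ?thesis by (simp add: dist_norm)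
  qed
  then show "\<exists>d>0. \<forall>S\<in>{T. bounded_below T \<and> surj (blinfun_apply T)}. dist S T < d \<longrightarrow>
      dist (blinfun_inv S) (blinfun_inv T) < e" using d by blast
qed

section \<open>Reduction of unitary operators\<close>

lemma bounded_opsI:
  fixes A :: "'a::complex_hilbert \<Rightarrow>\<^sub>L 'a"
  shows "(\<And>c x. A (c *\<^sub>C x) = c *\<^sub>C A x) \<Longrightarrow> A \<in> bounded_ops"
  by (simp add: bounded_ops_def)

lemma bounded_ops_scaleC: "A \<in> bounded_ops \<Longrightarrow> A (c *\<^sub>C x) = c *\<^sub>C A x"
  by (simp add: bounded_ops_def)

lemma bounded_ops_id: "id_blinfun \<in> bounded_ops"
  by (simp add: bounded_ops_def)

lemma bounded_ops_compose: "A \<in> bounded_ops \<Longrightarrow> B \<in> bounded_ops \<Longrightarrow> A o\<^sub>L B \<in> bounded_ops"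
  by (simp add: bounded_ops_def)

lemma bounded_ops_add: "A \<in> bounded_ops \<Longrightarrow> B \<in> bounded_ops \<Longrightarrow> A + B \<in> bounded_ops"
  by (simp add: bounded_ops_def blinfun.add_left scaleC_add_right)

lemma bounded_ops_diff: "A \<in> bounded_ops \<Longrightarrow> B \<in> bounded_ops \<Longrightarrow> A - B \<in> bounded_ops"
  by (simp add: bounded_ops_def blinfun.diff_left complex_vector.scale_right_diff_distrib)

lemma bounded_ops_scaleR: "A \<in> bounded_ops \<Longrightarrow> r *\<^sub>R A \<in> bounded_ops"
  by (simp add: bounded_ops_def blinfun.scaleR_left scaleR_scaleC scaleC_scaleC mult.commute)

lemma bounded_ops_inv:
  assumes "T \<in> bounded_ops" "bounded_below T" "surj (blinfun_apply T)"
  shows "blinfun_inv T \<in> bounded_ops"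
proof (rule bounded_opsI)
  fix c x
  show "blinfun_inv T (c *\<^sub>C x) = c *\<^sub>C blinfun_inv T x"
    using blinfun_inv_left[OF assms(2,3), of "c *\<^sub>C blinfun_inv T x"]
    by (simp add: bounded_ops_scaleC[OF assms(1)] blinfun_inv_right[OF assms(2,3)])
qed

section \<open>Unitary operators\<close>

lemma unitary_cinner: "W \<in> unitary_ops \<Longrightarrow> cinner (W x) (W y) = cinner x y"
  by (simp add: unitary_ops_def)

lemma unitary_inner: "W \<in> unitary_ops \<Longrightarrow> inner (W x) (W y) = inner x y"
  by (simp add: inner_eq_Re_cinner unitary_cinner)

lemma unitary_norm: "W \<in> unitary_ops \<Longrightarrow> norm (W x) = norm x"
  by (simp add: norm_eq_sqrt_inner unitary_inner)

lemma unitary_bounded_ops: "W \<in> unitary_ops \<Longrightarrow> W \<in> bounded_ops"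
  by (simp add: unitary_ops_def)

lemma unitary_scaleC: "W \<in> unitary_ops \<Longrightarrow> W (c *\<^sub>C x) = c *\<^sub>C W x"
  by (simp add: unitary_ops_def bounded_ops_def)

lemma unitary_surj: "W \<in> unitary_ops \<Longrightarrow> surj (blinfun_apply W)"
  by (simp add: unitary_ops_def)

lemma unitary_bounded_below: "W \<in> unitary_ops \<Longrightarrow> bounded_below W"
  unfolding bounded_below_def by (intro exI[of _ 1]) (simp add: unitary_norm)

lemma unitary_opsI:
  assumes "W \<in> bounded_ops" "\<And>x. norm (W x) = norm x" "\<And>y. \<exists>x. W x = y"
  shows "W \<in> unitary_ops"
proof -
  have "cinner (W x) (W y) = cinner x y" for x y
    by (rule cinner_eq_of_norm_eq) (simp_all add: assms(2) blinfun.add_right bounded_ops_scaleC[OF assms(1)])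
  then show ?thesis using assms(1,3) by (auto simp: unitary_ops_def surj_def) metis
qed

lemma unitary_inv_right: "W \<in> unitary_ops \<Longrightarrow> W (blinfun_inv W x) = x"
  by (simp add: blinfun_inv_right unitary_bounded_below unitary_surj)

lemma unitary_inv_left: "W \<in> unitary_ops \<Longrightarrow> blinfun_inv W (W x) = x"
  by (simp add: blinfun_inv_left unitary_bounded_below unitary_surj)

lemma unitary_inv: "W \<in> unitary_ops \<Longrightarrow> blinfun_inv W \<in> unitary_ops"
proof (rule unitary_opsI)
  assume W: "W \<in> unitary_ops"
  show "blinfun_inv W \<in> bounded_ops"
    using W by (intro bounded_ops_inv unitary_bounded_ops unitary_bounded_below unitary_surj)
  show "norm (blinfun_inv W x) = norm x" for x
    using unitary_norm[OF W, of "blinfun_inv W x"] by (simp add: unitary_inv_right[OF W])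
  show "\<exists>x. blinfun_inv W x = y" for y using unitary_inv_left[OF W] by blast
qed

lemma unitary_cinner_inv: "W \<in> unitary_ops \<Longrightarrow> cinner (W x) y = cinner x (blinfun_inv W y)"
  using unitary_cinner[of W x "blinfun_inv W y"] by (simp add: unitary_inv_right)

text \<open>Expanding the square turns a lower bound for \<open>1 + W\<close> into one for the real
  part of \<open>W\<close>; all coercivity below comes from here.\<close>

lemma unitary_inner_eq:
  assumes "W \<in> unitary_ops"
  shows "inner (W y) y = (norm (y + W y))\<^sup>2 / 2 - (norm y)\<^sup>2"
  unfolding power2_norm_eq_inner
  by (simp add: inner_add_left inner_add_right inner_commute unitary_inner[OF assms] add_divide_distrib)

section \<open>Stages and the feedback construction\<close>

locale orthogonal_projection =
  fixes Q :: "'a::complex_hilbert \<Rightarrow>\<^sub>L 'a"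
  assumes Q_bounded: "Q \<in> bounded_ops"
    and Q_idem [simp]: "Q (Q x) = Q x"
    and Q_sym: "cinner (Q x) y = cinner x (Q y)"
begin

lemma inner_Q: "inner (Q x) y = inner x (Q y)"
  by (simp add: inner_eq_Re_cinner Q_sym)

lemma norm_split: "(norm x)\<^sup>2 = (norm (Q x))\<^sup>2 + (norm (x - Q x))\<^sup>2"
  using inner_Q[of x x] inner_Q[of "Q x" x]
  by (simp add: power2_norm_eq_inner inner_diff_left inner_diff_right inner_commute)

lemma norm_Q_le: "norm (Q x) \<le> norm x"
  by (rule power2_le_imp_le) (use norm_split[of x] in simp_all)

definition stage :: "('a \<Rightarrow>\<^sub>L 'a) set"
  where "stage = {W \<in> unitary_ops. \<exists>c>0. \<forall>y. c * norm (Q y) \<le> norm (Q y + W (Q y))}"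

lemma stage_unitary: "W \<in> stage \<Longrightarrow> W \<in> unitary_ops"
  by (simp add: stage_def)

text \<open>\<open>W\<close> maps \<open>y + blinfun_inv W y\<close> isometrically to
  \<open>W y + y\<close>. Inverses are wanted because the circuit is inverted by running it
  backwards, with \<open>blinfun_inv W\<close> in place of \<open>W\<close>.\<close>

lemma stage_inv:
  assumes W: "W \<in> stage"
  shows "blinfun_inv W \<in> stage"
proof -
  have u: "W \<in> unitary_ops" by (rule stage_unitary[OF W])
  have "norm (y + blinfun_inv W y) = norm (y + W y)" for y
  proof -
    have "norm (y + blinfun_inv W y) = norm (W (y + blinfun_inv W y))" by (simp add: unitary_norm[OF u])
    then show ?thesis by (simp add: blinfun.add_right unitary_inv_right[OF u] add.commute)
  qed
  then show ?thesis using W unitary_inv[OF u] by (simp add: stage_def)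
qed

lemma openin_stage: "openin (top_of_set unitary_ops) stage"
  unfolding openin_contains_ball
proof (intro conjI ballI)
  fix W assume W: "W \<in> stage"
  then obtain c where c: "c > 0" "\<And>y. c * norm (Q y) \<le> norm (Q y + W (Q y))" by (auto simp: stage_def)
  have "V \<in> stage" if V: "V \<in> unitary_ops" "dist W V < c / 2" for V
  proof -
    have "c / 2 * norm (Q y) \<le> norm (Q y + V (Q y))" for y
    proof -
      have "norm (W (Q y) - V (Q y)) \<le> norm (W - V) * norm (Q y)"
        using norm_blinfun[of "W - V" "Q y"] by (simp add: blinfun.diff_left)
      also have "\<dots> \<le> c / 2 * norm (Q y)" using V(2) by (intro mult_right_mono) (auto simp: dist_norm)
      finally show ?thesis
        using c(2)[of y] norm_triangle_ineq[of "Q y + V (Q y)" "W (Q y) - V (Q y)"] by (simp add: algebra_simps)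
    qed
    then show ?thesis using V(1) c(1) by (auto simp: stage_def intro!: exI[of _ "c / 2"])
  qed
  then show "\<exists>e>0. ball W e \<inter> unitary_ops \<subseteq> stage" using c(1) by (intro exI[of _ "c / 2"]) auto
qed (auto simp: stage_def)

text \<open>The operator of the feedback equation on the range of \<open>Q\<close>, completed by the
  identity on the kernel of \<open>Q\<close> to an operator on the whole space.\<close>

definition compression :: "real \<Rightarrow> ('a \<Rightarrow>\<^sub>L 'a) \<Rightarrow> 'a \<Rightarrow>\<^sub>L 'a"
  where "compression s W = id_blinfun + s *\<^sub>R (Q o\<^sub>L W o\<^sub>L Q)"

lemma compression_apply: "compression s W x = x + s *\<^sub>R Q (W (Q x))"
  by (simp add: compression_def blinfun.bilinear_simps)

lemma compression_coercive:
  assumes W: "W \<in> stage" and s: "s \<in> {0..1}"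
  shows "\<exists>k>0. \<forall>x. k * (norm x)\<^sup>2 \<le> inner (compression s W x) x"
proof -
  obtain c where c: "c > 0" "\<And>y. c * norm (Q y) \<le> norm (Q y + W (Q y))" using W by (auto simp: stage_def)
  \<comment> \<open>The quadratic form is \<open>(norm x)\<^sup>2\<close> plus \<open>s\<close>
    times a term that is at least \<open>(c\<^sup>2 / 2 - 1) * (norm (Q x))\<^sup>2\<close>. Capping
    \<open>k\<close> at 1 makes \<open>k - 1\<close> nonpositive, so that \<open>s\<close> may be
    replaced by 1 and \<open>Q x\<close> by \<open>x\<close>; the bound is uniform in
    \<open>s\<close>.\<close>
  define k where "k = min 1 (c\<^sup>2 / 2)"
  have "k * (norm x)\<^sup>2 \<le> inner (compression s W x) x" for x
  proof -
    have "inner (compression s W x) x = (norm x)\<^sup>2 + s * inner (W (Q x)) (Q x)"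
      by (simp add: compression_apply inner_add_left inner_Q power2_norm_eq_inner)
    also have "\<dots> = (norm x)\<^sup>2 + s * ((norm (Q x + W (Q x)))\<^sup>2 / 2 - (norm (Q x))\<^sup>2)"
      by (simp add: unitary_inner_eq[OF stage_unitary[OF W]])
    finally have e: "inner (compression s W x) x = \<dots>" .
    have "(c * norm (Q x))\<^sup>2 \<le> (norm (Q x + W (Q x)))\<^sup>2"
      using c by (intro power_mono) auto
    moreover have "k * (norm (Q x))\<^sup>2 \<le> c\<^sup>2 / 2 * (norm (Q x))\<^sup>2" by (intro mult_right_mono) (auto simp: k_def)
    ultimately have z: "(k - 1) * (norm (Q x))\<^sup>2 \<le> (norm (Q x + W (Q x)))\<^sup>2 / 2 - (norm (Q x))\<^sup>2"
      by (simp add: power_mult_distrib algebra_simps)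
    have "(k - 1) * (norm x)\<^sup>2 \<le> (k - 1) * (norm (Q x))\<^sup>2"
      using norm_split[of x] by (intro mult_left_mono_neg) (auto simp: k_def)
    also have "\<dots> = 1 * ((k - 1) * (norm (Q x))\<^sup>2)" by simp
    also have "\<dots> \<le> s * ((k - 1) * (norm (Q x))\<^sup>2)"
      using s by (intro mult_right_mono_neg mult_nonpos_nonneg) (auto simp: k_def)
    also have "\<dots> \<le> s * ((norm (Q x + W (Q x)))\<^sup>2 / 2 - (norm (Q x))\<^sup>2)"
      using s z by (intro mult_left_mono) auto
    finally show ?thesis unfolding e by (simp add: algebra_simps)
  qed
  moreover have "k > 0" using c(1) by (simp add: k_def)
  ultimately show ?thesis by blast
qed

lemma compression_invertible:
  assumes "W \<in> stage" "s \<in> {0..1}"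
  shows "bounded_below (compression s W)" "surj (blinfun_apply (compression s W))"
proof -
  obtain k where k: "k > 0" "\<And>x. k * (norm x)\<^sup>2 \<le> inner (compression s W x) x"
    using compression_coercive[OF assms] by blast
  show "bounded_below (compression s W)" by (rule coercive_imp_bounded_below[OF k])
  show "surj (blinfun_apply (compression s W))" using coercive_surj[OF k] by (metis surj_def)
qed

text \<open>The inverse of \<open>1 + s W Q\<close>, written with the inverse of
  \<open>1 + s Q W Q\<close> by the push-through identity; coercivity is available only for the
  latter.\<close>

definition resolvent :: "real \<Rightarrow> ('a \<Rightarrow>\<^sub>L 'a) \<Rightarrow> 'a \<Rightarrow>\<^sub>L 'a"
  where "resolvent s W = id_blinfun - s *\<^sub>R (W o\<^sub>L blinfun_inv (compression s W) o\<^sub>L Q)"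

lemma resolvent_apply: "resolvent s W x = x - s *\<^sub>R W (blinfun_inv (compression s W) (Q x))"
  by (simp add: resolvent_def blinfun.bilinear_simps)

text \<open>Multiplication by \<open>c\<close> on the range of \<open>Q\<close> and the identity on
  its kernel. For \<open>c = sqrt (1 - s\<^sup>2)\<close> this is transmission through the beam
  splitter.\<close>

definition damping :: "real \<Rightarrow> 'a \<Rightarrow>\<^sub>L 'a"
  where "damping c = id_blinfun - (1 - c) *\<^sub>R Q"

lemma damping_apply: "damping c x = x - (1 - c) *\<^sub>R Q x"
  by (simp add: damping_def blinfun.bilinear_simps)

lemma damping_bounded: "damping c \<in> bounded_ops"
  unfolding damping_def by (intro bounded_ops_diff bounded_ops_scaleR bounded_ops_id Q_bounded)

lemma Q_damping [simp]: "Q (damping c x) = c *\<^sub>R Q x"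
  by (simp add: damping_apply blinfun.bilinear_simps algebra_simps)

text \<open>The scattering matrix obtained from \<open>W\<close> by feeding the \<open>Q\<close>-component of its output back into
  its input through a beam splitter with reflection coefficient \<open>s\<close>; see \<open>reduce_apply\<close>.
  For \<open>s = 1\<close> this is the symplectic reduction of the Cayley graph. The form below, a two-sided
  multiple of \<open>W - 1\<close>, makes it evident that operator ideals are respected.\<close>

definition reduce :: "real \<Rightarrow> ('a \<Rightarrow>\<^sub>L 'a) \<Rightarrow> 'a \<Rightarrow>\<^sub>L 'a"
  where "reduce s W = id_blinfun +
     ((damping (sqrt (1 - s\<^sup>2)) o\<^sub>L resolvent s W) o\<^sub>L (W - id_blinfun) o\<^sub>L damping (sqrt (1 - s\<^sup>2) / (1 + s)))"

lemma reduce_eq: "reduce s W v = v + damping (sqrt (1 - s\<^sup>2))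
    (resolvent s W (W (damping (sqrt (1 - s\<^sup>2) / (1 + s)) v) - damping (sqrt (1 - s\<^sup>2) / (1 + s)) v))"
  by (simp add: reduce_def blinfun.bilinear_simps)

context
  fixes W :: "'a \<Rightarrow>\<^sub>L 'a" and s :: real assumes W: "W \<in> stage" and s: "s \<in> {0..1}"
begin

text \<open>The compression commutes with \<open>Q\<close>, so its inverse preserves the range of
  \<open>Q\<close>; on that range \<open>Q\<close> may be dropped from the input of
  \<open>W\<close>.\<close>

lemma compression_Q_inverse:
  "blinfun_inv (compression s W) (Q x) + s *\<^sub>R Q (W (blinfun_inv (compression s W) (Q x))) = Q x"
  "Q (blinfun_inv (compression s W) (Q x)) = blinfun_inv (compression s W) (Q x)"
proof -
  define q where "q = blinfun_inv (compression s W) (Q x)"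
  have q: "q + s *\<^sub>R Q (W (Q q)) = Q x"
    using blinfun_inv_right[OF compression_invertible[OF W s], of "Q x"]
    by (simp add: q_def compression_apply)
  then have "Q q = Q (Q x - s *\<^sub>R Q (W (Q q)))" by (metis add_diff_cancel_right')
  then have "Q q = Q x - s *\<^sub>R Q (W (Q q))" by (simp add: blinfun.bilinear_simps)
  then have "Q q = q" using q by (metis add_diff_cancel_right')
  then show "Q (blinfun_inv (compression s W) (Q x)) = blinfun_inv (compression s W) (Q x)"
    "blinfun_inv (compression s W) (Q x) + s *\<^sub>R Q (W (blinfun_inv (compression s W) (Q x))) = Q x"
    using q by (simp_all add: q_def)
qed

lemma resolvent_left: "resolvent s W (x + s *\<^sub>R W (Q x)) = x"
proof -
  have "compression s W (Q x) = Q (x + s *\<^sub>R W (Q x))"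
    by (simp add: compression_apply blinfun.bilinear_simps)
  then have "blinfun_inv (compression s W) (Q (x + s *\<^sub>R W (Q x))) = Q x"
    by (metis blinfun_inv_left compression_invertible[OF W s])
  then show ?thesis by (simp add: resolvent_apply)
qed

lemma feedback_exists: "\<exists>x. x + s *\<^sub>R Q (W x) = g"
proof -
  \<comment> \<open>For \<open>x = g - s *\<^sub>R q\<close> the equation follows from
    \<open>q + s *\<^sub>R Q (W q) = Q (W g)\<close>, which lives on the range of
    \<open>Q\<close>.\<close>
  define q where "q = blinfun_inv (compression s W) (Q (W g))"
  have "q + s *\<^sub>R Q (W q) = Q (W g)" unfolding q_def by (rule compression_Q_inverse)
  then have "s *\<^sub>R Q (W g) = s *\<^sub>R q + s *\<^sub>R s *\<^sub>R Q (W q)"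
    by (metis scaleR_right_distrib)
  then have "(g - s *\<^sub>R q) + s *\<^sub>R Q (W (g - s *\<^sub>R q)) = g"
    by (simp add: blinfun.bilinear_simps scaleR_right_diff_distrib)
  then show ?thesis by blast
qed

text \<open>Here \<open>x\<close> is the total input of \<open>W\<close> in the closed circuit: the
  transmitted part of \<open>v\<close> minus \<open>s\<close> times the returned
  \<open>Q\<close>-component of the output. Eliminating \<open>x\<close> gives the closed formula
  that defines \<open>reduce\<close>.\<close>

lemma reduce_apply:
  assumes x: "x + s *\<^sub>R Q (W x) = damping (sqrt (1 - s\<^sup>2)) v"
  shows "reduce s W v = damping (sqrt (1 - s\<^sup>2)) (W x) + s *\<^sub>R Q v"
proof -
  define c where "c = sqrt (1 - s\<^sup>2)"
  \<comment> \<open>Since \<open>c * c = (1 - s) * (1 + s)\<close>, the vector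
    \<open>u = damping t v\<close> satisfies both \<open>u + s *\<^sub>R Q u = damping c v\<close>
    and \<open>damping c u = v - s *\<^sub>R Q v\<close>. By the first, \<open>W x - u\<close> is
    the resolvent applied to \<open>W u - u\<close>; by the second,
    \<open>v + damping c (W x - u)\<close> is the output of the circuit.\<close>
  define t where "t = c / (1 + s)"
  define u where "u = damping t v"
  have s2: "s\<^sup>2 \<le> 1" using s by (simp add: power_le_one)
  have c2: "c * c = (1 - s) * (1 + s)" using s2 by (simp add: c_def algebra_simps power2_eq_square)
  have "t * (1 + s) = c" using s by (auto simp: t_def)
  then have cs: "t + s * t = c" by (simp add: algebra_simps)
  have "c * t = (1 - s) * ((1 + s) / (1 + s))" using c2 by (simp add: t_def)
  then have cc: "c * t = 1 - s" using s by simp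
  have Qu: "Q u = t *\<^sub>R Q v" by (simp add: u_def)
  have Dv: "u + s *\<^sub>R Q u = damping c v"
  proof -
    have "u + s *\<^sub>R Q u = v + ((t + s * t) - 1) *\<^sub>R Q v"
      unfolding Qu by (simp add: u_def damping_apply algebra_simps)
    then show ?thesis unfolding cs by (simp add: damping_apply algebra_simps)
  qed
  have Du: "damping c u = v - s *\<^sub>R Q v"
  proof -
    have "damping c u = v + (c * t - 1) *\<^sub>R Q v"
      unfolding damping_apply[of c u] Qu by (simp add: u_def damping_apply algebra_simps)
    then show ?thesis unfolding cc by simp
  qed
  have "W (x + s *\<^sub>R Q (W x)) = W (u + s *\<^sub>R Q u)" using x Dv by (simp add: c_def)
  then have "(W x - u) + s *\<^sub>R W (Q (W x - u)) = W u - u"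
    by (simp add: blinfun.bilinear_simps algebra_simps)
  then have "resolvent s W (W u - u) = W x - u" using resolvent_left[of "W x - u"] by metis
  then have "reduce s W v = v + damping c (W x - u)"
    by (simp add: reduce_eq c_def[symmetric] t_def[symmetric] u_def[symmetric])
  then show ?thesis by (simp add: blinfun.diff_right Du c_def[symmetric])
qed

text \<open>The beam splitter is a rotation matrix with cosine \<open>sqrt (1 - s\<^sup>2)\<close>
  and sine \<open>s\<close>.\<close>

lemma rotation_norm:
  fixes p q :: 'a
  shows "(norm (sqrt (1 - s\<^sup>2) *\<^sub>R p - s *\<^sub>R q))\<^sup>2 + (norm (sqrt (1 - s\<^sup>2) *\<^sub>R q + s *\<^sub>R p))\<^sup>2
      = (norm p)\<^sup>2 + (norm q)\<^sup>2"
proof -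
  define c where "c = sqrt (1 - s\<^sup>2)"
  have "s\<^sup>2 \<le> 1" using s by (simp add: power_le_one)
  then have c: "c\<^sup>2 = 1 - s\<^sup>2" by (simp add: c_def)
  have "(norm (c *\<^sub>R p - s *\<^sub>R q))\<^sup>2 + (norm (c *\<^sub>R q + s *\<^sub>R p))\<^sup>2 = (c\<^sup>2 + s\<^sup>2) * ((norm p)\<^sup>2 + (norm q)\<^sup>2)"
    unfolding power2_norm_eq_inner
    by (simp add: inner_diff_left inner_diff_right inner_add_left inner_add_right inner_commute
        power2_eq_square algebra_simps)
  then show ?thesis unfolding c by (simp add: c_def)
qed

text \<open>Conservation of energy. Let \<open>z = W x\<close> and let \<open>w\<close> be the
  output of the circuit. The \<open>Q\<close>-components of \<open>x\<close> and \<open>w\<close>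
  arise from those of \<open>v\<close> and \<open>z\<close> by a rotation; in the kernel of
  \<open>Q\<close> the components of \<open>x\<close> and \<open>v\<close> agree, and so do those of
  \<open>w\<close> and \<open>z\<close>. Since \<open>norm z = norm x\<close>, the loop cancels from
  the balance.\<close>

lemma reduce_norm: "norm (reduce s W v) = norm v"
proof -
  define c where "c = sqrt (1 - s\<^sup>2)"
  obtain x where x: "x + s *\<^sub>R Q (W x) = damping c v" using feedback_exists by blast
  define z w where "z = W x" and "w = reduce s W v"
  have w: "w = damping c z + s *\<^sub>R Q v" using reduce_apply x by (simp add: w_def z_def c_def)
  have x': "x = damping c v - s *\<^sub>R Q z" using x by (simp add: z_def algebra_simps)
  have "Q x = c *\<^sub>R Q v - s *\<^sub>R Q z" "Q w = c *\<^sub>R Q z + s *\<^sub>R Q v"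
    by (simp_all add: x' w blinfun.bilinear_simps)
  then have "(norm (Q x))\<^sup>2 + (norm (Q w))\<^sup>2 = (norm (Q v))\<^sup>2 + (norm (Q z))\<^sup>2"
    using rotation_norm[of "Q v" "Q z"] by (simp add: c_def)
  moreover have "x - Q x = v - Q v" "w - Q w = z - Q z"
    by (simp_all add: x' w blinfun.bilinear_simps damping_apply algebra_simps)
  moreover have "norm z = norm x" by (simp add: z_def unitary_norm[OF stage_unitary[OF W]])
  ultimately have "(norm w)\<^sup>2 = (norm v)\<^sup>2"
    using norm_split[of x] norm_split[of w] norm_split[of v] norm_split[of z] by simp
  then show ?thesis by (simp add: w_def)
qed

text \<open>The circuit run backwards: the feedback equation for \<open>blinfun_inv W\<close> with
  incoming signal \<open>w\<close> yields the output \<open>z\<close> of \<open>W\<close>, and the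
  inverse rotation recovers \<open>v\<close>.\<close>

lemma reduce_surj: "\<exists>v. reduce s W v = w"
proof -
  define c where "c = sqrt (1 - s\<^sup>2)"
  have "s\<^sup>2 \<le> 1" using s by (simp add: power_le_one)
  then have c: "c * c = 1 - s * s" by (simp add: c_def power2_eq_square[symmetric])
  obtain z where z: "z + s *\<^sub>R Q (blinfun_inv W z) = damping c w"
    using orthogonal_projection.feedback_exists[OF orthogonal_projection_axioms stage_inv[OF W] s] by blast
  define x where "x = blinfun_inv W z"
  have Wx: "W x = z" by (simp add: x_def unitary_inv_right[OF stage_unitary[OF W]])
  have z': "z = damping c w - s *\<^sub>R Q x" using z by (simp add: x_def algebra_simps)
  define v where "v = damping c x + s *\<^sub>R Q w"
  have Qv: "Q v = c *\<^sub>R Q x + s *\<^sub>R Q w" by (simp add: v_def blinfun.bilinear_simps)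
  have Qz: "Q z = c *\<^sub>R Q w - s *\<^sub>R Q x" by (simp add: z' blinfun.bilinear_simps)
  have "damping c v - s *\<^sub>R Q z = x + (c * c + s * s - 1) *\<^sub>R Q x"
    unfolding damping_apply[of c v] Qv Qz by (simp add: v_def damping_apply algebra_simps)
  then have "x + s *\<^sub>R Q (W x) = damping (sqrt (1 - s\<^sup>2)) v"
    unfolding c Wx c_def[symmetric] by (simp add: algebra_simps)
  then have "reduce s W v = damping c z + s *\<^sub>R Q v" unfolding c_def Wx[symmetric] by (rule reduce_apply)
  also have "\<dots> = w + (c * c + s * s - 1) *\<^sub>R Q w"
    unfolding damping_apply[of c z] Qv Qz by (simp add: z' damping_apply algebra_simps)
  finally show ?thesis unfolding c by auto
qed

lemma resolvent_bounded: "resolvent s W \<in> bounded_ops"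
proof -
  have Wb: "W \<in> bounded_ops" by (intro unitary_bounded_ops stage_unitary W)
  then have "compression s W \<in> bounded_ops" unfolding compression_def
    by (intro bounded_ops_add bounded_ops_scaleR bounded_ops_id bounded_ops_compose Q_bounded)
  then have "blinfun_inv (compression s W) \<in> bounded_ops"
    by (intro bounded_ops_inv compression_invertible W s)
  then show ?thesis unfolding resolvent_def
    by (intro bounded_ops_diff bounded_ops_scaleR bounded_ops_id bounded_ops_compose Q_bounded Wb)
qed

lemma reduce_unitary: "reduce s W \<in> unitary_ops"
proof (rule unitary_opsI)
  show "reduce s W \<in> bounded_ops" unfolding reduce_def
    by (intro bounded_ops_add bounded_ops_id bounded_ops_compose damping_bounded resolvent_bounded
        bounded_ops_diff unitary_bounded_ops stage_unitary W)
qed (use reduce_norm reduce_surj in auto)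

text \<open>Keeps the homotopy inside the union of the stages. For \<open>v\<close> in the range of
  \<open>Q\<close>, the sum of input and output has the same component in the kernel of
  \<open>Q\<close> for \<open>W\<close> as for the circuit, and the two \<open>Q\<close>-components
  are proportional with a factor \<open>t \<le> 1\<close>. Hence
  \<open>norm (x + W x) \<le> norm (v + reduce s W v)\<close>.\<close>

lemma reduce_stage: "reduce s W \<in> stage"
proof -
  define c where "c = sqrt (1 - s\<^sup>2)"
  have s2: "s\<^sup>2 \<le> 1" using s by (simp add: power_le_one)
  have c01: "0 \<le> c" "c \<le> 1" by (simp_all add: c_def s2)
  obtain g where g: "g > 0" "\<And>y. g * norm (Q y) \<le> norm (Q y + W (Q y))" using W by (auto simp: stage_def)
  \<comment> \<open>The constant combines two estimates:
    \<open>g * norm x \<le> norm (v + w)\<close>, as \<open>x\<close> lies in the range of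
    \<open>Q\<close>, and \<open>norm v \<le> norm (v + w) + 2 * norm x\<close>, as
    \<open>v + w\<close> is \<open>(1 + s) *\<^sub>R v\<close> plus a damped vector of norm at most
    \<open>2 * norm x\<close>.\<close>
  have main: "norm (Q y) \<le> (1 + 2 / g) * norm (Q y + reduce s W (Q y))" for y
  proof -
    define v where "v = Q y"
    obtain x where x: "x + s *\<^sub>R Q (W x) = damping c v" using feedback_exists by blast
    define z w where "z = W x" and "w = reduce s W v"
    have w: "w = damping c z + s *\<^sub>R v" using reduce_apply x by (simp add: w_def z_def c_def v_def)
    have Qv: "Q v = v" by (simp add: v_def)
    have x': "x = c *\<^sub>R v - s *\<^sub>R Q z" using x Qv by (simp add: z_def damping_apply algebra_simps)
    have Qx: "Q x = x" by (simp add: x' blinfun.bilinear_simps Qv)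
    have nz: "norm z = norm x" by (simp add: z_def unitary_norm[OF stage_unitary[OF W]])
    have vw: "v + w = (v + Q w) + (z - Q z)"
      by (simp add: w blinfun.bilinear_simps Qv damping_apply algebra_simps)
    have xz: "x + z = (x + Q z) + (z - Q z)" by simp
    define t where "t = c / (1 + s)"
    have ts: "t * (1 + s) = c" using s by (simp add: t_def)
    have "c * c = (1 - s) * (1 + s)" using s2 by (simp add: c_def algebra_simps power2_eq_square)
    then have "t * c = (1 - s) * ((1 + s) / (1 + s))" by (simp add: t_def)
    then have tc: "t * c = 1 - s" using s by simp
    have "c \<le> 1 + s" using c01 s by simp
    then have t01: "0 \<le> t" "t \<le> 1" using c01 s by (simp_all add: t_def divide_le_eq)
    have "x + Q z = t *\<^sub>R (v + Q w)"
    proof -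
      have "t *\<^sub>R (v + Q w) = (t * (1 + s)) *\<^sub>R v + (t * c) *\<^sub>R Q z"
        by (simp add: w blinfun.bilinear_simps Qv algebra_simps)
      also have "\<dots> = x + Q z" unfolding ts tc by (simp add: x' algebra_simps)
      finally show ?thesis ..
    qed
    then have "norm (x + Q z) \<le> norm (v + Q w)" using t01 by (simp add: mult_left_le_one_le)
    then have "(norm (x + Q z))\<^sup>2 \<le> (norm (v + Q w))\<^sup>2" by (rule power_mono) simp
    moreover have "Q (x + z) = x + Q z" "x + z - Q (x + z) = z - Q z"
      by (simp_all add: blinfun.add_right Qx)
    moreover have "Q (v + w) = v + Q w" "v + w - Q (v + w) = z - Q z"
      by (simp_all add: vw blinfun.bilinear_simps Qv)
    ultimately have "(norm (x + z))\<^sup>2 \<le> (norm (v + w))\<^sup>2"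
      using norm_split[of "x + z"] norm_split[of "v + w"] by simp
    then have "norm (x + z) \<le> norm (v + w)" by (rule power2_le_imp_le) simp
    moreover have "g * norm x \<le> norm (x + z)" using g(2)[of x] by (simp add: Qx z_def)
    ultimately have nx: "norm x \<le> norm (v + w) / g" using g(1) by (simp add: field_simps)
    have "v + w = (1 + s) *\<^sub>R v + damping c z" by (simp add: w algebra_simps)
    moreover have "norm (damping c z) \<le> 2 * norm z"
    proof -
      have "norm (damping c z) \<le> norm z + norm ((1 - c) *\<^sub>R Q z)"
        unfolding damping_apply by (rule norm_triangle_ineq4)
      also have "norm ((1 - c) *\<^sub>R Q z) \<le> 1 * norm z"
        unfolding norm_scaleR using c01 norm_Q_le[of z] by (intro mult_mono) auto
      finally show ?thesis by simp
    qed
    moreover have "norm v \<le> norm ((1 + s) *\<^sub>R v)" using s mult_right_mono[of 1 "1 + s" "norm v"] by simp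
    ultimately have "norm v \<le> norm (v + w) + 2 * norm x"
      using norm_triangle_ineq4[of "v + w" "damping c z"] nz by simp
    then show ?thesis using nx by (simp add: v_def w_def algebra_simps)
  qed
  have "1 / (1 + 2 / g) * norm (Q y) \<le> norm (Q y + reduce s W (Q y))" for y
    using main[of y] g(1) by (simp add: field_simps)
  then show ?thesis using reduce_unitary g(1)
    by (auto simp: stage_def add_pos_pos intro!: exI[of _ "1 / (1 + 2 / g)"])
qed

text \<open>\<open>W - 1\<close> kills the range of \<open>Q\<close>, so damping its argument has no
  effect; its values lie in the kernel of \<open>Q\<close>, where the resolvent and the outer
  damping are the identity.\<close>

lemma reduce_fixed:
  assumes WQ: "\<And>x. W (Q x) = Q x" and QW: "\<And>x. Q (W x) = Q x"
  shows "reduce s W = W"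
proof (rule blinfun_eqI)
  fix v
  have 1: "W (damping c v) - damping c v = W v - v" for c
    by (simp add: damping_apply blinfun.bilinear_simps WQ)
  have "Q (W v - v) = 0" by (simp add: blinfun.diff_right QW)
  then show "reduce s W v = W v"
    unfolding reduce_eq 1 by (simp add: resolvent_apply damping_apply)
qed

end

lemma reduce_0: "reduce 0 W = W"
  by (rule blinfun_eqI) (simp add: reduce_eq resolvent_apply damping_apply)

text \<open>At \<open>s = 1\<close> both damping constants are 0, and \<open>damping 0\<close> is
  the projection onto the kernel of \<open>Q\<close>. So \<open>reduce 1 W - 1\<close> is supported
  on that kernel, on both sides.\<close>

lemma reduce_1: "reduce 1 W (Q x) = Q x" "Q (reduce 1 W x) = Q x"
  by (simp_all add: reduce_eq damping_apply blinfun.bilinear_simps)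

lemma continuous_on_resolvent:
  "continuous_on ({0..1} \<times> stage) (\<lambda>z. resolvent (fst z) (snd z))"
proof -
  have "continuous_on ({0..1} \<times> stage) (\<lambda>z. blinfun_inv (compression (fst z) (snd z)))"
  proof (rule continuous_on_compose2[OF continuous_on_blinfun_inv])
    show "continuous_on ({0..1} \<times> stage) (\<lambda>z. compression (fst z) (snd z))"
      unfolding compression_def
      by (intro continuous_intros bounded_bilinear.continuous_on[OF bounded_bilinear_blinfun_compose])
  qed (use compression_invertible in auto)
  then show ?thesis unfolding resolvent_def
    by (intro continuous_intros bounded_bilinear.continuous_on[OF bounded_bilinear_blinfun_compose])
qed

lemma continuous_on_damping:
  "continuous_on S f \<Longrightarrow> continuous_on S (\<lambda>z. damping (f z))"
  unfolding damping_def by (intro continuous_intros)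

lemma continuous_on_damping_factors:
  "continuous_on ({0..1} \<times> S) (\<lambda>z. damping (sqrt (1 - (fst z)\<^sup>2)))"
  "continuous_on ({0..1} \<times> S) (\<lambda>z. damping (sqrt (1 - (fst z)\<^sup>2) / (1 + fst z)))"
  by (intro continuous_on_damping continuous_intros; force)+

lemma continuous_on_reduce: "continuous_on ({0..1} \<times> stage) (\<lambda>z. reduce (fst z) (snd z))"
  unfolding reduce_def
  by (intro continuous_intros bounded_bilinear.continuous_on[OF bounded_bilinear_blinfun_compose]
      continuous_on_resolvent continuous_on_damping_factors)

end

lemma stage_mono:
  assumes "orthogonal_projection Q" "orthogonal_projection Q'" and QQ': "\<And>x. Q (Q' x) = Q' x"
  shows "orthogonal_projection.stage Q \<subseteq> orthogonal_projection.stage Q'"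
  using QQ' unfolding orthogonal_projection.stage_def[OF assms(1)] orthogonal_projection.stage_def[OF assms(2)]
  by (smt (verit) Collect_mono_iff)

section \<open>Weak equivalences from the stable unitary group\<close>

lemma U_fin_Suc: "U_fin n \<subseteq> U_fin (Suc n)"
proof
  fix A assume "A \<in> U_fin n"
  then have A: "\<And>i k. \<not> (i < n \<and> k < n) \<Longrightarrow> A i k = (if i = k then 1 else 0)"
    and col: "\<And>i k. i < n \<Longrightarrow> k < n \<Longrightarrow> (\<Sum>l<n. cnj (A l i) * A l k) = (if i = k then 1 else 0)"
    and row: "\<And>i k. i < n \<Longrightarrow> k < n \<Longrightarrow> (\<Sum>l<n. A i l * cnj (A k l)) = (if i = k then 1 else 0)"
    unfolding U_fin_def by blast+
  have "(\<Sum>l<Suc n. cnj (A l i) * A l k) = (if i = k then 1 else 0)" if "i < Suc n" "k < Suc n" for i k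
    using that col[of i k] A[of n i] A[of n k] A[of _ n]
    by (cases "i = n"; cases "k = n") (auto simp: less_Suc_eq)
  moreover have "(\<Sum>l<Suc n. A i l * cnj (A k l)) = (if i = k then 1 else 0)" if "i < Suc n" "k < Suc n" for i k
    using that row[of i k] A[of i n] A[of k n] A[of n]
    by (cases "i = n"; cases "k = n") (auto simp: less_Suc_eq)
  moreover have "A i k = (if i = k then 1 else 0)" if "\<not> (i < Suc n \<and> k < Suc n)" for i k
    using A[of i k] that by auto
  ultimately show "A \<in> U_fin (Suc n)" unfolding U_fin_def by blast
qed

lemma U_fin_mono: "m \<le> n \<Longrightarrow> U_fin m \<subseteq> U_fin n"
  by (rule lift_Suc_mono_le[of U_fin]) (rule U_fin_Suc)

lemma topspace_U_infinity: "topspace U_infinity_topology = (\<Union>n. U_fin n)"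
proof -
  have "U_fin m \<inter> (\<Union>n. U_fin n) = U_fin m" for m by blast
  then have "openin U_infinity_topology (\<Union>n. U_fin n)"
    by (simp add: openin_U_infinity_topology Int_commute)
  then show ?thesis
    by (auto simp: topspace_def openin_U_infinity_topology)
qed

lemma continuous_map_U_fin_U_infinity: "continuous_map (top_of_set (U_fin n)) U_infinity_topology (\<lambda>A. A)"
  unfolding continuous_map_def
  by (auto simp: topspace_U_infinity openin_U_infinity_topology Collect_conj_eq Int_commute)

lemma continuous_map_from_U_infinity:
  assumes "\<And>n. continuous_map (top_of_set (U_fin n)) X f"
  shows "continuous_map U_infinity_topology X f"
  unfolding continuous_map_def openin_U_infinity_topology topspace_U_infinity
proof (intro conjI allI impI)
  show "f \<in> (\<Union>n. U_fin n) \<rightarrow> topspace X"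
    using assms unfolding continuous_map_def by auto
next
  fix W n assume W: "openin X W"
  have "{x \<in> \<Union>n. U_fin n. f x \<in> W} \<inter> U_fin n = {x \<in> U_fin n. f x \<in> W}" by blast
  then show "openin (top_of_set (U_fin n)) ({x \<in> \<Union>n. U_fin n. f x \<in> W} \<inter> U_fin n)"
    using assms[of n] W unfolding continuous_map_def by simp
qed auto

text \<open>The lower bound \<open>m\<close> allows the stage to be enlarged until prescribed
  matrices belong to \<open>U_fin n\<close> as well.\<close>

lemma compactin_increasing_cover:
  fixes V :: "nat \<Rightarrow> 'b set"
  assumes "compactin X K" "\<And>n. openin X (V n)" "\<And>n. V n \<subseteq> V (Suc n)" "K \<subseteq> (\<Union>n. V n)"
  shows "\<exists>n\<ge>m. K \<subseteq> V n"
proof -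
  obtain F where F: "finite F" "F \<subseteq> range V" "K \<subseteq> \<Union>F"
    using compactinD[OF assms(1), of "range V"] assms(2,4) by auto
  then obtain I where I: "finite I" "F = V ` I"
    by (meson finite_subset_image)
  have mono: "V i \<subseteq> V k" if "i \<le> k" for i k
    using that by (rule lift_Suc_mono_le[of V, OF assms(3)])
  have "K \<subseteq> V (Max (insert m I))"
  proof
    fix x assume "x \<in> K"
    then obtain i where "i \<in> I" "x \<in> V i" using F I by auto
    then show "x \<in> V (Max (insert m I))" using mono[of i "Max (insert m I)"] I by auto
  qed
  then show ?thesis using I by (intro exI[of _ "Max (insert m I)"]) auto
qed

lemma compactin_U_infinity:
  assumes K: "compactin U_infinity_topology K"
  shows "\<exists>n. K \<subseteq> U_fin n"
proof (rule ccontr)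
  assume "\<not> ?thesis"
  then have "\<forall>n. \<exists>u. u \<in> K \<and> u \<notin> U_fin n" by blast
  then obtain u where u: "\<And>n. u n \<in> K" "\<And>n. u n \<notin> U_fin n" by metis
  \<comment> \<open>Each \<open>U_fin m\<close> contains \<open>u k\<close> only for
    \<open>k < m\<close>, so every tail of the sequence meets it in a finite, hence closed, set. The
    complements \<open>V n\<close> of the tails form an increasing open cover, yet
    \<open>u n\<close> escapes \<open>V n\<close>.\<close>
  define V where "V n = (\<Union>n. U_fin n) - u ` {n..}" for n
  have "openin (top_of_set (U_fin m)) (V n \<inter> U_fin m)" for m n
  proof -
    have sub: "u ` {n..} \<inter> U_fin m \<subseteq> u ` {..<m}"
    proof
      fix x assume "x \<in> u ` {n..} \<inter> U_fin m"
      then obtain k where k: "x = u k" "u k \<in> U_fin m" by auto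
      have "k < m"
      proof (rule ccontr)
        assume "\<not> k < m"
        then show False using U_fin_mono[of m k] k u(2)[of k] by auto
      qed
      then show "x \<in> u ` {..<m}" using k by auto
    qed
    have "closed (u ` {n..} \<inter> U_fin m)"
      using finite_subset[OF sub] by (intro finite_imp_closed) auto
    moreover have "V n \<inter> U_fin m = U_fin m \<inter> - (u ` {n..} \<inter> U_fin m)"
      unfolding V_def by auto
    ultimately show ?thesis by (metis openin_open open_Compl)
  qed
  then have "openin U_infinity_topology (V n)" for n
    unfolding openin_U_infinity_topology by (auto simp: V_def)
  moreover have "V n \<subseteq> V (Suc n)" for n unfolding V_def by auto
  moreover have "K \<subseteq> (\<Union>n. V n)"
  proof
    fix x assume "x \<in> K"
    then obtain m where m: "x \<in> U_fin m"
      using compactin_subset_topspace[OF K] by (auto simp: topspace_U_infinity)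
    have "x \<notin> u ` {m..}" using m u(2) U_fin_mono[of m] by auto
    then show "x \<in> (\<Union>n. V n)" using m by (auto simp: V_def)
  qed
  ultimately obtain n where "K \<subseteq> V n"
    using compactin_increasing_cover[OF K] by blast
  moreover have "u n \<notin> V n" by (auto simp: V_def)
  ultimately show False using u(1) by blast
qed

section \<open>Spheres and homotopy classes\<close>

lemma compact_space_nsphere: "compact_space (nsphere n)"
proof -
  let ?S = "{x :: nat \<Rightarrow> real. (\<Sum>i\<le>n. x i ^ 2) = 1 \<and> (\<forall>i>n. x i = 0)}"
  \<comment> \<open>The sphere is a closed subset of an infinite-dimensional cube, compact by
    Tychonoff.\<close>
  have "compactin (powertop_real UNIV) (PiE UNIV (\<lambda>i::nat. {-1..1}))"
    by (simp add: compactin_PiE)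
  moreover have "closed ?S"
  proof -
    have c: "continuous_on UNIV (\<lambda>x::nat \<Rightarrow> real. x i)" for i
      by (rule continuous_on_product_coordinates)
    have "?S = {x. (\<Sum>i\<le>n. x i ^ 2) = 1} \<inter> (\<Inter>i\<in>{n<..}. {x. x i = 0})" by auto
    also have "closed \<dots>"
      by (intro closed_Int closed_INT ballI closed_Collect_eq continuous_intros c)
    finally show ?thesis .
  qed
  then have "closedin (powertop_real UNIV) ?S"
    by (simp add: euclidean_product_topology)
  moreover have "?S \<subseteq> PiE UNIV (\<lambda>i. {-1..1})"
  proof
    fix x assume x: "x \<in> ?S"
    have "x i \<in> {-1..1}" for i
    proof (cases "i \<le> n")
      case True
      then have "x i ^ 2 \<le> (\<Sum>i\<le>n. x i ^ 2)"
        by (intro member_le_sum) auto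
      then have "x i ^ 2 \<le> 1" using x by simp
      then show ?thesis using abs_square_le_1[of "x i"] by (auto simp: abs_le_iff)
    next
      case False
      then show ?thesis using x by auto
    qed
    then show "x \<in> PiE UNIV (\<lambda>i. {-1..1})" by auto
  qed
  ultimately have "compactin (powertop_real UNIV) ?S"
    using closed_compactin by blast
  then show ?thesis unfolding nsphere by (rule compact_space_subtopology)
qed

lemma sphere_base_in_nsphere: "sphere_base \<in> topspace (nsphere n)"
  unfolding sphere_base_def by (rule in_topspace_nsphere)

lemma equiv_based_homotopy: "equiv (based_maps n X a) (based_homotopy n X a)"
proof (rule equivI)
  show "based_homotopy n X a \<subseteq> based_maps n X a \<times> based_maps n X a"
    by (auto simp: based_homotopy_def)
  show "refl_on (based_maps n X a) (based_homotopy n X a)"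
    by (auto simp: refl_on_def based_homotopy_def based_maps_def)
  show "sym (based_homotopy n X a)"
    by (auto simp: sym_def based_homotopy_def intro: homotopic_with_symD)
  show "trans (based_homotopy n X a)"
    by (auto simp: trans_def based_homotopy_def intro: homotopic_with_trans)
qed

lemma based_maps_compose:
  assumes "continuous_map X Y f" "g \<in> based_maps n X a"
  shows "f \<circ> g \<in> based_maps n Y (f a)"
  using assms by (auto simp: based_maps_def intro: continuous_map_compose)

text \<open>\<open>induced_map\<close> unites the classes of all composites; as composition with
  \<open>f\<close> preserves based homotopy, they form a single class.\<close>

lemma induced_map_class:
  assumes f: "continuous_map X Y f" and g: "g \<in> based_maps n X a"
  shows "induced_map n Y f a (based_homotopy n X a `` {g}) = based_homotopy n Y (f a) `` {f \<circ> g}"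
proof -
  have "based_homotopy n Y (f a) `` {f \<circ> h} = based_homotopy n Y (f a) `` {f \<circ> g}"
    if "(g, h) \<in> based_homotopy n X a" for h
  proof (rule equiv_class_eq[OF equiv_based_homotopy])
    have "homotopic_with (\<lambda>k. k sphere_base = f a) (nsphere n) Y (f \<circ> h) (f \<circ> g)"
      using that
      by (intro homotopic_with_compose_continuous_map_left[OF _ f, where p = "\<lambda>k. k sphere_base = a"])
         (auto simp: based_homotopy_def intro: homotopic_with_symD)
    then show "(f \<circ> h, f \<circ> g) \<in> based_homotopy n Y (f a)"
      using that based_maps_compose[OF f] by (auto simp: based_homotopy_def)
  qed
  moreover have "(g, g) \<in> based_homotopy n X a"
    using g by (auto simp: based_homotopy_def based_maps_def)
  ultimately show ?thesis unfolding induced_map_def by blast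
qed

text \<open>Bijectivity on quotients is restated for representatives: maps whose images are
  homotopic in \<open>Y\<close> are homotopic in \<open>X\<close>, and every based map into
  \<open>Y\<close> deforms to an image.\<close>

lemma weak_homotopy_equivalenceI:
  assumes f: "continuous_map X Y f"
    and inj0: "\<And>x y. x \<in> topspace X \<Longrightarrow> y \<in> topspace X \<Longrightarrow> path_component_of Y (f x) (f y) \<Longrightarrow>
                 path_component_of X x y"
    and surj0: "\<And>y. y \<in> topspace Y \<Longrightarrow> \<exists>x\<in>topspace X. path_component_of Y (f x) y"
    and inj: "\<And>n a g h. a \<in> topspace X \<Longrightarrow> g \<in> based_maps n X a \<Longrightarrow> h \<in> based_maps n X a \<Longrightarrow>
                homotopic_with (\<lambda>k. k sphere_base = f a) (nsphere n) Y (f \<circ> g) (f \<circ> h) \<Longrightarrow>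
                homotopic_with (\<lambda>k. k sphere_base = a) (nsphere n) X g h"
    and surj: "\<And>n a g. a \<in> topspace X \<Longrightarrow> g \<in> based_maps n Y (f a) \<Longrightarrow>
                \<exists>h\<in>based_maps n X a. homotopic_with (\<lambda>k. k sphere_base = f a) (nsphere n) Y (f \<circ> h) g"
  shows "weak_homotopy_equivalence X Y f"
  unfolding weak_homotopy_equivalence_def
proof (intro conjI allI impI ballI)
  show "continuous_map X Y f" by (rule f)
next
  let ?F = "\<lambda>C. {y. \<exists>x\<in>C. path_component_of Y (f x) y}"
  have fX: "f x \<in> topspace Y" if "x \<in> topspace X" for x
    using f that by (auto simp: continuous_map_def)
  have map: "path_component_of Y (f x) (f y)" if "path_component_of X x y" for x y
  proof -
    from that obtain p where p: "pathin X p" "p 0 = x" "p 1 = y"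
      unfolding path_component_of_def by blast
    show ?thesis unfolding path_component_of_def
      by (rule exI[of _ "f \<circ> p"]) (use p pathin_compose[OF p(1) f] in auto)
  qed
  have F: "?F (Collect (path_component_of X x)) = Collect (path_component_of Y (f x))"
    if "x \<in> topspace X" for x
    using that map path_component_of_refl[of X x] path_component_of_trans[of Y] by blast
  show "bij_betw ?F (path_components_of X) (path_components_of Y)"
    unfolding bij_betw_def
  proof
    show "inj_on ?F (path_components_of X)"
    proof (rule inj_onI)
      fix C D assume "C \<in> path_components_of X" "D \<in> path_components_of X" and eq: "?F C = ?F D"
      then obtain x y where x: "x \<in> topspace X" "C = Collect (path_component_of X x)"
        and y: "y \<in> topspace X" "D = Collect (path_component_of X y)"
        unfolding path_components_of_def by blast
      have "Collect (path_component_of Y (f x)) = Collect (path_component_of Y (f y))"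
        using eq F x y by simp
      then have "path_component_of Y (f x) (f y)"
        using fX[OF y(1)] path_component_of_refl[of Y "f y"] by blast
      then have "path_component_of X x y" using inj0 x y by blast
      then show "C = D" using x y by (simp add: path_component_of_equiv)
    qed
    show "?F ` path_components_of X = path_components_of Y"
    proof (intro subset_antisym subsetI)
      fix D assume "D \<in> ?F ` path_components_of X"
      then show "D \<in> path_components_of Y"
        using F fX unfolding path_components_of_def by auto
    next
      fix D assume "D \<in> path_components_of Y"
      then obtain y where y: "y \<in> topspace Y" "D = Collect (path_component_of Y y)"
        unfolding path_components_of_def by blast
      obtain x where x: "x \<in> topspace X" "path_component_of Y (f x) y"
        using surj0 y by blast
      then have "D = ?F (Collect (path_component_of X x))"
        using F[OF x(1)] y by (simp add: path_component_of_equiv)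
      then show "D \<in> ?F ` path_components_of X"
        using x unfolding path_components_of_def by blast
    qed
  qed
next
  fix n :: nat and a assume a: "a \<in> topspace X"
  show "bij_betw (induced_map n Y f a) (homotopy_classes n X a) (homotopy_classes n Y (f a))"
    unfolding bij_betw_def
  proof
    show "inj_on (induced_map n Y f a) (homotopy_classes n X a)"
    proof (rule inj_onI)
      fix C D assume "C \<in> homotopy_classes n X a" "D \<in> homotopy_classes n X a"
        and eq: "induced_map n Y f a C = induced_map n Y f a D"
      then obtain g h where g: "g \<in> based_maps n X a" "C = based_homotopy n X a `` {g}"
        and h: "h \<in> based_maps n X a" "D = based_homotopy n X a `` {h}"
        unfolding homotopy_classes_def quotient_def by auto
      have "based_homotopy n Y (f a) `` {f \<circ> g} = based_homotopy n Y (f a) `` {f \<circ> h}"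
        using eq g h induced_map_class[OF f] by simp
      then have "(f \<circ> g, f \<circ> h) \<in> based_homotopy n Y (f a)"
        using equiv_based_homotopy[of n Y "f a"] based_maps_compose[OF f h(1)]
        by (simp add: eq_equiv_class)
      then have "homotopic_with (\<lambda>k. k sphere_base = a) (nsphere n) X g h"
        using inj[OF a g(1) h(1)] by (simp add: based_homotopy_def)
      then have "(g, h) \<in> based_homotopy n X a"
        using g h by (simp add: based_homotopy_def)
      then show "C = D" unfolding g(2) h(2) by (rule equiv_class_eq[OF equiv_based_homotopy])
    qed
    show "induced_map n Y f a ` homotopy_classes n X a = homotopy_classes n Y (f a)"
    proof (intro subset_antisym subsetI)
      fix D assume "D \<in> induced_map n Y f a ` homotopy_classes n X a"
      then obtain g where "g \<in> based_maps n X a" "D = induced_map n Y f a (based_homotopy n X a `` {g})"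
        unfolding homotopy_classes_def quotient_def by auto
      then show "D \<in> homotopy_classes n Y (f a)"
        using induced_map_class[OF f] based_maps_compose[OF f]
        by (auto simp: homotopy_classes_def intro: quotientI)
    next
      fix D assume "D \<in> homotopy_classes n Y (f a)"
      then obtain g where g: "g \<in> based_maps n Y (f a)" "D = based_homotopy n Y (f a) `` {g}"
        unfolding homotopy_classes_def quotient_def by auto
      obtain h where h: "h \<in> based_maps n X a"
        "homotopic_with (\<lambda>k. k sphere_base = f a) (nsphere n) Y (f \<circ> h) g"
        using surj[OF a g(1)] by blast
      have "(f \<circ> h, g) \<in> based_homotopy n Y (f a)"
        using h g based_maps_compose[OF f h(1)] by (simp add: based_homotopy_def)
      then have "D = induced_map n Y f a (based_homotopy n X a `` {h})"
        using induced_map_class[OF f h(1)] g(2) equiv_class_eq[OF equiv_based_homotopy] by metis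
      then show "D \<in> induced_map n Y f a ` homotopy_classes n X a"
        using h(1) unfolding homotopy_classes_def by (auto intro: quotientI)
    qed
  qed
qed

section \<open>The abstract retraction criterion\<close>

locale stage_retraction =
  fixes X :: "'b topology" and j :: "(nat \<Rightarrow> nat \<Rightarrow> complex) \<Rightarrow> 'b"
    and V :: "nat \<Rightarrow> 'b set" and r :: "nat \<Rightarrow> 'b \<Rightarrow> nat \<Rightarrow> nat \<Rightarrow> complex"
    and H :: "nat \<Rightarrow> real \<times> 'b \<Rightarrow> 'b"
  assumes open_stage: "openin X (V n)"
    and stage_Suc: "V n \<subseteq> V (Suc n)"
    and stage_cover: "topspace X \<subseteq> (\<Union>n. V n)"
    and continuous_j: "continuous_map (top_of_set (U_fin n)) X j"
    and j_stage: "A \<in> U_fin n \<Longrightarrow> j A \<in> V n"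
    and continuous_r: "continuous_map (subtopology X (V n)) (top_of_set (U_fin n)) (r n)"
    and r_j: "A \<in> U_fin n \<Longrightarrow> r n (j A) = A"
    and continuous_H:
      "continuous_map (prod_topology (top_of_set {0..1}) (subtopology X (V n))) X (H n)"
    and H_0: "x \<in> V n \<Longrightarrow> H n (0, x) = x"
    and H_1: "x \<in> V n \<Longrightarrow> H n (1, x) = j (r n x)"
    and H_j: "A \<in> U_fin n \<Longrightarrow> t \<in> {0..1} \<Longrightarrow> H n (t, j A) = j A"
begin

text \<open>Injectivity: a path or homotopy between images under \<open>j\<close> has compact range,
  so it lies in one \<open>V n\<close>, and \<open>r n\<close> carries it back, being a left inverse
  of \<open>j\<close> on \<open>U_fin n\<close>. Surjectivity: \<open>H n\<close> deforms a map
  \<open>g\<close> into \<open>V n\<close> to \<open>j \<circ> (r n \<circ> g)\<close>, and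
  \<open>H_j\<close> keeps the base point in place.\<close>

lemma weak_homotopy_equivalence_j: "weak_homotopy_equivalence U_infinity_topology X j"
proof (rule weak_homotopy_equivalenceI)
  have stage: "\<exists>n\<ge>m. K \<subseteq> V n" if "compactin X K" for K m
    using compactin_increasing_cover[where V = V and m = m, OF that open_stage stage_Suc]
      compactin_subset_topspace[OF that] stage_cover by blast
  have rU: "continuous_map (subtopology X (V n)) U_infinity_topology (r n)" for n
    using continuous_map_compose[OF continuous_r continuous_map_U_fin_U_infinity] by (simp add: o_def)
  show cj: "continuous_map U_infinity_topology X j"
    by (intro continuous_map_from_U_infinity continuous_j)
  show "path_component_of U_infinity_topology A B"
    if A: "A \<in> topspace U_infinity_topology" and B: "B \<in> topspace U_infinity_topology"
      and path: "path_component_of X (j A) (j B)" for A B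
  proof -
    obtain p where p: "pathin X p" "p 0 = j A" "p 1 = j B"
      using path unfolding path_component_of_def by blast
    obtain k l where kl: "A \<in> U_fin k" "B \<in> U_fin l"
      using A B by (auto simp: topspace_U_infinity)
    have "compactin X (p ` {0..1})"
      using p(1) unfolding pathin_def by (rule image_compactin[rotated]) (simp add: compactin_subtopology)
    then obtain n where n: "n \<ge> max k l" "p ` {0..1} \<subseteq> V n" using stage by blast
    have AB: "A \<in> U_fin n" "B \<in> U_fin n"
      using kl n(1) U_fin_mono[of k n] U_fin_mono[of l n] by auto
    have "pathin (subtopology X (V n)) p"
      using p(1) n(2) by (auto simp: pathin_subtopology)
    then have "pathin U_infinity_topology (r n \<circ> p)"
      by (rule pathin_compose[OF _ rU])
    then show ?thesis unfolding path_component_of_def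
      by (intro exI[of _ "r n \<circ> p"]) (simp add: p AB r_j)
  qed
  show "\<exists>A\<in>topspace U_infinity_topology. path_component_of X (j A) x" if x: "x \<in> topspace X" for x
  proof -
    obtain n where n: "x \<in> V n" using x stage_cover by blast
    have "continuous_map (top_of_set {0..1::real})
             (prod_topology (top_of_set {0..1}) (subtopology X (V n))) (\<lambda>t. (t, x))"
      using x n by (intro continuous_map_pairedI) auto
    from continuous_map_compose[OF this continuous_H]
    have "pathin X (\<lambda>t. H n (t, x))" by (simp add: pathin_def o_def)
    then have "path_component_of X x (j (r n x))"
      unfolding path_component_of_def by (intro exI[of _ "\<lambda>t. H n (t, x)"]) (simp add: H_0 H_1 n)
    moreover have "r n x \<in> topspace U_infinity_topology"
      using continuous_map_funspace[OF rU, of n] x n by auto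
    ultimately show ?thesis using path_component_of_sym by metis
  qed
  show "homotopic_with (\<lambda>k. k sphere_base = a) (nsphere n) U_infinity_topology g h"
    if a: "a \<in> topspace U_infinity_topology"
      and g: "g \<in> based_maps n U_infinity_topology a" and h: "h \<in> based_maps n U_infinity_topology a"
      and hom: "homotopic_with (\<lambda>k. k sphere_base = j a) (nsphere n) X (j \<circ> g) (j \<circ> h)" for n a g h
  proof -
    have fin: "\<exists>m. f ` topspace (nsphere n) \<subseteq> U_fin m" if "f \<in> based_maps n U_infinity_topology a" for f
      using that compact_space_nsphere[of n]
      by (intro compactin_U_infinity image_compactin[of "nsphere n"]) (auto simp: based_maps_def compact_space_def)
    obtain k l where kl: "g ` topspace (nsphere n) \<subseteq> U_fin k" "h ` topspace (nsphere n) \<subseteq> U_fin l"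
      using fin[OF g] fin[OF h] by blast
    obtain G :: "real \<times> (nat \<Rightarrow> real) \<Rightarrow> 'b" where G: "continuous_map (prod_topology (top_of_set {0..1}) (nsphere n)) X G"
      "\<And>x. G (0, x) = j (g x)" "\<And>x. G (1, x) = j (h x)" "\<And>t. t \<in> {0..1} \<Longrightarrow> G (t, sphere_base) = j a"
      using hom unfolding homotopic_with_def by force
    have "compactin X (G ` topspace (prod_topology (top_of_set {0..1}) (nsphere n)))"
      by (rule image_compactin[OF _ G(1)])
         (simp only: compact_space_def[symmetric] compact_space_prod_topology, simp add: compact_space_nsphere compact_space_subtopology)
    then obtain m where m: "m \<ge> max k l" "G ` topspace (prod_topology (top_of_set {0..1}) (nsphere n)) \<subseteq> V m"
      using stage by blast
    have gh: "g x \<in> U_fin m" "h x \<in> U_fin m" if "x \<in> topspace (nsphere n)" for x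
      using kl m(1) U_fin_mono[of k m] U_fin_mono[of l m] that by auto
    have am: "a \<in> U_fin m"
      using gh(1)[OF sphere_base_in_nsphere] g by (simp add: based_maps_def)
    have "continuous_map (prod_topology (top_of_set {0..1}) (nsphere n)) (subtopology X (V m)) G"
      using G(1) m(2) by (auto simp: continuous_map_in_subtopology)
    from continuous_map_compose[OF this rU]
    have c: "continuous_map (prod_topology (top_of_set {0..1}) (nsphere n)) U_infinity_topology (r m \<circ> G)" .
    \<comment> \<open>\<open>homotopic_with\<close> asks for endpoints equal as functions on the
      whole type, whereas \<open>r m \<circ> G\<close> is controlled only over the sphere. Agreement
      there suffices because the condition on the base point only looks at a point of the
      sphere.\<close>
    show ?thesis
    proof (subst homotopic_with)
      show "(p sphere_base = a) = (q sphere_base = a)"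
        if "\<And>x. x \<in> topspace (nsphere n) \<Longrightarrow> p x = q x" for p q
        using that[OF sphere_base_in_nsphere] by simp
      show "\<exists>F. continuous_map (prod_topology (top_of_set {0..1::real}) (nsphere n)) U_infinity_topology F \<and>
           (\<forall>x\<in>topspace (nsphere n). F (0, x) = g x) \<and> (\<forall>x\<in>topspace (nsphere n). F (1, x) = h x) \<and>
           (\<forall>t\<in>{0..1}. F (t, sphere_base) = a)"
        by (rule exI[of _ "r m \<circ> G"]) (use c G gh r_j am in auto)
    qed
  qed
  show "\<exists>h\<in>based_maps n U_infinity_topology a.
          homotopic_with (\<lambda>k. k sphere_base = j a) (nsphere n) X (j \<circ> h) g"
    if a: "a \<in> topspace U_infinity_topology" and g: "g \<in> based_maps n X (j a)" for n a g
  proof -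
    have cg: "continuous_map (nsphere n) X g" and ga: "g sphere_base = j a"
      using g by (auto simp: based_maps_def)
    obtain k where k: "a \<in> U_fin k" using a by (auto simp: topspace_U_infinity)
    have "compactin X (g ` topspace (nsphere n))"
      using compact_space_nsphere[of n] by (intro image_compactin[OF _ cg]) (simp add: compact_space_def)
    then obtain m where m: "m \<ge> k" "g ` topspace (nsphere n) \<subseteq> V m" using stage by blast
    have am: "a \<in> U_fin m" using k U_fin_mono[OF m(1)] by auto
    have cgV: "continuous_map (nsphere n) (subtopology X (V m)) g"
      using cg m(2) by (auto simp: continuous_map_in_subtopology)
    have h: "r m \<circ> g \<in> based_maps n U_infinity_topology a"
      using continuous_map_compose[OF cgV rU] by (simp add: based_maps_def ga r_j am)
    have "continuous_map (prod_topology (top_of_set {0..1}) (nsphere n))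
       (prod_topology (top_of_set {0..1}) (subtopology X (V m))) (\<lambda>z. (fst z, g (snd z)))"
      using continuous_map_compose[OF continuous_map_snd cgV]
      by (intro continuous_map_pairedI continuous_map_fst) (simp add: o_def)
    from continuous_map_compose[OF this continuous_H]
    have c: "continuous_map (prod_topology (top_of_set {0..1}) (nsphere n)) X
               (H m \<circ> (\<lambda>z. (fst z, g (snd z))))" .
    have "homotopic_with (\<lambda>k. k sphere_base = j a) (nsphere n) X g (j \<circ> (r m \<circ> g))"
    proof (subst homotopic_with)
      show "(p sphere_base = j a) = (q sphere_base = j a)"
        if "\<And>x. x \<in> topspace (nsphere n) \<Longrightarrow> p x = q x" for p q
        using that[OF sphere_base_in_nsphere] by simp
      show "\<exists>F. continuous_map (prod_topology (top_of_set {0..1::real}) (nsphere n)) X F \<and>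
           (\<forall>x\<in>topspace (nsphere n). F (0, x) = g x) \<and>
           (\<forall>x\<in>topspace (nsphere n). F (1, x) = (j \<circ> (r m \<circ> g)) x) \<and>
           (\<forall>t\<in>{0..1}. F (t, sphere_base) = j a)"
        by (rule exI[of _ "H m \<circ> (\<lambda>z. (fst z, g (snd z)))"])
          (use c m(2) H_0 H_1 H_j am ga in auto)
    qed
    then show ?thesis using h homotopic_with_symD by blast
  qed
qed

text \<open>The stages are built from operators, the theorem speaks of Lagrangians. All data are
  carried along \<open>f\<close>, the homotopies by conjugation with it.\<close>

lemma homeomorphic_transfer:
  assumes "homeomorphic_map X Z f"
  shows "weak_homotopy_equivalence U_infinity_topology Z (f \<circ> j)"
proof -
  obtain g where fg: "homeomorphic_maps X Z f g"
    using assms homeomorphic_map_maps by blast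
  then have f: "continuous_map X Z f" and g: "continuous_map Z X g"
    and gf: "\<And>x. x \<in> topspace X \<Longrightarrow> g (f x) = x" and fg': "\<And>y. y \<in> topspace Z \<Longrightarrow> f (g y) = y"
    unfolding homeomorphic_maps_def by auto
  have VX: "x \<in> topspace X" if "x \<in> V n" for x n
    using that openin_subset[OF open_stage] by blast
  have jX: "j A \<in> topspace X" if "A \<in> U_fin n" for A n
    using that j_stage VX by blast
  have gV: "continuous_map (subtopology Z (f ` V n)) (subtopology X (V n)) g" for n
    using g gf VX by (auto simp: continuous_map_in_subtopology continuous_map_from_subtopology)
  interpret T: stage_retraction Z "f \<circ> j" "\<lambda>n. f ` V n" "\<lambda>n. r n \<circ> g"
    "\<lambda>n. f \<circ> H n \<circ> (\<lambda>z. (fst z, g (snd z)))"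
  proof
    fix n
    show "openin Z (f ` V n)"
      using assms open_stage homeomorphic_map_openness_eq VX by blast
    show "f ` V n \<subseteq> f ` V (Suc n)" by (intro image_mono stage_Suc)
    show "topspace Z \<subseteq> (\<Union>n. f ` V n)"
      using homeomorphic_imp_surjective_map[OF assms] stage_cover by blast
    show "continuous_map (top_of_set (U_fin n)) Z (f \<circ> j)"
      by (rule continuous_map_compose[OF continuous_j f])
    show "continuous_map (subtopology Z (f ` V n)) (top_of_set (U_fin n)) (r n \<circ> g)"
      by (rule continuous_map_compose[OF gV continuous_r])
    have "continuous_map (prod_topology (top_of_set {0..1}) (subtopology Z (f ` V n)))
       (prod_topology (top_of_set {0..1}) (subtopology X (V n))) (\<lambda>z. (fst z, g (snd z)))"
      using continuous_map_compose[OF continuous_map_snd gV]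
      by (intro continuous_map_pairedI continuous_map_fst) (simp add: o_def)
    from continuous_map_compose[OF continuous_map_compose[OF this continuous_H] f]
    show "continuous_map (prod_topology (top_of_set {0..1}) (subtopology Z (f ` V n))) Z
       (f \<circ> H n \<circ> (\<lambda>z. (fst z, g (snd z))))" by (simp add: o_assoc)
  next
    fix A n assume A: "A \<in> U_fin n"
    show "(f \<circ> j) A \<in> f ` V n" using j_stage[OF A] by auto
    show "(r n \<circ> g) ((f \<circ> j) A) = A" using gf[OF jX[OF A]] r_j[OF A] by simp
    show "(f \<circ> H n \<circ> (\<lambda>z. (fst z, g (snd z)))) (t, (f \<circ> j) A) = (f \<circ> j) A" if "t \<in> {0..1}" for t
      using gf[OF jX[OF A]] H_j[OF A that] by simp
  next
    fix y n assume "y \<in> f ` V n"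
    then obtain x where x: "x \<in> V n" "y = f x" by blast
    show "(f \<circ> H n \<circ> (\<lambda>z. (fst z, g (snd z)))) (0, y) = y"
      using x gf[OF VX[OF x(1)]] H_0 by simp
    show "(f \<circ> H n \<circ> (\<lambda>z. (fst z, g (snd z)))) (1, y) = (f \<circ> j) ((r n \<circ> g) y)"
      using x gf[OF VX[OF x(1)]] H_1 by simp
  qed
  show ?thesis by (rule T.weak_homotopy_equivalence_j)
qed

end

section \<open>Finite matrices and stages\<close>

locale hilbert_basis =
  fixes e :: "nat \<Rightarrow> 'a::complex_hilbert"
  assumes orth: "cinner (e i) (e j) = (if i = j then 1 else 0)"
    and total: "(\<And>i. cinner x (e i) = 0) \<Longrightarrow> x = 0"
begin

lemma vec_eqI: "(\<And>i. cinner x (e i) = cinner y (e i)) \<Longrightarrow> x = y"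
  using total[of "x - y"] by (simp add: cinner_diff_left)

definition tail :: "nat \<Rightarrow> 'a \<Rightarrow>\<^sub>L 'a"
  where "tail n = id_blinfun - Blinfun (\<lambda>x. \<Sum>i<n. cinner x (e i) *\<^sub>C e i)"

lemma tail_apply: "tail n x = x - (\<Sum>i<n. cinner x (e i) *\<^sub>C e i)"
proof -
  have "bounded_linear (\<lambda>x. \<Sum>i<n. cinner x (e i) *\<^sub>C e i)"
    by (intro bounded_linear_sum bounded_linear_compose[OF
          bounded_bilinear.bounded_linear_left[OF bounded_bilinear_scaleC]
          bounded_bilinear.bounded_linear_left[OF bounded_bilinear_cinner]])
  then show ?thesis by (simp add: tail_def blinfun.diff_left bounded_linear_Blinfun_apply)
qed

lemma cinner_tail: "cinner (tail n x) (e i) = (if i < n then 0 else cinner x (e i))"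
proof -
  have "(\<Sum>j<n. cinner x (e j) * cinner (e j) (e i)) = (\<Sum>j<n. if j = i then cinner x (e j) else 0)"
    by (intro sum.cong) (auto simp: orth)
  then show ?thesis by (simp add: tail_apply cinner_diff_left cinner_sum_left cinner_scaleC_left)
qed

lemma tail_basis: "tail n (e i) = (if i < n then 0 else e i)"
  by (rule vec_eqI) (simp add: cinner_tail orth)

lemma tail_tail: "m \<le> n \<Longrightarrow> tail m (tail n x) = tail n x"
  by (rule vec_eqI) (simp add: cinner_tail)

lemma tail_projection: "orthogonal_projection (tail n)"
proof
  show "tail n \<in> bounded_ops"
    by (rule bounded_opsI, rule vec_eqI) (simp add: cinner_tail cinner_scaleC_left)
  show "tail n (tail n x) = tail n x" for x by (simp add: tail_tail)
  show "cinner (tail n x) y = cinner x (tail n y)" for x y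
  proof -
    have "cnj (cinner y (e i)) = cinner (e i) y" for i by (rule cinner_commute[symmetric])
    then show ?thesis by (simp add: tail_apply cinner_simps mult.commute)
  qed
qed

abbreviation stages where "stages n \<equiv> orthogonal_projection.stage (tail n)"
abbreviation reduction where "reduction n \<equiv> orthogonal_projection.reduce (tail n)"

lemma parseval_finite:
  assumes "tail n y = 0"
  shows "cinner x y = (\<Sum>l<n. cinner x (e l) * cnj (cinner y (e l)))"
proof -
  have "y = (\<Sum>l<n. cinner y (e l) *\<^sub>C e l)" using assms by (simp add: tail_apply)
  then have "cinner x y = cinner x (\<Sum>l<n. cinner y (e l) *\<^sub>C e l)" by simp
  then show ?thesis by (simp add: cinner_sum_right cinner_scaleC_right mult.commute)
qed

lemma norm_tail: "(norm x)\<^sup>2 = (norm (tail n x))\<^sup>2 + (\<Sum>l<n. (cmod (cinner x (e l)))\<^sup>2)"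
proof -
  interpret orthogonal_projection "tail n" by (rule tail_projection)
  have "tail n (x - tail n x) = 0" by (simp add: blinfun.diff_right)
  moreover have "cinner (x - tail n x) (e l) = cinner x (e l)" if "l < n" for l
    using that by (simp add: cinner_diff_left cinner_tail)
  ultimately have "cinner (x - tail n x) (x - tail n x) = (\<Sum>l<n. cinner x (e l) * cnj (cinner x (e l)))"
    by (simp add: parseval_finite)
  also have "\<dots> = complex_of_real (\<Sum>l<n. (cmod (cinner x (e l)))\<^sup>2)"
    by (simp only: of_real_sum complex_norm_square)
  finally have "(norm (x - tail n x))\<^sup>2 = (\<Sum>l<n. (cmod (cinner x (e l)))\<^sup>2)"
    unfolding cinner_self of_real_eq_iff .
  then show ?thesis using norm_split[of x] by simp
qed

text \<open>The vectors with this property form a subspace \<open>M\<close>, closed because the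
  tails have norm at most 1, that contains every \<open>e i\<close>. The residual of
  \<open>x\<close> after projection onto \<open>M\<close> is orthogonal to the basis, hence
  0.\<close>

lemma tail_tendsto_0: "(\<lambda>n. tail n x) \<longlonglongrightarrow> 0"
proof -
  define M where "M = {x. (\<lambda>n. tail n x) \<longlonglongrightarrow> 0}"
  have scale: "tail n (c *\<^sub>C x) = c *\<^sub>C tail n x" for n c x
    by (rule vec_eqI) (simp add: cinner_tail cinner_scaleC_left)
  have sub: "csubspace M"
  proof (rule complex_vector.subspaceI)
    show "0 \<in> M" by (simp add: M_def)
    show "x + y \<in> M" if "x \<in> M" "y \<in> M" for x y
      using that tendsto_add[of "\<lambda>n. tail n x" 0 sequentially "\<lambda>n. tail n y" 0]
      by (simp add: M_def blinfun.add_right)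
    show "c *\<^sub>C x \<in> M" if "x \<in> M" for c x
      using that tendsto_scaleC[of "\<lambda>_. c" c sequentially "\<lambda>n. tail n x" 0]
      by (simp add: M_def scale)
  qed
  have "closed M"
    unfolding closed_sequential_limits
  proof (intro allI impI, elim conjE)
    fix y x assume y: "\<forall>k::nat. y k \<in> M" and lim: "y \<longlonglongrightarrow> x"
    show "x \<in> M" unfolding M_def mem_Collect_eq LIMSEQ_iff
    proof (intro allI impI)
      fix r :: real assume r: "r > 0"
      obtain k where k: "norm (y k - x) < r / 2"
        using lim r unfolding LIMSEQ_iff by (meson half_gt_zero order_refl)
      obtain N where N: "\<And>n. n \<ge> N \<Longrightarrow> norm (tail n (y k) - 0) < r / 2"
        using y[rule_format, of k] r unfolding M_def mem_Collect_eq LIMSEQ_iff by (meson half_gt_zero)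
      have "norm (tail n x - 0) < r" if "n \<ge> N" for n
      proof -
        have "norm (tail n (x - y k)) \<le> norm (x - y k)"
          by (rule orthogonal_projection.norm_Q_le[OF tail_projection])
        then show ?thesis using k N[OF that] norm_triangle_ineq[of "tail n (x - y k)" "tail n (y k)"]
          by (simp add: blinfun.diff_right norm_minus_commute)
      qed
      then show "\<exists>N. \<forall>n\<ge>N. norm (tail n x - 0) < r" by blast
    qed
  qed
  then obtain m where m: "m \<in> M" "x - m \<in> orth_compl M" using closed_csubspace_projection[OF sub] by blast
  have "e i \<in> M" for i
  proof -
    have "eventually (\<lambda>n. tail n (e i) = 0) sequentially"
      using eventually_gt_at_top[of i] by eventually_elim (simp add: tail_basis)
    then show ?thesis by (simp add: M_def tendsto_eventually)
  qed
  then have "cinner (x - m) (e i) = 0" for i using m(2) by (simp add: orth_compl_def)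
  then have "x - m = 0" by (rule total)
  then show ?thesis using m(1) by (simp add: M_def)
qed

lemma stage_Suc: "stages n \<subseteq> stages (Suc n)"
  by (intro stage_mono tail_projection tail_tail) simp

text \<open>Failure of the bound of the \<open>n\<close>-th stage with constant
  \<open>1 / (real n + 1)\<close>, normalized: approximate eigenvectors of \<open>W\<close> for the
  eigenvalue -1 whose first \<open>n\<close> coordinates vanish.\<close>

lemma not_stage_sequence:
  assumes W: "W \<in> unitary_ops" "W \<notin> (\<Union>n. stages n)"
  shows "\<exists>y. \<forall>n. tail n (y n) = y n \<and> norm (y n) = 1 \<and> norm (y n + W (y n)) \<le> 1 / (real n + 1)"
proof -
  have "\<exists>y. tail n y = y \<and> norm y = 1 \<and> norm (y + W y) \<le> 1 / (real n + 1)" for n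
  proof -
    interpret orthogonal_projection "tail n" by (rule tail_projection)
    have "\<not> (\<forall>y. 1 / (real n + 1) * norm (tail n y) \<le> norm (tail n y + W (tail n y)))"
    proof
      assume "\<forall>y. 1 / (real n + 1) * norm (tail n y) \<le> norm (tail n y + W (tail n y))"
      then have "W \<in> stages n" using W(1) unfolding stage_def by (auto intro!: exI[of _ "1 / (real n + 1)"])
      then show False using W(2) by blast
    qed
    then obtain x where x: "norm (tail n x + W (tail n x)) < 1 / (real n + 1) * norm (tail n x)"
      by (auto simp: not_le)
    define r where "r = norm (tail n x)"
    have r: "r > 0"
    proof (rule ccontr)
      assume "\<not> r > 0"
      then have "r = 0" by (simp add: r_def)
      then have "tail n x = 0" by (simp add: r_def)
      then show False using x by simp
    qed
    define y where "y = (1 / r) *\<^sub>R tail n x"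
    have "tail n y = y" by (simp add: y_def blinfun.scaleR_right)
    moreover have "norm y = 1" using r by (simp add: y_def r_def)
    moreover have "y + W y = (1 / r) *\<^sub>R (tail n x + W (tail n x))"
      by (simp add: y_def blinfun.scaleR_right scaleR_right_distrib)
    then have "norm (y + W y) = norm (tail n x + W (tail n x)) / r" using r by simp
    then have "norm (y + W y) \<le> 1 / (real n + 1)"
      using x r by (simp add: r_def[symmetric] divide_le_eq)
    ultimately show ?thesis by blast
  qed
  then show ?thesis by metis
qed

lemma inverse_Suc_tendsto_0: "(\<lambda>n. 1 / (real n + 1)) \<longlonglongrightarrow> 0"
  using LIMSEQ_inverse_real_of_nat by (simp add: inverse_eq_divide add.commute)

text \<open>With \<open>A = W - 1\<close>, the vector \<open>y n\<close> is half the difference of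
  \<open>y n + W (y n)\<close> and \<open>A (y n)\<close>. The former tends to 0 and the latter
  converges along a subsequence, so \<open>y n\<close> does too. The limit has norm 1, but all its
  coordinates vanish.\<close>

lemma compact_perturbation_stage:
  assumes W: "W \<in> unitary_ops" and K: "W - id_blinfun \<in> compact_ops"
  shows "W \<in> (\<Union>n. stages n)"
proof (rule ccontr)
  assume "W \<notin> (\<Union>n. stages n)"
  then obtain y where y: "\<And>n. tail n (y n) = y n" "\<And>n. norm (y n) = 1"
    "\<And>n. norm (y n + W (y n)) \<le> 1 / (real n + 1)"
    using not_stage_sequence[OF W] by blast
  define A where "A = W - id_blinfun"
  have "A (y n) \<in> closure (blinfun_apply A ` cball 0 1)" for n
    using y(2)[of n] by (intro subsetD[OF closure_subset] imageI) simp
  then obtain z r where zr: "strict_mono (r :: nat \<Rightarrow> nat)" "((\<lambda>n. A (y n)) \<circ> r) \<longlonglongrightarrow> z"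
    using K unfolding compact_ops_def compact_def A_def by (smt (verit) mem_Collect_eq)
  have "(\<lambda>n. y n + W (y n)) \<longlonglongrightarrow> 0"
    by (rule Lim_null_comparison[OF _ inverse_Suc_tendsto_0]) (use y(3) in simp)
  then have "((\<lambda>n. y n + W (y n)) \<circ> r) \<longlonglongrightarrow> 0" using zr(1) by (rule LIMSEQ_subseq_LIMSEQ)
  from tendsto_scaleR[OF tendsto_const[of "1/2"] tendsto_diff[OF this zr(2)]]
  have "(\<lambda>n. y (r n)) \<longlonglongrightarrow> (1/2) *\<^sub>R (0 - z)"
  proof (rule Lim_transform_eventually)
    have "(1/2) *\<^sub>R ((y n + W (y n)) - A (y n)) = y n" for n
      by (simp add: A_def blinfun.diff_left scaleR_2[symmetric])
    then show "\<forall>\<^sub>F n in sequentially. (1/2) *\<^sub>R (((\<lambda>n. y n + W (y n)) \<circ> r) n - ((\<lambda>n. A (y n)) \<circ> r) n) = y (r n)"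
      by simp
  qed
  then obtain a where a: "(\<lambda>n. y (r n)) \<longlonglongrightarrow> a" by blast
  have "norm a = 1" using tendsto_norm[OF a] y(2) by (simp add: LIMSEQ_const_iff)
  moreover have "cinner a (e j) = 0" for j
  proof (rule LIMSEQ_unique)
    show "(\<lambda>n. cinner (y (r n)) (e j)) \<longlonglongrightarrow> cinner a (e j)" by (intro tendsto_cinner a tendsto_const)
    have "\<forall>\<^sub>F n in sequentially. cinner (y (r n)) (e j) = 0"
      using eventually_gt_at_top[of j]
    proof eventually_elim
      case (elim n)
      then have "j < r n" using seq_suble[OF zr(1), of n] by simp
      then show ?case using cinner_tail[of "r n" "y (r n)" j] y(1)[of "r n"] by simp
    qed
    then show "(\<lambda>n. cinner (y (r n)) (e j)) \<longlonglongrightarrow> 0" by (rule tendsto_eventually)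
  qed
  then have "a = 0" by (rule total)
  ultimately show False by simp
qed

section \<open>Matrices as operators\<close>

definition unit_op :: "nat \<Rightarrow> nat \<Rightarrow> complex \<Rightarrow> 'a \<Rightarrow>\<^sub>L 'a"
  where "unit_op i j a = Blinfun (\<lambda>x. (a * cinner x (e j)) *\<^sub>C e i)"

lemma unit_op_apply: "unit_op i j a x = (a * cinner x (e j)) *\<^sub>C e i"
proof -
  have "bounded_linear (\<lambda>x. (a * cinner x (e j)) *\<^sub>C e i)"
    by (intro bounded_linear_compose[OF bounded_bilinear.bounded_linear_left[OF bounded_bilinear_scaleC]]
        bounded_linear_compose[OF bounded_linear_mult_right
          bounded_bilinear.bounded_linear_left[OF bounded_bilinear_cinner]])
  then show ?thesis by (simp add: unit_op_def bounded_linear_Blinfun_apply)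
qed

lemma norm_basis: "norm (e i) = 1"
proof (rule power2_eq_imp_eq)
  show "(norm (e i))\<^sup>2 = 1\<^sup>2" by (simp add: norm_eq_cinner orth)
qed auto

lemma bounded_linear_unit_op: "bounded_linear (unit_op i j)"
proof (rule bounded_linear_intro)
  show "unit_op i j (a + b) = unit_op i j a + unit_op i j b" for a b
    by (rule blinfun_eqI) (simp add: unit_op_apply blinfun.add_left algebra_simps scaleC_add_left)
  show "unit_op i j (r *\<^sub>R a) = r *\<^sub>R unit_op i j a" for r a
    by (rule blinfun_eqI) (simp add: unit_op_apply blinfun.scaleR_left scaleR_scaleC scaleC_scaleC scaleR_conv_of_real)
  show "norm (unit_op i j a) \<le> norm a * 1" for a
  proof (rule norm_blinfun_bound)
    show "norm (unit_op i j a x) \<le> norm a * 1 * norm x" for x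
      using cmod_cinner_le[of x "e j"] by (simp add: unit_op_apply norm_scaleC norm_mult norm_basis mult_left_mono)
  qed simp
qed

definition matrix_op :: "nat \<Rightarrow> (nat \<Rightarrow> nat \<Rightarrow> complex) \<Rightarrow> 'a \<Rightarrow>\<^sub>L 'a"
  where "matrix_op n A = tail n + (\<Sum>i<n. \<Sum>j<n. unit_op i j (A i j))"

lemma cinner_matrix_op:
  "cinner (matrix_op n A x) (e i) = (if i < n then \<Sum>j<n. A i j * cinner x (e j) else cinner x (e i))"
proof -
  have "cinner ((\<Sum>k<n. \<Sum>j<n. unit_op k j (A k j)) x) (e i)
      = (\<Sum>k<n. \<Sum>j<n. if k = i then A k j * cinner x (e j) else 0)"
    by (simp add: blinfun.sum_left unit_op_apply cinner_sum_left cinner_scaleC_left orth if_distrib cong: if_cong)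
  also have "\<dots> = (\<Sum>k<n. if k = i then \<Sum>j<n. A k j * cinner x (e j) else 0)"
    by (intro sum.cong) auto
  also have "\<dots> = (if i < n then \<Sum>j<n. A i j * cinner x (e j) else 0)" by simp
  finally show ?thesis
    by (simp add: matrix_op_def blinfun.add_left cinner_add_left cinner_tail)
qed

lemma continuous_on_matrix_op: "continuous_on S (matrix_op n)"
proof -
  have "continuous_on S (\<lambda>A. A i j)" for i j :: nat and S :: "(nat \<Rightarrow> nat \<Rightarrow> complex) set"
    using continuous_on_product_then_coordinatewise[OF continuous_on_product_coordinates]
    by (rule continuous_on_subset) simp
  then show ?thesis unfolding matrix_op_def
    by (intro continuous_intros bounded_linear.continuous_on[OF bounded_linear_unit_op])
qed

lemma matrix_op_tail: "matrix_op n A (tail n x) = tail n x" "tail n (matrix_op n A x) = tail n x"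
  by (rule vec_eqI; simp add: cinner_matrix_op cinner_tail)+

lemma matrix_op_unitary:
  assumes A: "A \<in> U_fin n"
  shows "matrix_op n A \<in> unitary_ops"
proof (rule unitary_opsI)
  have col: "(\<Sum>l<n. A l j * cnj (A l i)) = (if i = j then 1 else 0)"
    and row: "(\<Sum>l<n. A i l * cnj (A j l)) = (if i = j then 1 else 0)" if "i < n" "j < n" for i j
    using A that unfolding U_fin_def by (auto simp: mult.commute)
  show "matrix_op n A \<in> bounded_ops"
    by (rule bounded_opsI, rule vec_eqI)
       (simp add: cinner_matrix_op cinner_scaleC_left sum_distrib_left mult.left_commute)
  show "norm (matrix_op n A x) = norm x" for x
  proof -
    let ?c = "\<lambda>j. cinner x (e j)"
    \<comment> \<open>Expanding the squares and summing over the row index \<open>i\<close> first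
      brings in the orthonormality of the columns of \<open>A\<close>.\<close>
    have "complex_of_real (\<Sum>i<n. (cmod (\<Sum>j<n. A i j * ?c j))\<^sup>2)
        = (\<Sum>i<n. (\<Sum>j<n. A i j * ?c j) * cnj (\<Sum>j<n. A i j * ?c j))"
      by (simp only: of_real_sum complex_norm_square)
    also have "\<dots> = (\<Sum>i<n. \<Sum>j<n. \<Sum>k<n. (?c j * cnj (?c k)) * (A i j * cnj (A i k)))"
      by (simp add: sum_product mult_ac)
    also have "\<dots> = (\<Sum>j<n. \<Sum>k<n. \<Sum>i<n. (?c j * cnj (?c k)) * (A i j * cnj (A i k)))"
      by (rule trans[OF sum.swap], rule sum.cong[OF refl], rule sum.swap)
    also have "\<dots> = (\<Sum>j<n. \<Sum>k<n. (?c j * cnj (?c k)) * (if k = j then 1 else 0))"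
      by (intro sum.cong refl, subst sum_distrib_left[symmetric], simp add: col)
    also have "\<dots> = (\<Sum>j<n. ?c j * cnj (?c j))"
      by (intro sum.cong refl) (simp add: if_distrib cong: if_cong)
    also have "\<dots> = complex_of_real (\<Sum>j<n. (cmod (?c j))\<^sup>2)" by (simp only: of_real_sum complex_norm_square)
    finally have "(\<Sum>i<n. (cmod (\<Sum>j<n. A i j * ?c j))\<^sup>2) = (\<Sum>j<n. (cmod (?c j))\<^sup>2)"
      by (simp only: of_real_eq_iff)
    then have "(norm (matrix_op n A x))\<^sup>2 = (norm x)\<^sup>2"
      using norm_tail[of "matrix_op n A x" n] norm_tail[of x n] by (simp add: cinner_matrix_op matrix_op_tail)
    then show ?thesis by simp
  qed
  show "\<exists>x. matrix_op n A x = y" for y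
  proof (rule exI, rule vec_eqI)
    fix i
    \<comment> \<open>The conjugate transpose provides the preimage, by orthonormality of the
      rows.\<close>
    let ?x = "matrix_op n (\<lambda>i j. cnj (A j i)) y"
    have "(\<Sum>j<n. A i j * (\<Sum>k<n. cnj (A k j) * cinner y (e k))) = cinner y (e i)" if i: "i < n"
    proof -
      have "(\<Sum>j<n. A i j * (\<Sum>k<n. cnj (A k j) * cinner y (e k)))
          = (\<Sum>j<n. \<Sum>k<n. cinner y (e k) * (A i j * cnj (A k j)))"
        by (simp add: sum_distrib_left mult_ac)
      also have "\<dots> = (\<Sum>k<n. \<Sum>j<n. cinner y (e k) * (A i j * cnj (A k j)))" by (rule sum.swap)
      also have "\<dots> = (\<Sum>k<n. cinner y (e k) * (if i = k then 1 else 0))"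
        by (intro sum.cong refl, subst sum_distrib_left[symmetric], simp add: row i)
      also have "\<dots> = cinner y (e i)" using i by (simp add: if_distrib cong: if_cong)
      finally show ?thesis .
    qed
    then show "cinner (matrix_op n A ?x) (e i) = cinner y (e i)" by (simp add: cinner_matrix_op)
  qed
qed

lemma matrix_op_stage:
  assumes "A \<in> U_fin n"
  shows "matrix_op n A \<in> stages n"
proof -
  interpret orthogonal_projection "tail n" by (rule tail_projection)
  have "2 * norm (tail n y) \<le> norm (tail n y + matrix_op n A (tail n y))" for y
    by (simp add: matrix_op_tail scaleR_2[symmetric])
  then show ?thesis using matrix_op_unitary[OF assms] by (auto simp: stage_def intro!: exI[of _ 2])
qed

lemma matrix_op_eq:
  assumes A: "A \<in> U_fin m" and "m \<le> n"
  shows "matrix_op n A = matrix_op m A"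
proof (rule blinfun_eqI, rule vec_eqI)
  fix x i
  have out: "A i j = (if i = j then 1 else 0)" if "\<not> (i < m \<and> j < m)" for i j
    using A that unfolding U_fin_def by blast
  show "cinner (matrix_op n A x) (e i) = cinner (matrix_op m A x) (e i)"
  proof (cases "i < m")
    case True
    have "(\<Sum>j<n. A i j * cinner x (e j)) = (\<Sum>j<m. A i j * cinner x (e j))"
      using \<open>m \<le> n\<close> True by (intro sum.mono_neutral_right) (auto simp: out)
    then show ?thesis using True \<open>m \<le> n\<close> by (simp add: cinner_matrix_op)
  next
    case False
    then have "(\<Sum>j<n. A i j * cinner x (e j)) = (\<Sum>j<n. if i = j then cinner x (e j) else 0)"
      by (intro sum.cong) (auto simp: out)
    then show ?thesis using False by (simp add: cinner_matrix_op)
  qed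
qed

text \<open>The operators \<open>matrix_op n A\<close> coincide for all \<open>n\<close> with
  \<open>A \<in> U_fin n\<close>, so \<open>LEAST\<close> merely selects one of them. This makes the
  embedding independent of \<open>n\<close>, as a map out of the colimit must be.\<close>

definition stable_op :: "(nat \<Rightarrow> nat \<Rightarrow> complex) \<Rightarrow> 'a \<Rightarrow>\<^sub>L 'a"
  where "stable_op A = matrix_op (LEAST n. A \<in> U_fin n) A"

lemma stable_op_eq: "A \<in> U_fin n \<Longrightarrow> stable_op A = matrix_op n A"
  unfolding stable_op_def by (rule matrix_op_eq[symmetric]) (auto intro: LeastI Least_le)

text \<open>The padding by the identity matrix puts the result into the stabilized form of
  \<open>U_fin\<close>.\<close>

definition op_matrix :: "nat \<Rightarrow> ('a \<Rightarrow>\<^sub>L 'a) \<Rightarrow> nat \<Rightarrow> nat \<Rightarrow> complex"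
  where "op_matrix n W i j = (if i < n \<and> j < n then cinner (W (e j)) (e i) else if i = j then 1 else 0)"

lemma op_matrix_matrix_op:
  assumes "A \<in> U_fin n"
  shows "op_matrix n (matrix_op n A) = A"
proof (intro ext)
  fix i j
  have "(\<Sum>k<n. A i k * (if j = k then 1 else 0)) = A i j" if "j < n"
    using that by (simp add: if_distrib cong: if_cong)
  moreover have "A i j = (if i = j then 1 else 0)" if "\<not> (i < n \<and> j < n)"
    using assms that unfolding U_fin_def by blast
  ultimately show "op_matrix n (matrix_op n A) i j = A i j"
    by (simp add: op_matrix_def cinner_matrix_op orth)
qed

lemma continuous_on_op_matrix: "continuous_on S (op_matrix n)"
proof (intro continuous_on_coordinatewise_then_product)
  fix i j
  show "continuous_on S (\<lambda>W. op_matrix n W i j)"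
    unfolding op_matrix_def by (cases "i < n \<and> j < n") (auto intro!: continuous_intros)
qed

context
  fixes V n
  assumes V: "V \<in> unitary_ops" and Vt: "\<And>x. V (tail n x) = tail n x" and tV: "\<And>x. tail n (V x) = tail n x"
begin

text \<open>\<open>V\<close> is block diagonal with the identity on the tail, so
  \<open>V (e j)\<close> for \<open>j < n\<close> has no tail and the finite Parseval formula
  expresses its inner products through the matrix.\<close>

lemma op_matrix_U_fin: "op_matrix n V \<in> U_fin n"
proof -
  have "(\<Sum>l<n. cnj (cinner (V (e i)) (e l)) * cinner (V (e j)) (e l)) = (if i = j then 1 else 0)"
    if "i < n" "j < n" for i j
  proof -
    have "cinner (V (e j)) (V (e i)) = (\<Sum>l<n. cinner (V (e j)) (e l) * cnj (cinner (V (e i)) (e l)))"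
      using that by (intro parseval_finite) (simp add: tV tail_basis)
    then show ?thesis by (simp add: unitary_cinner[OF V] orth mult.commute eq_commute)
  qed
  moreover have "(\<Sum>l<n. cinner (V (e l)) (e i) * cnj (cinner (V (e l)) (e j))) = (if i = j then 1 else 0)"
    if ij: "i < n" "j < n" for i j
  proof -
    \<comment> \<open>Row \<open>k\<close> of the matrix consists of the conjugated coordinates of
      \<open>x k\<close>, so the row relations say that the inverse of \<open>V\<close> preserves
      orthonormality.\<close>
    define x where "x k = blinfun_inv V (e k)" for k
    have "tail n (x i) = tail n (V (x i))" by (simp add: tV)
    also have "\<dots> = 0" using ij by (simp add: x_def unitary_inv_right[OF V] tail_basis)
    finally have x_parseval: "cinner (x j) (x i) = (\<Sum>l<n. cinner (x j) (e l) * cnj (cinner (x i) (e l)))"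
      by (rule parseval_finite)
    have V_x: "cinner (V (e l)) (e k) = cnj (cinner (x k) (e l))" for l k
      unfolding unitary_cinner_inv[OF V] x_def by (rule cinner_commute)
    have "(\<Sum>l<n. cinner (V (e l)) (e i) * cnj (cinner (V (e l)) (e j)))
        = (\<Sum>l<n. cinner (x j) (e l) * cnj (cinner (x i) (e l)))"
      by (simp add: V_x mult.commute)
    also have "\<dots> = cinner (x j) (x i)" by (simp only: x_parseval)
    also have "\<dots> = cinner (e j) (e i)"
      unfolding x_def by (rule unitary_cinner[OF unitary_inv[OF V]])
    finally show ?thesis by (simp add: orth eq_commute)
  qed
  ultimately show ?thesis unfolding U_fin_def by (simp add: op_matrix_def)
qed

lemma matrix_op_op_matrix: "matrix_op n (op_matrix n V) = V"
proof (rule blinfun_eqI, rule vec_eqI)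
  fix x i
  show "cinner (matrix_op n (op_matrix n V) x) (e i) = cinner (V x) (e i)"
  proof (cases "i < n")
    case True
    have "x = tail n x + (\<Sum>j<n. cinner x (e j) *\<^sub>C e j)" by (simp add: tail_apply)
    then have "V x = V (tail n x + (\<Sum>j<n. cinner x (e j) *\<^sub>C e j))" by simp
    also have "\<dots> = tail n x + (\<Sum>j<n. cinner x (e j) *\<^sub>C V (e j))"
      by (simp add: blinfun.add_right blinfun.sum_right Vt unitary_scaleC[OF V])
    finally have "cinner (V x) (e i) = (\<Sum>j<n. cinner x (e j) * cinner (V (e j)) (e i))"
      using True by (simp add: cinner_simps cinner_tail)
    then show ?thesis using True by (simp add: cinner_matrix_op op_matrix_def mult.commute)
  next
    case False
    then show ?thesis using cinner_tail[of n "V x" i] cinner_tail[of n x i]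
      by (simp add: cinner_matrix_op tV)
  qed
qed

end

text \<open>Serves both the norm topology and the topology of an ideal. Openness of the stages and
  continuity of matrix entries are inherited from the norm topology through \<open>finer\<close>;
  continuity of \<open>stable_op\<close> and of the reduction has to be supplied for each
  \<open>X\<close>. The stages are cut down to \<open>topspace X\<close>, since an ideal sees only
  part of them.\<close>

lemma stage_retraction_unitary:
  assumes sub: "topspace X \<subseteq> (\<Union>n. stages n)"
    and finer: "continuous_map X euclidean (\<lambda>W. W)"
    and cont_stable: "\<And>n. continuous_map (top_of_set (U_fin n)) X stable_op"
    and cont_reduce: "\<And>n. continuous_map (prod_topology (top_of_set {0..1}) (subtopology X (stages n))) X
                         (\<lambda>z. reduction n (fst z) (snd z))"
  shows "stage_retraction X stable_op (\<lambda>n. topspace X \<inter> stages n)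
           (\<lambda>n W. op_matrix n (reduction n 1 W)) (\<lambda>n z. reduction n (fst z) (snd z))"
proof
  fix n
  interpret orthogonal_projection "tail n" by (rule tail_projection)
  have unit: "topspace X \<subseteq> unitary_ops"
    using sub orthogonal_projection.stage_unitary[OF tail_projection] by blast
  obtain T where T: "open T" "stages n = unitary_ops \<inter> T"
    using openin_stage by (auto simp: openin_open)
  have "{W \<in> topspace X. W \<in> T} = topspace X \<inter> stages n" using T(2) unit by blast
  then show "openin X (topspace X \<inter> stages n)"
    using openin_continuous_map_preimage[OF finer, of T] T(1) by simp
  show "topspace X \<inter> stages n \<subseteq> topspace X \<inter> stages (Suc n)" using stage_Suc by blast
  show "topspace X \<subseteq> (\<Union>n. topspace X \<inter> stages n)" using sub by blast
  show "continuous_map (top_of_set (U_fin n)) X stable_op" by (rule cont_stable)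
  have subX: "subtopology X (topspace X \<inter> stages n) = subtopology X (stages n)"
    by (metis subtopology_restrict)
  show "continuous_map (prod_topology (top_of_set {0..1}) (subtopology X (topspace X \<inter> stages n))) X
      (\<lambda>z. reduce (fst z) (snd z))" unfolding subX by (rule cont_reduce)
  have "continuous_map (subtopology X (stages n)) (prod_topology (top_of_set {0..1}) (subtopology X (stages n)))
          (\<lambda>W. (1 :: real, W))"
    by (intro continuous_map_pairedI) auto
  from continuous_map_compose[OF continuous_map_compose[OF this cont_reduce] finer]
  have "continuous_map (subtopology X (stages n)) euclidean (\<lambda>W. reduce 1 W)" by (simp add: o_def)
  then have "continuous_map (subtopology X (stages n)) euclidean (op_matrix n \<circ> (\<lambda>W. reduce 1 W))"
    by (rule continuous_map_compose) (simp add: continuous_on_op_matrix)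
  then show "continuous_map (subtopology X (topspace X \<inter> stages n)) (top_of_set (U_fin n))
      (\<lambda>W. op_matrix n (reduce 1 W))"
    unfolding subX
    by (auto simp: continuous_map_in_subtopology o_def intro!: op_matrix_U_fin reduce_unitary reduce_1)
next
  fix A n assume A: "A \<in> U_fin n"
  interpret orthogonal_projection "tail n" by (rule tail_projection)
  have "stable_op A \<in> topspace X"
    using continuous_map_funspace[OF cont_stable[of n]] A by auto
  then show "stable_op A \<in> topspace X \<inter> stages n" using matrix_op_stage[OF A] by (simp add: stable_op_eq[OF A])
  have fixed: "reduce t (stable_op A) = stable_op A" if "t \<in> {0..1}" for t
    unfolding stable_op_eq[OF A] using matrix_op_stage[OF A] that
    by (intro reduce_fixed) (auto simp: matrix_op_tail)
  then show "op_matrix n (reduce 1 (stable_op A)) = A"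
    by (simp add: stable_op_eq[OF A] op_matrix_matrix_op[OF A])
  show "reduce (fst (t, stable_op A)) (snd (t, stable_op A)) = stable_op A" if "t \<in> {0..1}" for t
    using fixed[OF that] by simp
next
  fix W n assume W: "W \<in> topspace X \<inter> stages n"
  interpret orthogonal_projection "tail n" by (rule tail_projection)
  show "reduce (fst (0, W)) (snd (0, W)) = W" by (simp add: reduce_0)
  have u: "reduce 1 W \<in> unitary_ops" using W by (intro reduce_unitary) auto
  have "op_matrix n (reduce 1 W) \<in> U_fin n" by (intro op_matrix_U_fin u reduce_1)
  then show "reduce (fst (1, W)) (snd (1, W)) = stable_op (op_matrix n (reduce 1 W))"
    using matrix_op_op_matrix[OF u reduce_1] by (simp add: stable_op_eq)
qed

end

section \<open>Cayley graphs\<close>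

lemma scaleC_i_i: "\<i> *\<^sub>C \<i> *\<^sub>C x = - x"
  by (simp add: scaleC_scaleC)

lemma scaleC_2: "2 *\<^sub>C x = x + x"
  using scaleC_add_left[of 1 1 x] by (simp add: scaleC_one)

lemma csubspace_image:
  fixes f :: "'a::complex_hilbert \<Rightarrow> 'b::complex_hilbert"
  assumes add: "\<And>x y. f (x + y) = f x + f y" and scale: "\<And>c x. f (c *\<^sub>C x) = c *\<^sub>C f x"
    and E: "csubspace E"
  shows "csubspace (f ` E)"
proof (rule complex_vector.subspaceI)
  have "f 0 = 0" using scale[of 0 0] by simp
  then show "0 \<in> f ` E" using complex_vector.subspace_0[OF E] by (metis imageI)
  show "x + y \<in> f ` E" if "x \<in> f ` E" "y \<in> f ` E" for x y
    using that by (auto simp: add[symmetric] intro!: complex_vector.subspace_add[OF E])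
  show "c *\<^sub>C x \<in> f ` E" if "x \<in> f ` E" for c x
    using that by (auto simp: scale[symmetric] intro!: complex_vector.subspace_scale[OF E])
qed

lemma finite_dimensional_image:
  fixes f :: "'a::complex_hilbert \<Rightarrow> 'b::complex_hilbert"
  assumes add: "\<And>x y. f (x + y) = f x + f y" and scale: "\<And>c x. f (c *\<^sub>C x) = c *\<^sub>C f x"
    and E: "finite_dimensional E"
  shows "finite_dimensional (f ` E)"
proof -
  obtain B where B: "finite B" "cspan B = E" using E by (auto simp: finite_dimensional_def)
  have f0: "f 0 = 0" using scale[of 0 0] by simp
  have "f x \<in> cspan (f ` B)" if "x \<in> cspan B" for x
    using that
  proof (induction rule: complex_vector.span_induct_alt)
    case (step c x y)
    then have "f x \<in> cspan (f ` B)" by (auto intro: complex_vector.span_base)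
    then show ?case unfolding add scale using step
      by (intro complex_vector.span_add complex_vector.span_scale)
  qed (simp add: f0 complex_vector.span_zero)
  moreover have "cspan (f ` B) \<subseteq> f ` cspan B"
  proof (rule complex_vector.span_minimal)
    show "f ` B \<subseteq> f ` cspan B" by (intro image_mono complex_vector.span_superset)
    show "csubspace (f ` cspan B)" by (rule csubspace_image[OF add scale complex_vector.subspace_span])
  qed
  ultimately have "f ` E = cspan (f ` B)" using B(2) by blast
  then show ?thesis using B(1) unfolding finite_dimensional_def by (intro exI[of _ "f ` B"]) simp
qed

section \<open>Lagrangians as Cayley graphs of unitary operators\<close>

lemma mem_Cayley: "(x, y) \<in> Cayley W \<longleftrightarrow> (\<exists>v. x = v + W v \<and> y = - (\<i> *\<^sub>C (v - W v)))"
  by (auto simp: Cayley_def)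

lemma csubspace_Cayley:
  assumes "W \<in> bounded_ops"
  shows "csubspace (Cayley W)"
proof (rule complex_vector.subspaceI)
  show "0 \<in> Cayley W" unfolding zero_prod_def mem_Cayley by (rule exI[of _ 0]) simp
  show "p + q \<in> Cayley W" if pq: "p \<in> Cayley W" "q \<in> Cayley W" for p q
  proof -
    obtain u v where "p = (u + W u, - (\<i> *\<^sub>C (u - W u)))" "q = (v + W v, - (\<i> *\<^sub>C (v - W v)))"
      using pq unfolding Cayley_def by blast
    then have "p + q = ((u + v) + W (u + v), - (\<i> *\<^sub>C ((u + v) - W (u + v))))"
      by (simp add: blinfun.add_right complex_vector.scale_right_distrib complex_vector.scale_right_diff_distrib)
    then show ?thesis unfolding Cayley_def by blast
  qed
  show "c *\<^sub>C p \<in> Cayley W" if pq: "p \<in> Cayley W" for c p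
  proof -
    obtain u where "p = (u + W u, - (\<i> *\<^sub>C (u - W u)))"
      using pq unfolding Cayley_def by blast
    then have "c *\<^sub>C p = (c *\<^sub>C u + W (c *\<^sub>C u), - (\<i> *\<^sub>C (c *\<^sub>C u - W (c *\<^sub>C u))))"
      by (simp add: scaleC_prod_def bounded_ops_scaleC[OF assms] complex_vector.scale_right_distrib
          complex_vector.scale_right_diff_distrib scaleC_scaleC mult.commute)
    then show ?thesis unfolding Cayley_def by blast
  qed
qed

lemma lagrangian_Cayley:
  fixes W :: "'a::complex_hilbert \<Rightarrow>\<^sub>L 'a"
  assumes W: "W \<in> unitary_ops"
  shows "lagrangian (Cayley W)"
  unfolding lagrangian_def
proof (intro conjI subset_antisym subsetI)
  show "csubspace (Cayley W)" by (intro csubspace_Cayley unitary_bounded_ops W)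
next
  fix p assume "p \<in> J ` Cayley W"
  then obtain v where p: "p = (- (\<i> *\<^sub>C (v - W v)), - (v + W v))" by (auto simp: Cayley_def J_def)
  show "p \<in> orth_compl (Cayley W)"
    unfolding orth_compl_def
  proof (intro CollectI ballI)
    fix q assume "q \<in> Cayley W"
    then obtain u where q: "q = (u + W u, - (\<i> *\<^sub>C (u - W u)))" unfolding Cayley_def by blast
    show "cinner p q = 0"
      by (simp add: p q cinner_prod_def cinner_simps unitary_cinner[OF W] algebra_simps)
  qed
next
  fix p assume p: "p \<in> orth_compl (Cayley W)"
  obtain a b where ab: "p = (a, b)" by (cases p)
  \<comment> \<open>In terms of \<open>z\<close>, orthogonality of \<open>(a, b)\<close> to the
    graph becomes \<open>W z = \<i> *\<^sub>C b - a\<close>.\<close>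
  define z where "z = a + \<i> *\<^sub>C b"
  have "cinner (W z + (a - \<i> *\<^sub>C b)) (W u) = 0" for u
  proof -
    have "cinner p (u + W u, - (\<i> *\<^sub>C (u - W u))) = 0"
      using p by (auto simp: orth_compl_def Cayley_def)
    then have "cinner z u + cinner (a - \<i> *\<^sub>C b) (W u) = 0"
      by (simp add: ab cinner_prod_def cinner_simps z_def algebra_simps)
    then show ?thesis by (simp add: cinner_add_left unitary_cinner[OF W])
  qed
  then have "cinner (W z + (a - \<i> *\<^sub>C b)) y = 0" for y using unitary_surj[OF W] by (metis surjD)
  then have "W z + (a - \<i> *\<^sub>C b) = 0" using cinner_self_eq_0 by blast
  then have Wz: "W z = \<i> *\<^sub>C b - a" by (simp add: algebra_simps add_eq_0_iff)
  \<comment> \<open>Solves \<open>v + W v = - b\<close> and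
    \<open>v - W v = \<i> *\<^sub>C a\<close>, the conditions for \<open>J\<close> to send the graph
    point of \<open>v\<close> to \<open>(a, b)\<close>.\<close>
  define v where "v = (\<i> / 2) *\<^sub>C z"
  have Wv: "W v = (\<i> / 2) *\<^sub>C (\<i> *\<^sub>C b - a)" by (simp add: v_def unitary_scaleC[OF W] Wz)
  have "z - (\<i> *\<^sub>C b - a) = 2 *\<^sub>C a" "z + (\<i> *\<^sub>C b - a) = 2 *\<^sub>C \<i> *\<^sub>C b"
    unfolding scaleC_2 by (simp_all add: z_def)
  moreover have "v - W v = (\<i> / 2) *\<^sub>C (z - (\<i> *\<^sub>C b - a))" "v + W v = (\<i> / 2) *\<^sub>C (z + (\<i> *\<^sub>C b - a))"
    unfolding Wv unfolding v_def by (simp_all only: complex_vector.scale_right_diff_distrib scaleC_add_right)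
  ultimately have 1: "- (\<i> *\<^sub>C (v - W v)) = a" and 2: "- (v + W v) = b"
    by (simp_all add: scaleC_scaleC scaleC_one)
  have "p = J (v + W v, - (\<i> *\<^sub>C (v - W v)))" using 1 2 by (simp add: ab J_def)
  then show "p \<in> J ` Cayley W" by (auto simp: Cayley_def)
qed

lemma closed_lagrangian:
  fixes L :: "('a::complex_hilbert \<times> 'a) set"
  assumes "lagrangian L"
  shows "closed L"
proof -
  have "inj (J :: 'a \<times> 'a \<Rightarrow> _)" by (auto simp: inj_def J_def)
  then have "p \<in> L \<longleftrightarrow> J p \<in> orth_compl L" for p
    using inj_image_mem_iff[of J p L] assms by (simp add: lagrangian_def)
  then have "L = J -` orth_compl L" by auto
  moreover have "continuous_on UNIV (J :: 'a \<times> 'a \<Rightarrow> _)"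
    unfolding J_def case_prod_beta by (intro continuous_intros)
  then have "closed (J -` orth_compl L)" by (intro closed_vimage closed_orth_compl)
  ultimately show ?thesis by simp
qed

lemma lagrangian_isotropic:
  assumes "lagrangian L" "(x, y) \<in> L" "(x', y') \<in> L"
  shows "cinner y x' = cinner x y'"
proof -
  have "J (x, y) \<in> orth_compl L" using assms by (auto simp: lagrangian_def)
  then have "cinner (J (x, y)) (x', y') = 0" using assms(3) by (auto simp: orth_compl_def)
  then show ?thesis by (simp add: J_def cinner_prod_def cinner_minus_left)
qed

lemma lagrangian_polarization:
  fixes L :: "('a::complex_hilbert \<times> 'a) set" and c :: complex
  assumes L: "lagrangian L" and c: "c * cnj c = 1" "cnj c = - c"
  defines "f \<equiv> \<lambda>p :: 'a \<times> 'a. fst p + c *\<^sub>C snd p"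
  shows "p \<in> L \<Longrightarrow> norm (f p) = norm p" and "\<exists>p\<in>L. f p = z"
proof -
  have sub: "csubspace L" using L by (simp add: lagrangian_def)
  show norm: "norm (f p) = norm p" if "p \<in> L" for p
  proof -
    obtain x y where p: "p = (x, y)" by (cases p)
    have "cinner y x = cinner x y" using lagrangian_isotropic[OF L, of x y x y] that by (simp add: p)
    moreover have "- (c * c) = 1" using c by simp
    then have "c * c = - 1" by (metis minus_minus)
    then have ccw: "c * (c * w) = - w" for w by (simp add: mult.assoc[symmetric])
    ultimately have "cinner (f p) (f p) = cinner p p"
      by (simp add: f_def p cinner_prod_def cinner_simps c(2) algebra_simps) (simp add: ccw)
    then have "(norm (f p))\<^sup>2 = (norm p)\<^sup>2" unfolding cinner_self of_real_eq_iff .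
    then show ?thesis by simp
  qed
  have f_add: "f (p + q) = f p + f q" for p q by (simp add: f_def scaleC_add_right)
  have f_scale: "f (d *\<^sub>C p) = d *\<^sub>C f p" for d p
    by (simp add: f_def scaleC_prod_def scaleC_add_right scaleC_scaleC mult.commute)
  have nc: "norm c = 1"
  proof (rule power2_eq_imp_eq)
    have "complex_of_real ((cmod c)\<^sup>2) = complex_of_real 1" using c(1) by (simp only: complex_norm_square of_real_1)
    then show "(cmod c)\<^sup>2 = 1\<^sup>2" by (simp only: of_real_eq_iff power_one)
  qed auto
  have "bounded_linear f"
  proof (rule bounded_linear_intro[of _ 2])
    show "norm (f p) \<le> norm p * 2" for p
      using norm_triangle_ineq[of "fst p" "c *\<^sub>C snd p"] norm_fst_le[of "fst p" "snd p"] norm_snd_le[of "snd p" "fst p"]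
      by (simp add: f_def norm_scaleC nc)
    show "f (r *\<^sub>R p) = r *\<^sub>R f p" for r p unfolding scaleR_scaleC by (rule f_scale)
  qed (rule f_add)
  then have "complete (f ` L)"
    using norm closed_lagrangian[OF L]
    by (intro complete_isometric_image[of 1]) (auto simp: csubspace_imp_subspace[OF sub] complete_eq_closed)
  then have closed: "closed (f ` L)" by (rule complete_imp_closed)
  have sub_f: "csubspace (f ` L)" by (rule csubspace_image[OF f_add f_scale sub])
  obtain m where m: "m \<in> f ` L" "z - m \<in> orth_compl (f ` L)"
    using closed_csubspace_projection[OF sub_f closed] by blast
  define u where "u = z - m"
  have u: "cinner u (f p) = 0" if "p \<in> L" for p using m(2) that by (auto simp: orth_compl_def u_def)
  have "(u, cnj c *\<^sub>C u) \<in> orth_compl L"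
    unfolding orth_compl_def
  proof (intro CollectI ballI)
    fix p assume "p \<in> L"
    from u[OF this] show "cinner (u, cnj c *\<^sub>C u) p = 0"
      by (simp add: f_def cinner_prod_def cinner_simps)
  qed
  then have "(u, cnj c *\<^sub>C u) \<in> J ` L" using L by (simp add: lagrangian_def)
  then obtain x y where xy: "(x, y) \<in> L" "(u, cnj c *\<^sub>C u) = J (x, y)" by auto
  have y: "y = u" and x: "x = c *\<^sub>C u" using xy(2) c(2) by (auto simp: J_def)
  have "cinner u (f (x, y)) = 0" by (rule u[OF xy(1)])
  then have "2 * (cnj c * cinner u u) = 0"
    unfolding mult_2 by (simp add: f_def x y cinner_add_right cinner_scaleC_right)
  then have "u = 0" using c(1) by auto
  then show "\<exists>p\<in>L. f p = z" using m(1) by (auto simp: u_def)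
qed

text \<open>The inverse Cayley transform: \<open>W\<close> sends \<open>x + \<i> *\<^sub>C y\<close>
  to \<open>x - \<i> *\<^sub>C y\<close> for \<open>(x, y)\<close> in \<open>L\<close>, which is
  well defined and unitary because both expressions are isometries of \<open>L\<close> onto the
  space.\<close>

lemma lagrangian_imp_Cayley:
  fixes L :: "('a::complex_hilbert \<times> 'a) set"
  assumes L: "lagrangian L"
  shows "\<exists>W\<in>unitary_ops. L = Cayley W"
proof -
  define f where "f p = fst p + \<i> *\<^sub>C snd p" for p :: "'a \<times> 'a"
  define g where "g p = fst p + (- \<i>) *\<^sub>C snd p" for p :: "'a \<times> 'a"
  have sub: "csubspace L" using L by (simp add: lagrangian_def)
  have f: "norm (f p) = norm p" "norm (g p) = norm p" if "p \<in> L" for p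
    using lagrangian_polarization(1)[OF L, of \<i> p] lagrangian_polarization(1)[OF L, of "- \<i>" p] that
    by (simp_all add: f_def g_def)
  have f_surj: "\<exists>p\<in>L. f p = z" and g_surj: "\<exists>p\<in>L. g p = z" for z
    using lagrangian_polarization(2)[OF L, of \<i> z] lagrangian_polarization(2)[OF L, of "- \<i>" z]
    by (simp_all add: f_def g_def)
  have lin: "f (p + q) = f p + f q" "g (p + q) = g p + g q" "f (c *\<^sub>C p) = c *\<^sub>C f p" "g (c *\<^sub>C p) = c *\<^sub>C g p"
    "f (p - q) = f p - f q" for p q c
    by (simp_all add: f_def g_def scaleC_prod_def complex_vector.scale_right_distrib
        complex_vector.scale_right_diff_distrib mult.commute)
  obtain h where h: "\<And>z. h z \<in> L" "\<And>z. f (h z) = z" using f_surj by metis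
  have hf: "h (f p) = p" if "p \<in> L" for p
  proof -
    have "h (f p) - p \<in> L" by (intro complex_vector.subspace_diff[OF sub] h that)
    from f(1)[OF this] show ?thesis by (simp add: lin h(2))
  qed
  have h_add: "h (x + y) = h x + h y" for x y
    using hf[of "h x + h y"] complex_vector.subspace_add[OF sub h(1) h(1)] by (simp add: lin h(2))
  have h_scale: "h (c *\<^sub>C x) = c *\<^sub>C h x" for c x
    using hf[of "c *\<^sub>C h x"] complex_vector.subspace_scale[OF sub h(1)] by (simp add: lin h(2))
  have norm: "norm (g (h x)) = norm x" for x
    using f[OF h(1)[of x]] by (simp add: h(2))
  define W where "W = Blinfun (\<lambda>z. g (h z))"
  have "bounded_linear (\<lambda>z. g (h z))"
    by (rule bounded_linear_intro[of _ 1]) (simp_all add: h_add lin norm scaleR_scaleC h_scale)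
  then have W: "W z = g (h z)" for z by (simp add: W_def bounded_linear_Blinfun_apply)
  have "W \<in> unitary_ops"
  proof (rule unitary_opsI)
    show "W \<in> bounded_ops" by (rule bounded_opsI) (simp add: W h_scale lin)
    show "norm (W x) = norm x" for x by (simp add: W norm)
    show "\<exists>x. W x = y" for y using g_surj[of y] hf by (auto simp: W) metis
  qed
  moreover have point: "(v + W v, - (\<i> *\<^sub>C (v - W v))) = 2 *\<^sub>C h v" for v
  proof -
    have v: "v = fst (h v) + \<i> *\<^sub>C snd (h v)" using h(2)[of v] by (simp add: f_def)
    have Wv: "W v = fst (h v) - \<i> *\<^sub>C snd (h v)" by (simp add: W g_def)
    have "v + W v = 2 *\<^sub>C fst (h v)" by (subst v, simp only: Wv scaleC_2) simp
    moreover have "v - W v = \<i> *\<^sub>C (2 *\<^sub>C snd (h v))"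
      by (subst v, simp only: Wv scaleC_2) (simp add: scaleC_add_right)
    ultimately show ?thesis by (simp add: scaleC_prod_def scaleC_i_i)
  qed
  have "L = Cayley W"
  proof (intro subset_antisym subsetI)
    fix p assume p: "p \<in> L"
    \<comment> \<open>Halving compensates for the factor 2 in \<open>point\<close>.\<close>
    define v where "v = f ((1/2) *\<^sub>C p)"
    have "h v = (1/2) *\<^sub>C p" unfolding v_def by (intro hf complex_vector.subspace_scale[OF sub] p)
    then have "p = 2 *\<^sub>C h v" by (simp add: scaleC_one)
    then show "p \<in> Cayley W" unfolding Cayley_def point[symmetric] by blast
  next
    fix p assume "p \<in> Cayley W"
    then show "p \<in> L" using complex_vector.subspace_scale[OF sub h(1)] by (auto simp: Cayley_def point)
  qed
  ultimately show ?thesis by blast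
qed

section \<open>Projections onto Cayley graphs\<close>

lemma orth_proj_eqI:
  fixes P :: "'a::complex_hilbert \<Rightarrow>\<^sub>L 'a"
  assumes L: "csubspace L" and P: "\<And>x. P x \<in> L" "\<And>x. x - P x \<in> orth_compl L"
  shows "orth_proj L = P"
  unfolding orth_proj_def
proof (rule the_equality)
  show "\<forall>x. P x \<in> L \<and> x - P x \<in> orth_compl L" using P by blast
  fix R assume R: "\<forall>x. blinfun_apply R x \<in> L \<and> x - blinfun_apply R x \<in> orth_compl L"
  show "R = P"
  proof (rule blinfun_eqI)
    fix x
    have 1: "R x - P x \<in> L" using R P L by (intro complex_vector.subspace_diff) auto
    have "(x - P x) - (x - R x) \<in> orth_compl L"
      using R P by (intro complex_vector.subspace_diff[OF csubspace_orth_compl, of "x - P x" L "x - R x"]) auto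
    then have "R x - P x \<in> orth_compl L" by simp
    then have "cinner (R x - P x) (R x - P x) = 0" using 1 by (simp add: orth_compl_def)
    then show "R x = P x" by simp
  qed
qed

definition left_incl :: "'a::complex_hilbert \<Rightarrow>\<^sub>L ('a \<times> 'a)" where "left_incl = Blinfun (\<lambda>x. (x, 0))"
definition right_incl :: "'a::complex_hilbert \<Rightarrow>\<^sub>L ('a \<times> 'a)" where "right_incl = Blinfun (\<lambda>x. (0, x))"
definition left_proj :: "('a::complex_hilbert \<times> 'a) \<Rightarrow>\<^sub>L 'a" where "left_proj = Blinfun fst"
definition right_proj :: "('a::complex_hilbert \<times> 'a) \<Rightarrow>\<^sub>L 'a" where "right_proj = Blinfun snd"
definition times_i :: "'a::complex_hilbert \<Rightarrow>\<^sub>L 'a" where "times_i = Blinfun (scaleC \<i>)"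

lemma block_apply [simp]:
  "left_incl x = (x, 0)" "right_incl x = (0, x)" "left_proj p = fst p" "right_proj p = snd p"
  "times_i x = \<i> *\<^sub>C x"
proof -
  have "bounded_linear (\<lambda>x :: 'a. (x, 0 :: 'a))" "bounded_linear (\<lambda>x :: 'a. (0 :: 'a, x))"
    by (intro bounded_linear_Pair bounded_linear_ident bounded_linear_zero)+
  then show "left_incl x = (x, 0)" "right_incl x = (0, x)"
    by (simp_all add: left_incl_def right_incl_def bounded_linear_Blinfun_apply)
  show "left_proj p = fst p" "right_proj p = snd p"
    by (simp_all add: left_proj_def right_proj_def bounded_linear_Blinfun_apply bounded_linear_fst bounded_linear_snd)
  show "times_i x = \<i> *\<^sub>C x"
    by (simp add: times_i_def bounded_linear_Blinfun_apply bounded_bilinear.bounded_linear_right[OF bounded_bilinear_scaleC])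
qed

text \<open>The orthogonal projection onto the Cayley graph is $\frac14 M M^*$ with
  $M v = ((1+W)v, -i(1-W)v)$.\<close>

definition Cayley_proj :: "('a::complex_hilbert \<Rightarrow>\<^sub>L 'a) \<Rightarrow> ('a \<times> 'a) \<Rightarrow>\<^sub>L ('a \<times> 'a)"
  where "Cayley_proj W = (1/4) *\<^sub>R
    ((left_incl o\<^sub>L (((2 *\<^sub>R id_blinfun + W + blinfun_inv W) o\<^sub>L left_proj) +
        (times_i o\<^sub>L (W - blinfun_inv W) o\<^sub>L right_proj))) +
     (right_incl o\<^sub>L ((times_i o\<^sub>L (W - blinfun_inv W) o\<^sub>L left_proj) +
        ((2 *\<^sub>R id_blinfun - W - blinfun_inv W) o\<^sub>L right_proj))))"

lemma Cayley_proj_apply: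
  "Cayley_proj W (x, y) = (1/4) *\<^sub>R
     (2 *\<^sub>R x + W x + blinfun_inv W x + \<i> *\<^sub>C (W y - blinfun_inv W y),
      \<i> *\<^sub>C (W x - blinfun_inv W x) + (2 *\<^sub>R y - W y - blinfun_inv W y))"
  by (simp add: Cayley_proj_def blinfun.bilinear_simps complex_vector.scale_right_diff_distrib)

lemma orth_proj_Cayley:
  fixes W :: "'a::complex_hilbert \<Rightarrow>\<^sub>L 'a"
  assumes W: "W \<in> unitary_ops"
  shows "orth_proj (Cayley W) = Cayley_proj W"
proof (rule orth_proj_eqI)
  show "csubspace (Cayley W)" by (intro csubspace_Cayley unitary_bounded_ops W)
  \<comment> \<open>A quarter of the adjoint of \<open>M\<close> applied to \<open>(x, y)\<close>;
    applying \<open>M\<close> to it gives the projection. The quarter arises because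
    \<open>norm (M v)\<close> is twice \<open>norm v\<close>.\<close>
  let ?u = "\<lambda>x y :: 'a. (1/4) *\<^sub>C (x + blinfun_inv W x + \<i> *\<^sub>C (y - blinfun_inv W y))"
  have quarter: "(1/4) *\<^sub>R x = (1/4) *\<^sub>C x" for x :: 'a by (simp add: scaleR_scaleC)
  have Wu: "W (?u x y) = (1/4) *\<^sub>C (W x + x + \<i> *\<^sub>C (W y - y))" for x y
    by (simp add: unitary_scaleC[OF W] blinfun.bilinear_simps unitary_inv_right[OF W])
  have P: "Cayley_proj W (x, y) = (?u x y + W (?u x y), - (\<i> *\<^sub>C (?u x y - W (?u x y))))" for x y
    unfolding Cayley_proj_apply Wu
    by (simp add: scaleR_2 quarter complex_vector.scale_right_distrib complex_vector.scale_right_diff_distrib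
        complex_vector.scale_minus_left scaleC_scaleC)
  show "Cayley_proj W p \<in> Cayley W" for p
    by (cases p) (auto simp: P Cayley_def)
  show "p - Cayley_proj W p \<in> orth_compl (Cayley W)" for p
  proof -
    obtain x y where p: "p = (x, y)" by (cases p)
    define u where "u = ?u x y"
    have "cinner (p - Cayley_proj W p) (v + W v, - (\<i> *\<^sub>C (v - W v))) = 0" for v
    proof -
      have "cinner (4 *\<^sub>C u) v = cinner x v + cinner x (W v) + \<i> * (cinner y v - cinner y (W v))"
        using unitary_cinner[OF W, of "blinfun_inv W x" v] unitary_cinner[OF W, of "blinfun_inv W y" v]
        by (simp add: u_def cinner_simps scaleC_scaleC scaleC_one unitary_inv_right[OF W])
      moreover have "cinner (Cayley_proj W p) (v + W v, - (\<i> *\<^sub>C (v - W v))) = 4 * cinner u v"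
        unfolding p P u_def[symmetric]
        by (simp add: cinner_prod_def cinner_simps unitary_cinner[OF W] algebra_simps)
      ultimately show ?thesis
        by (simp add: cinner_diff_left p cinner_prod_def cinner_simps algebra_simps)
    qed
    then show ?thesis by (auto simp: orth_compl_def Cayley_def)
  qed
qed

lemma continuous_on_Cayley_proj: "continuous_on unitary_ops Cayley_proj"
proof -
  have "continuous_on unitary_ops (blinfun_inv :: ('a \<Rightarrow>\<^sub>L 'a) \<Rightarrow> _)"
    by (rule continuous_on_subset[OF continuous_on_blinfun_inv])
       (auto simp: unitary_bounded_below unitary_surj)
  then show ?thesis unfolding Cayley_proj_def
    by (intro continuous_intros bounded_bilinear.continuous_on[OF bounded_bilinear_blinfun_compose])
qed

text \<open>Reads \<open>W\<close> off the first block column of the projection, whose entries are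
  \<open>(2 + W + V) / 4\<close> and \<open>\<i> / 4\<close> times \<open>W - V\<close>, with
  \<open>V\<close> the inverse of \<open>W\<close>. Being affine in \<open>P\<close>, it is
  continuous for the norm.\<close>

definition Cayley_inv :: "(('a::complex_hilbert \<times> 'a) \<Rightarrow>\<^sub>L ('a \<times> 'a)) \<Rightarrow> 'a \<Rightarrow>\<^sub>L 'a"
  where "Cayley_inv P = 2 *\<^sub>R (left_proj o\<^sub>L P o\<^sub>L left_incl) - id_blinfun
           - 2 *\<^sub>R (times_i o\<^sub>L right_proj o\<^sub>L P o\<^sub>L left_incl)"

lemma Cayley_inv_Cayley_proj: "Cayley_inv (Cayley_proj W) = W"
proof (rule blinfun_eqI)
  fix x
  have "Cayley_inv (Cayley_proj W) x = 2 *\<^sub>R fst (Cayley_proj W (x, 0)) - x - 2 *\<^sub>R \<i> *\<^sub>C snd (Cayley_proj W (x, 0))"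
    by (simp add: Cayley_inv_def blinfun.bilinear_simps)
  also have "\<dots> = (1/2) *\<^sub>R (2 *\<^sub>R x + W x + blinfun_inv W x) - x + (1/2) *\<^sub>R (W x - blinfun_inv W x)"
    unfolding Cayley_proj_apply
    by (simp add: scaleR_scaleC[of "1/4"] scaleC_scaleC mult.commute scaleR_scaleC[of "1/2"] scaleR_scaleC[of 2]
       complex_vector.scale_right_distrib complex_vector.scale_right_diff_distrib)
  also have "\<dots> = W x" by (simp add: algebra_simps scaleR_2[symmetric])
  finally show "Cayley_inv (Cayley_proj W) x = W x" .
qed

lemma continuous_on_Cayley_inv: "continuous_on S Cayley_inv"
  unfolding Cayley_inv_def
  by (intro continuous_intros bounded_bilinear.continuous_on[OF bounded_bilinear_blinfun_compose])

lemma homeomorphic_map_Cayley_Lag_minus: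
  "homeomorphic_map (top_of_set {W \<in> unitary_ops. Cayley W \<in> Lag_minus}) Lag_minus_topology
     (Cayley :: ('a::complex_hilbert \<Rightarrow>\<^sub>L 'a) \<Rightarrow> _)"
proof -
  let ?U = "{W \<in> unitary_ops. Cayley W \<in> Lag_minus} :: ('a \<Rightarrow>\<^sub>L 'a) set"
  let ?g = "Cayley_inv \<circ> orth_proj :: ('a \<times> 'a) set \<Rightarrow> _"
  have g: "?g (Cayley W) = W" if "W \<in> unitary_ops" for W
    using that by (simp add: orth_proj_Cayley Cayley_inv_Cayley_proj)
  have top: "topspace Lag_minus_topology = (Lag_minus :: ('a \<times> 'a) set set)"
    by (auto simp: Lag_minus_topology_def Lag_topology_def topspace_pullback_topology Lag_minus_def)
  have ex: "\<exists>W\<in>?U. L = Cayley W" if "L \<in> Lag_minus" for L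
    using that lagrangian_imp_Cayley[of L] by (auto simp: Lag_minus_def)
  have "continuous_map (top_of_set ?U) Lag_topology Cayley"
    unfolding Lag_topology_def
  proof (rule continuous_map_pullback')
    have "continuous_on ?U (orth_proj \<circ> Cayley)"
      by (rule continuous_on_eq[OF continuous_on_subset[OF continuous_on_Cayley_proj]])
         (auto simp: orth_proj_Cayley)
    then show "continuous_map (top_of_set ?U) euclidean (orth_proj \<circ> Cayley)" by simp
    show "topspace (top_of_set ?U) \<subseteq> Cayley -` {L. lagrangian L}"
      by (auto simp: lagrangian_Cayley)
  qed
  then have 1: "continuous_map (top_of_set ?U) Lag_minus_topology Cayley"
    unfolding Lag_minus_topology_def by (auto simp: continuous_map_in_subtopology)
  have "continuous_map Lag_topology euclidean ?g"
    unfolding Lag_topology_def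
    by (rule continuous_map_pullback) (simp add: continuous_on_Cayley_inv)
  then have "continuous_map Lag_minus_topology euclidean ?g"
    unfolding Lag_minus_topology_def by (rule continuous_map_from_subtopology)
  moreover have "?g L \<in> ?U" if L: "L \<in> Lag_minus" for L
  proof -
    obtain W where W: "W \<in> ?U" "L = Cayley W" using ex[OF L] by blast
    then have "?g L = W" using g by simp
    then show ?thesis using W(1) by (simp only:)
  qed
  ultimately have 2: "continuous_map Lag_minus_topology (top_of_set ?U) ?g"
    by (auto simp: continuous_map_in_subtopology top)
  have "homeomorphic_maps (top_of_set ?U) Lag_minus_topology Cayley ?g"
    unfolding homeomorphic_maps_def
  proof (intro conjI ballI 1 2)
    show "?g (Cayley W) = W" if "W \<in> topspace (top_of_set ?U)" for W using that by (intro g) simp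
    show "Cayley (?g L) = L" if "L \<in> topspace Lag_minus_topology" for L
    proof -
      have "L \<in> Lag_minus" using that by (simp only: top)
      then obtain W where W: "W \<in> ?U" "L = Cayley W" using ex by blast
      then have "?g L = W" using g by simp
      then show ?thesis using W(2) by simp
    qed
  qed
  then show ?thesis using homeomorphic_maps_map by blast
qed

section \<open>Fredholm Lagrangians\<close>

text \<open>The first coordinate of a graph point vanishes when \<open>W v = - v\<close>, and then
  the second is a fixed multiple of \<open>v\<close>. The finiteness condition on a Lagrangian thus
  concerns the kernel of \<open>1 + W\<close>.\<close>

lemma Cayley_inter_H_minus:
  fixes W :: "'a::complex_hilbert \<Rightarrow>\<^sub>L 'a"
  shows "Cayley W \<inter> H_minus = (\<lambda>v. (0, (- 2 * \<i>) *\<^sub>C v)) ` {v. v + W v = 0}"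
proof -
  have eq: "- (\<i> *\<^sub>C (v - W v)) = (- 2 * \<i>) *\<^sub>C v" if "v + W v = 0" for v :: 'a
  proof -
    have "W v = - v" using that by (simp add: add_eq_0_iff)
    then have "v - W v = 2 *\<^sub>C v" by (simp add: scaleC_2)
    then show ?thesis by (simp add: scaleC_scaleC mult.commute)
  qed
  show ?thesis
  proof (intro subset_antisym subsetI)
    fix p assume p: "p \<in> Cayley W \<inter> H_minus"
    then obtain v where v: "p = (v + W v, - (\<i> *\<^sub>C (v - W v)))" unfolding Cayley_def by blast
    then have v0: "v + W v = 0" using p by (simp add: H_minus_def)
    have "p = (0, (- 2 * \<i>) *\<^sub>C v)" unfolding v eq[OF v0] v0 ..
    then show "p \<in> (\<lambda>v. (0, (- 2 * \<i>) *\<^sub>C v)) ` {v. v + W v = 0}" using v0 by blast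
  next
    fix p :: "'a \<times> 'a" assume "p \<in> (\<lambda>v. (0, (- 2 * \<i>) *\<^sub>C v)) ` {v. v + W v = 0}"
    then obtain v where v: "v + W v = 0" "p = (0, (- 2 * \<i>) *\<^sub>C v)" by blast
    then have "p = (v + W v, - (\<i> *\<^sub>C (v - W v)))" using eq[OF v(1)] by simp
    then have "p \<in> Cayley W" unfolding Cayley_def by blast
    then show "p \<in> Cayley W \<inter> H_minus" by (simp add: H_minus_def v(2))
  qed
qed

text \<open>Adding \<open>H_minus\<close> frees the second coordinate, so the closedness condition
  on a Lagrangian concerns the range of \<open>1 + W\<close>.\<close>

lemma Cayley_plus_H_minus:
  fixes W :: "'a::complex_hilbert \<Rightarrow>\<^sub>L 'a"
  shows "{p + q | p q. p \<in> Cayley W \<and> q \<in> H_minus} = range (\<lambda>v. v + W v) \<times> (UNIV :: 'a set)"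
proof (intro subset_antisym subsetI)
  fix p :: "'a \<times> 'a" assume "p \<in> range (\<lambda>v. v + W v) \<times> UNIV"
  then obtain v y where p: "p = (v + W v, y)" by auto
  have "p = (v + W v, - (\<i> *\<^sub>C (v - W v))) + (0, y + \<i> *\<^sub>C (v - W v))" by (simp add: p)
  moreover have "(v + W v, - (\<i> *\<^sub>C (v - W v))) \<in> Cayley W" by (auto simp: Cayley_def)
  moreover have "(0, y + \<i> *\<^sub>C (v - W v)) \<in> H_minus" by (simp add: H_minus_def)
  ultimately show "p \<in> {p + q | p q. p \<in> Cayley W \<and> q \<in> H_minus}" by blast
qed (auto simp: Cayley_def H_minus_def)

lemma csubspace_kernel:
  assumes "W \<in> bounded_ops"
  shows "csubspace {v. v + W v = 0}"
proof (rule complex_vector.subspaceI)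
  show "x + y \<in> {v. v + W v = 0}" if "x \<in> {v. v + W v = 0}" "y \<in> {v. v + W v = 0}" for x y
  proof -
    have "(x + y) + W (x + y) = (x + W x) + (y + W y)" by (simp add: blinfun.add_right)
    also have "\<dots> = 0" using that by simp
    finally show ?thesis by simp
  qed
  show "c *\<^sub>C x \<in> {v. v + W v = 0}" if "x \<in> {v. v + W v = 0}" for c x
  proof -
    have "c *\<^sub>C x + W (c *\<^sub>C x) = c *\<^sub>C (x + W x)" by (simp add: bounded_ops_scaleC[OF assms] scaleC_add_right)
    also have "\<dots> = 0" using that by simp
    finally show ?thesis by simp
  qed
qed simp

lemma csubspace_range:
  assumes "W \<in> bounded_ops"
  shows "csubspace (range (\<lambda>v. v + W v))"
  by (rule csubspace_image)
     (auto simp: blinfun.add_right bounded_ops_scaleC[OF assms] scaleC_add_right)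

text \<open>By uniform boundedness it suffices to bound \<open>inner x f\<close> over
  \<open>B\<close> for each \<open>f\<close>. Closed range splits \<open>f\<close> into
  \<open>g + W g\<close> and a vector orthogonal to the range, which lies in the kernel and does not
  contribute; unitarity rewrites the rest as \<open>inner (x + W x) (W g)\<close>, at most
  \<open>norm g\<close> in absolute value.\<close>

lemma closed_range_bounded_below:
  fixes W :: "'a::complex_hilbert \<Rightarrow>\<^sub>L 'a"
  assumes W: "W \<in> unitary_ops" and closed: "closed (range (\<lambda>v. v + W v))"
  shows "\<exists>c>0. \<forall>x\<in>orth_compl {v. v + W v = 0}. norm x \<le> c * norm (x + W x)"
proof -
  let ?E = "{v. v + W v = 0}"
  define B where "B = {x \<in> orth_compl ?E. norm (x + W x) \<le> 1}"
  have "\<exists>c. \<forall>x\<in>B. \<bar>inner x f\<bar> \<le> c" for f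
  proof -
    obtain m where m: "m \<in> range (\<lambda>v. v + W v)" "f - m \<in> orth_compl (range (\<lambda>v. v + W v))"
      using closed_csubspace_projection[OF csubspace_range[OF unitary_bounded_ops[OF W]] closed] by blast
    obtain g where g: "m = g + W g" using m(1) by blast
    \<comment> \<open>For unitary \<open>W\<close> the orthogonal complement of the range of
      \<open>1 + W\<close> is contained in its kernel: shift \<open>W\<close> across the product and
      use that \<open>W\<close> is onto.\<close>
    have "cinner (W (f - m) + (f - m)) (W v) = 0" for v
      using m(2) by (auto simp: orth_compl_def cinner_add_left cinner_add_right unitary_cinner[OF W])
    then have "cinner (W (f - m) + (f - m)) y = 0" for y using unitary_surj[OF W] by (metis surjD)
    then have "W (f - m) + (f - m) = 0" using cinner_self_eq_0 by blast
    then have fm: "f - m \<in> ?E" by (simp add: add.commute)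
    have "\<bar>inner x f\<bar> \<le> norm g" if x: "x \<in> B" for x
    proof -
      have "inner x (f - m) = 0" using x fm by (auto simp: B_def orth_compl_def inner_eq_Re_cinner)
      then have "inner x f = inner x (g + W g)" by (simp add: inner_diff_right g)
      also have "\<dots> = inner (x + W x) (W g)"
        by (simp add: inner_add_left inner_add_right unitary_inner[OF W])
      also have "\<bar>\<dots>\<bar> \<le> norm (x + W x) * norm (W g)" by (rule Cauchy_Schwarz_ineq2)
      also have "\<dots> \<le> 1 * norm g" using x by (intro mult_mono) (auto simp: B_def unitary_norm[OF W])
      finally show ?thesis by simp
    qed
    then show ?thesis by blast
  qed
  then have "\<exists>c. \<forall>x\<in>B. norm x \<le> c" by (rule pointwise_bounded_imp_bounded)
  then obtain c where c: "\<And>x. x \<in> B \<Longrightarrow> norm x \<le> c" by blast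
  \<comment> \<open>\<open>c\<close> bounds the norms on \<open>B\<close> and may be 0, whereas the
    constant claimed must be positive.\<close>
  have "norm x \<le> max c 1 * norm (x + W x)" if x: "x \<in> orth_compl ?E" for x
  proof (cases "x + W x = 0")
    case True
    then have "cinner x x = 0" using x unfolding orth_compl_def by blast
    then show ?thesis by simp
  next
    case False
    define r where "r = norm (x + W x)"
    have r: "r > 0" using False by (simp add: r_def)
    have "(1 / r) *\<^sub>R x + W ((1 / r) *\<^sub>R x) = (1 / r) *\<^sub>R (x + W x)"
      by (simp add: blinfun.scaleR_right scaleR_add_right)
    then have "norm ((1 / r) *\<^sub>R x + W ((1 / r) *\<^sub>R x)) \<le> 1" using r by (simp add: r_def)
    moreover have "(1 / r) *\<^sub>R x \<in> orth_compl ?E"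
      using x by (auto simp: orth_compl_def cinner_scaleR_left)
    ultimately have "norm ((1 / r) *\<^sub>R x) \<le> c" by (intro c) (simp add: B_def)
    then have "norm x \<le> c * r" using r by (simp add: field_simps)
    also have "\<dots> \<le> max c 1 * r" using r by (intro mult_right_mono) auto
    finally show ?thesis by (simp add: r_def)
  qed
  then show ?thesis by (intro exI[of _ "max c 1"]) auto
qed

section \<open>The Fredholm condition as membership in a stage\<close>

context hilbert_basis
begin

text \<open>Otherwise take the vectors \<open>y n\<close> of \<open>not_stage_sequence\<close> and
  split off their components \<open>a n\<close> in the kernel of \<open>1 + W\<close>. These tend to
  0, as the kernel has a finite orthonormal basis and \<open>cinner (y n) u\<close> is bounded by
  \<open>norm (tail n u)\<close>. The rest tends to 0 by the lower bound on the complement of the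
  kernel, contradicting \<open>norm (y n) = 1\<close>.\<close>

lemma Lag_minus_imp_stage:
  assumes W: "W \<in> unitary_ops" and Lag: "Cayley W \<in> Lag_minus"
  shows "W \<in> (\<Union>n. stages n)"
proof (rule ccontr)
  assume "W \<notin> (\<Union>n. stages n)"
  then obtain y where y: "\<And>n. tail n (y n) = y n" "\<And>n. norm (y n) = 1"
    "\<And>n. norm (y n + W (y n)) \<le> 1 / (real n + 1)"
    using not_stage_sequence[OF W] by blast
  let ?E = "{v. v + W v = 0}"
  have "closed (range (\<lambda>v. v + W v) \<times> (UNIV :: 'a set))"
    using Lag unfolding Cayley_plus_H_minus[symmetric] Lag_minus_def by blast
  then have "closed ((\<lambda>x. (x, 0 :: 'a)) -` (range (\<lambda>v. v + W v) \<times> UNIV))"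
    by (intro closed_vimage continuous_intros)
  moreover have "(\<lambda>x. (x, 0 :: 'a)) -` (range (\<lambda>v. v + W v) \<times> UNIV) = range (\<lambda>v. v + W v)" by auto
  ultimately obtain c where c: "c > 0" "\<And>x. x \<in> orth_compl ?E \<Longrightarrow> norm x \<le> c * norm (x + W x)"
    using closed_range_bounded_below[OF W] by auto
  \<comment> \<open>The coefficient \<open>\<i> / 2\<close> undoes the factor
    \<open>- 2 * \<i>\<close> in \<open>Cayley_inter_H_minus\<close>.\<close>
  have "finite_dimensional ((\<lambda>p. (\<i> / 2) *\<^sub>C snd p) ` (Cayley W \<inter> H_minus))"
    by (rule finite_dimensional_image)
       (use Lag in \<open>auto simp: Lag_minus_def scaleC_add_right scaleC_prod_def scaleC_scaleC mult.commute\<close>)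
  also have "(\<lambda>p. (\<i> / 2) *\<^sub>C snd p) ` (Cayley W \<inter> H_minus) = ?E"
    unfolding Cayley_inter_H_minus image_image by (simp add: scaleC_scaleC scaleC_one)
  finally obtain S where S: "finite S" "orthonormal S" "cspan S = ?E"
    using finite_dimensional_orthonormal by blast
  define a where "a n = (\<Sum>u\<in>S. cinner (y n) u *\<^sub>C u)" for n
  have "a \<longlonglongrightarrow> (\<Sum>u\<in>S. 0 *\<^sub>C u)"
    unfolding a_def
  proof (intro tendsto_sum tendsto_scaleC tendsto_const)
    fix u
    have "norm (cinner (y n) u) \<le> norm (tail n u)" for n
      using cmod_cinner_le[of "y n" "tail n u"] y(2)[of n]
        orthogonal_projection.Q_sym[OF tail_projection, of n "y n" u] by (simp add: y(1))
    then have "eventually (\<lambda>n. norm (cinner (y n) u) \<le> norm (tail n u)) sequentially" by simp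
    moreover have "(\<lambda>n. norm (tail n u)) \<longlonglongrightarrow> 0" using tail_tendsto_0 by (rule tendsto_norm_zero)
    ultimately show "(\<lambda>n. cinner (y n) u) \<longlonglongrightarrow> 0" by (rule Lim_null_comparison)
  qed
  then have a: "a \<longlonglongrightarrow> 0" by simp
  have aE: "a n + W (a n) = 0" for n
  proof -
    have "a n \<in> cspan S" unfolding a_def
      by (intro complex_vector.span_sum complex_vector.span_scale complex_vector.span_base)
    then show ?thesis using S(3) by simp
  qed
  have "norm (y n - a n) \<le> c * (1 / (real n + 1))" for n
  proof -
    have "y n - a n \<in> orth_compl ?E"
      unfolding S(3)[symmetric] orth_compl_def a_def
      using orthonormal_expansion_residual[OF S(1,2)] by blast
    then have "norm (y n - a n) \<le> c * norm ((y n - a n) + W (y n - a n))" by (rule c(2))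
    also have "(y n - a n) + W (y n - a n) = (y n + W (y n)) - (a n + W (a n))"
      by (simp add: blinfun.diff_right)
    also have "c * norm \<dots> \<le> c * (1 / (real n + 1))"
      using c(1) y(3)[of n] by (intro mult_left_mono) (auto simp: aE)
    finally show ?thesis .
  qed
  then have "eventually (\<lambda>n. norm (y n - a n) \<le> c * (1 / (real n + 1))) sequentially" by simp
  moreover have "(\<lambda>n. c * (1 / (real n + 1))) \<longlonglongrightarrow> 0"
    using tendsto_mult[OF tendsto_const inverse_Suc_tendsto_0, of c] by simp
  ultimately have "(\<lambda>n. y n - a n) \<longlonglongrightarrow> 0"
    by (rule Lim_null_comparison)
  from tendsto_add[OF this a] have "y \<longlonglongrightarrow> 0" by simp
  then have "(\<lambda>n. norm (y n)) \<longlonglongrightarrow> 0" by (rule tendsto_norm_zero)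
  then show False using y(2) by (simp add: LIMSEQ_const_iff)
qed

lemma csubspace_range_tail: "csubspace (range (tail n))"
  by (rule csubspace_image)
    (simp_all add: blinfun.add_right bounded_ops_scaleC[OF orthogonal_projection.Q_bounded[OF tail_projection]])

lemma mem_range_tail: "y \<in> range (tail n) \<longleftrightarrow> tail n y = y"
  using tail_tail[of n n] by (metis order_refl rangeE rangeI)

lemma tail_Suc: "tail k y = tail (Suc k) y + cinner y (e k) *\<^sub>C e k"
  by (simp add: tail_apply)

text \<open>On the range of \<open>tail n\<close> the operator \<open>1 + W\<close> is injective
  with closed image. Going down from \<open>n\<close> to 0, each step adds one basis vector to the
  domain: the image grows by at most a line, which preserves closedness, and the kernel by at most
  one dimension, since two kernel vectors can be combined to cancel the new coordinate.\<close>

lemma stage_imp_Lag_minus: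
  assumes W: "W \<in> stages n"
  shows "Cayley W \<in> Lag_minus"
proof -
  interpret orthogonal_projection "tail n" by (rule tail_projection)
  have u: "W \<in> unitary_ops" by (rule stage_unitary[OF W])
  define T where "T = id_blinfun + W"
  have T: "T v = v + W v" for v by (simp add: T_def blinfun.add_left)
  have T_scale: "T (c *\<^sub>C v) = c *\<^sub>C T v" for c v by (simp add: T unitary_scaleC[OF u] scaleC_add_right)
  obtain c where c: "c > 0" "\<And>y. c * norm (tail n y) \<le> norm (tail n y + W (tail n y))"
    using W by (auto simp: stage_def)
  have "closed (T ` range (tail k))" if "k \<le> n" for k
    using that
  proof (induction rule: inc_induct)
    case base
    have "range (tail n) = {y. tail n y = y}" using mem_range_tail by blast
    moreover have "closed {y. tail n y = y}" by (intro closed_Collect_eq continuous_intros)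
    ultimately have "complete (range (tail n))" by (simp add: complete_eq_closed)
    then have "complete (T ` range (tail n))"
      using c by (intro complete_isometric_image[of c "range (tail n)" "blinfun_apply T"]) (auto simp: T csubspace_imp_subspace[OF csubspace_range_tail] blinfun.bounded_linear_right)
    then show ?case by (rule complete_imp_closed)
  next
    case (step k)
    have "T ` range (tail k) = {m + c *\<^sub>C T (e k) | m c. m \<in> T ` range (tail (Suc k))}"
    proof (intro subset_antisym subsetI)
      fix z assume "z \<in> T ` range (tail k)"
      then obtain y where "z = T (tail (Suc k) y) + cinner y (e k) *\<^sub>C T (e k)"
        by (auto simp: tail_Suc[of k] blinfun.add_right T_scale)
      then show "z \<in> {m + c *\<^sub>C T (e k) | m c. m \<in> T ` range (tail (Suc k))}" by blast
    next
      fix z assume "z \<in> {m + c *\<^sub>C T (e k) | m c. m \<in> T ` range (tail (Suc k))}"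
      then obtain y c where "z = T (tail (Suc k) y) + c *\<^sub>C T (e k)" by blast
      then have "z = T (tail k (tail (Suc k) y) + c *\<^sub>C tail k (e k))"
        by (simp add: blinfun.add_right T_scale tail_tail tail_basis)
      also have "tail k (tail (Suc k) y) + c *\<^sub>C tail k (e k) = tail k (tail (Suc k) y + c *\<^sub>C e k)"
        by (simp add: blinfun.add_right bounded_ops_scaleC[OF orthogonal_projection.Q_bounded[OF tail_projection]])
      finally show "z \<in> T ` range (tail k)" by blast
    qed
    moreover have "csubspace (T ` range (tail (Suc k)))"
      by (intro csubspace_image csubspace_range_tail) (simp_all add: blinfun.add_right T_scale)
    ultimately show ?case using closed_add_line[OF _ step.IH] by simp
  qed
  from this[of 0] have "closed (range (\<lambda>v. v + W v))" by (simp add: image_image tail_apply T)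
  then have "closed (range (\<lambda>v. v + W v) \<times> (UNIV :: 'a set))" by (intro closed_Times) auto
  moreover have "finite_dimensional {v. v + W v = 0 \<and> tail k v = v}" if "k \<le> n" for k
    using that
  proof (induction rule: inc_induct)
    case base
    have "v = 0" if "v + W v = 0" "tail n v = v" for v
    proof -
      have "c * norm v \<le> 0" using c(2)[of v] unfolding that(2) that(1) by simp
      then show ?thesis using c(1) by (simp add: mult_le_0_iff)
    qed
    moreover have "0 + W 0 = 0 \<and> tail n 0 = 0" by simp
    ultimately have "{v. v + W v = 0 \<and> tail n v = v} = cspan {}"
      unfolding complex_vector.span_empty by blast
    then show ?case unfolding finite_dimensional_def by (intro exI[of _ "{}"]) simp
  next
    case (step k)
    let ?F = "\<lambda>k. {v. v + W v = 0 \<and> tail k v = v}"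
    obtain B where B: "finite B" "cspan B = ?F (Suc k)" using step.IH by (auto simp: finite_dimensional_def)
    have F: "?F k = {v. v + W v = 0} \<inter> range (tail k)" for k using mem_range_tail by blast
    have subF: "csubspace (?F k)" for k
      unfolding F by (intro complex_vector.subspace_inter csubspace_kernel unitary_bounded_ops u csubspace_range_tail)
    have le: "?F (Suc k) \<subseteq> ?F k" using tail_tail[of k "Suc k"] by auto (metis)
    have down: "v \<in> ?F (Suc k)" if "v \<in> ?F k" "cinner v (e k) = 0" for v
      using that tail_Suc[of k v] by simp
    show ?case
    proof (cases "\<forall>v\<in>?F k. cinner v (e k) = 0")
      case True
      then have "?F k = ?F (Suc k)" using le down by blast
      then show ?thesis using step.IH by simp
    next
      case False
      then obtain v where v: "v \<in> ?F k" "cinner v (e k) \<noteq> 0" by blast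
      have "cspan (insert v B) = ?F k"
      proof (intro subset_antisym)
        show "cspan (insert v B) \<subseteq> ?F k"
          using v(1) le complex_vector.span_superset[of B] unfolding B(2)
          by (intro complex_vector.span_minimal subF) blast
        show "?F k \<subseteq> cspan (insert v B)"
        proof
          fix w assume w: "w \<in> ?F k"
          define d where "d = cinner w (e k) / cinner v (e k)"
          have "w - d *\<^sub>C v \<in> ?F k"
            by (intro complex_vector.subspace_diff[OF subF] complex_vector.subspace_scale[OF subF] w v)
          moreover have "cinner (w - d *\<^sub>C v) (e k) = 0" using v(2) by (simp add: d_def cinner_simps)
          ultimately have "w - d *\<^sub>C v \<in> cspan B" unfolding B(2) by (rule down)
          then show "w \<in> cspan (insert v B)" unfolding complex_vector.span_insert by blast
        qed
      qed
      then show ?thesis using B(1) unfolding finite_dimensional_def by (intro exI[of _ "insert v B"]) simp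
    qed
  qed
  from this[of 0] have "finite_dimensional {v. v + W v = 0}" by (simp add: tail_apply)
  then have "finite_dimensional (Cayley W \<inter> H_minus)"
    unfolding Cayley_inter_H_minus
    by (rule finite_dimensional_image[rotated 2])
       (simp_all add: scaleC_add_right scaleC_prod_def scaleC_scaleC mult.commute)
  ultimately show ?thesis
    using lagrangian_Cayley[OF u] unfolding Cayley_plus_H_minus[symmetric] Lag_minus_def by blast
qed

lemma Cayley_Lag_minus_iff_stage: "{W \<in> unitary_ops. Cayley W \<in> Lag_minus} = (\<Union>n. stages n)"
  using Lag_minus_imp_stage stage_imp_Lag_minus orthogonal_projection.stage_unitary[OF tail_projection] by blast

lemma weakly_homotopy_equivalent_Lag_minus:
  "weakly_homotopy_equivalent (Lag_minus_topology :: ('a \<times> 'a) set topology) U_infinity_topology"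
proof -
  let ?U = "\<Union>n. stages n"
  have st: "stable_op A \<in> ?U" if "A \<in> U_fin n" for A n
    using matrix_op_stage[OF that] by (auto simp: stable_op_eq[OF that])
  have "stage_retraction (top_of_set ?U) stable_op (\<lambda>n. topspace (top_of_set ?U) \<inter> stages n)
           (\<lambda>n W. op_matrix n (reduction n 1 W)) (\<lambda>n z. reduction n (fst z) (snd z))"
  proof (rule stage_retraction_unitary)
    fix n
    have "continuous_on (U_fin n) stable_op"
      by (rule continuous_on_eq[OF continuous_on_matrix_op]) (simp add: stable_op_eq)
    then show "continuous_map (top_of_set (U_fin n)) (top_of_set ?U) stable_op"
      using st by auto
    interpret orthogonal_projection "tail n" by (rule tail_projection)
    have "subtopology (top_of_set ?U) stage = top_of_set stage"
      by (simp add: subtopology_subtopology) (metis Int_absorb1 UN_upper UNIV_I)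
    then have eq: "prod_topology (top_of_set {0..1}) (subtopology (top_of_set ?U) stage) = top_of_set ({0..1} \<times> stage)"
      by (simp add: prod_topology_subtopology_eu)
    show "continuous_map (prod_topology (top_of_set {0..1}) (subtopology (top_of_set ?U) stage)) (top_of_set ?U)
       (\<lambda>z. reduce (fst z) (snd z))"
      unfolding eq
    proof (intro continuous_map_into_subtopology)
      show "continuous_map (top_of_set ({0..1} \<times> stage)) euclidean (\<lambda>z. reduce (fst z) (snd z))"
        using continuous_on_reduce by simp
      have "reduce (fst z) (snd z) \<in> stage" if "z \<in> {0..1} \<times> stage" for z
        using that by (intro reduce_stage) auto
      then show "(\<lambda>z. reduce (fst z) (snd z)) \<in> topspace (top_of_set ({0..1} \<times> stage)) \<rightarrow> ?U"
        by (intro Pi_I UN_I[of n]) auto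
    qed
  qed auto
  moreover have "homeomorphic_map (top_of_set ?U) Lag_minus_topology Cayley"
    using homeomorphic_map_Cayley_Lag_minus[where 'a = 'a] unfolding Cayley_Lag_minus_iff_stage .
  ultimately have "weak_homotopy_equivalence U_infinity_topology Lag_minus_topology (Cayley \<circ> stable_op)"
    by (rule stage_retraction.homeomorphic_transfer)
  then show ?thesis unfolding weakly_homotopy_equivalent_def by blast
qed

end

section \<open>Normed ideals\<close>

locale normed_ideal =
  fixes I :: "('a::complex_hilbert \<Rightarrow>\<^sub>L 'a) set" and N :: "('a \<Rightarrow>\<^sub>L 'a) \<Rightarrow> real"
  assumes ideal: "two_sided_ideal I" and norm: "norm_on I N"
    and norm_compose: "S \<in> bounded_ops \<Longrightarrow> A \<in> I \<Longrightarrow> T \<in> bounded_ops \<Longrightarrow>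
                         N (S o\<^sub>L A o\<^sub>L T) \<le> norm S * N A * norm T"
    and finer: "open V \<Longrightarrow> openin (ideal_topology I N) (I \<inter> V)"
begin

sublocale Metric_space I "ideal_dist I N"
  by (rule Metric_space_ideal_dist[OF ideal norm])

lemma mtopology_ideal: "mtopology = ideal_topology I N"
  by (simp add: ideal_topology_def)

lemma topspace_ideal: "topspace (ideal_topology I N) = I"
  by (simp flip: mtopology_ideal)

lemma ideal_add: "A \<in> I \<Longrightarrow> B \<in> I \<Longrightarrow> A + B \<in> I"
  using ideal by (simp add: two_sided_ideal_def)

lemma ideal_compose: "S \<in> bounded_ops \<Longrightarrow> A \<in> I \<Longrightarrow> T \<in> bounded_ops \<Longrightarrow> S o\<^sub>L A o\<^sub>L T \<in> I"
  using ideal by (simp add: two_sided_ideal_def)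

lemma ideal_diff:
  assumes "A \<in> I" "B \<in> I"
  shows "A - B \<in> I"
proof -
  have "- id_blinfun \<in> (bounded_ops :: ('a \<Rightarrow>\<^sub>L 'a) set)"
    by (simp add: bounded_ops_def blinfun.minus_left complex_vector.scale_minus_right)
  then have "- id_blinfun o\<^sub>L B o\<^sub>L id_blinfun \<in> I" using assms by (intro ideal_compose bounded_ops_id)
  moreover have "- id_blinfun o\<^sub>L B o\<^sub>L id_blinfun = - B"
    by (rule blinfun_eqI) (simp add: blinfun.minus_left)
  ultimately show ?thesis using ideal_add[OF assms(1), of "- B"] by simp
qed

lemma norm_nonneg: "A \<in> I \<Longrightarrow> 0 \<le> N A"
  using norm by (simp add: norm_on_def)

lemma norm_add: "A \<in> I \<Longrightarrow> B \<in> I \<Longrightarrow> N (A + B) \<le> N A + N B"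
  using norm by (simp add: norm_on_def)

text \<open>Mixed continuity of products: ideal norm for the middle factor, operator norm for the
  outer ones. The difference of two products telescopes into three terms, each controlled by
  \<open>norm_compose\<close>.\<close>

lemma continuous_ideal_compose:
  assumes A: "continuous_map Z (ideal_topology I N) A"
    and L: "continuous_map Z euclidean L" "\<And>z. z \<in> topspace Z \<Longrightarrow> L z \<in> bounded_ops"
    and R: "continuous_map Z euclidean R" "\<And>z. z \<in> topspace Z \<Longrightarrow> R z \<in> bounded_ops"
  shows "continuous_map Z (ideal_topology I N) (\<lambda>z. L z o\<^sub>L A z o\<^sub>L R z)"
  unfolding continuous_map_atin
proof
  fix a assume a: "a \<in> topspace Z"
  let ?F = "atin Z a"
  have ev: "eventually (\<lambda>z. z \<in> topspace Z) ?F"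
    unfolding eventually_atin using openin_topspace a by blast
  have AI: "A z \<in> I" if "z \<in> topspace Z" for z
    using continuous_map_funspace[OF A] that by (auto simp: topspace_ideal)
  have "limitin mtopology A (A a) ?F"
    using A a unfolding mtopology_ideal continuous_map_atin by blast
  then have "((\<lambda>z. ideal_dist I N (A z) (A a)) \<longlongrightarrow> 0) ?F" unfolding limitin_metric_dist_null by blast
  then have tA: "((\<lambda>z. N (A z - A a)) \<longlongrightarrow> 0) ?F"
    by (rule Lim_transform_eventually) (use ev in eventually_elim, simp add: ideal_dist_def AI a)
  have tL: "((\<lambda>z. norm (L z - L a)) \<longlongrightarrow> 0) ?F" and tR: "((\<lambda>z. norm (R z - R a)) \<longlongrightarrow> 0) ?F"
    and tR': "((\<lambda>z. norm (R z)) \<longlongrightarrow> norm (R a)) ?F"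
    using L(1) R(1) a unfolding continuous_map_atin
    by (auto simp: tendsto_norm LIM_zero tendsto_norm_zero)
  \<comment> \<open>The bound for the three telescoped terms. Writing
    \<open>N (A z - A a) + N (A a)\<close> in place of \<open>N (A z)\<close> leaves only quantities
    whose limits are known.\<close>
  define b where "b z = norm (L z - L a) * (N (A z - A a) + N (A a)) * norm (R z)
      + norm (L a) * N (A z - A a) * norm (R z) + norm (L a) * N (A a) * norm (R z - R a)" for z
  have "(b \<longlongrightarrow> 0 * (0 + N (A a)) * norm (R a) + norm (L a) * 0 * norm (R a) + norm (L a) * N (A a) * 0) ?F"
    unfolding b_def by (intro tendsto_intros tL tA tR tR')
  then have b: "(b \<longlongrightarrow> 0) ?F" by simp
  have inI: "L z o\<^sub>L A z o\<^sub>L R z \<in> I" if "z \<in> topspace Z" for z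
    using that by (intro ideal_compose L(2) R(2) AI)
  have bound: "ideal_dist I N (L z o\<^sub>L A z o\<^sub>L R z) (L a o\<^sub>L A a o\<^sub>L R a) \<le> b z" if z: "z \<in> topspace Z" for z
  proof -
    have bd: "L z - L a \<in> bounded_ops" "R z - R a \<in> bounded_ops"
      using z a by (auto intro!: bounded_ops_diff L(2) R(2))
    have dA: "A z - A a \<in> I" by (intro ideal_diff AI z a)
    let ?X = "(L z - L a) o\<^sub>L A z o\<^sub>L R z" and ?Y = "L a o\<^sub>L (A z - A a) o\<^sub>L R z"
      and ?W = "L a o\<^sub>L A a o\<^sub>L (R z - R a)"
    have I3: "?X \<in> I" "?Y \<in> I" "?W \<in> I"
      using z a dA bd by (auto intro!: ideal_compose L(2) R(2) AI)
    have eq: "(L z o\<^sub>L A z o\<^sub>L R z) - (L a o\<^sub>L A a o\<^sub>L R a) = (?X + ?Y) + ?W"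
      by (rule blinfun_eqI) (simp add: blinfun.bilinear_simps)
    have "N ((?X + ?Y) + ?W) \<le> N (?X + ?Y) + N ?W" by (intro norm_add ideal_add I3)
    also have "N (?X + ?Y) \<le> N ?X + N ?Y" by (intro norm_add I3)
    also have "N ?X \<le> norm (L z - L a) * N (A z) * norm (R z)" using z by (intro norm_compose bd AI R(2))
    also have "\<dots> \<le> norm (L z - L a) * (N (A z - A a) + N (A a)) * norm (R z)"
      using norm_add[OF dA AI[OF a]] by (intro mult_mono mult_nonneg_nonneg norm_nonneg AI z) (auto intro!: add_nonneg_nonneg norm_nonneg dA AI a)
    also have "N ?Y \<le> norm (L a) * N (A z - A a) * norm (R z)" using z a by (intro norm_compose dA L(2) R(2))
    also have "N ?W \<le> norm (L a) * N (A a) * norm (R z - R a)" using a by (intro norm_compose bd L(2) AI)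
    finally show ?thesis by (simp add: ideal_dist_def inI z a eq b_def)
  qed
  have "((\<lambda>z. ideal_dist I N (L z o\<^sub>L A z o\<^sub>L R z) (L a o\<^sub>L A a o\<^sub>L R a)) \<longlongrightarrow> 0) ?F"
  proof (rule tendsto_sandwich[OF _ _ tendsto_const b])
    show "eventually (\<lambda>z. 0 \<le> ideal_dist I N (L z o\<^sub>L A z o\<^sub>L R z) (L a o\<^sub>L A a o\<^sub>L R a)) ?F" by simp
    show "eventually (\<lambda>z. ideal_dist I N (L z o\<^sub>L A z o\<^sub>L R z) (L a o\<^sub>L A a o\<^sub>L R a) \<le> b z) ?F"
      using ev by eventually_elim (rule bound)
  qed
  moreover have "eventually (\<lambda>z. L z o\<^sub>L A z o\<^sub>L R z \<in> I) ?F"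
    using ev by eventually_elim (rule inI)
  ultimately show "limitin (ideal_topology I N) (\<lambda>z. L z o\<^sub>L A z o\<^sub>L R z) (L a o\<^sub>L A a o\<^sub>L R a) ?F"
    unfolding mtopology_ideal[symmetric] limitin_metric_dist_null
    using inI[OF a] by blast
qed

lemma continuous_map_ideal_euclidean: "continuous_map (ideal_topology I N) euclidean (\<lambda>A. A)"
  unfolding continuous_map_def topspace_ideal
  using finer by (simp add: Collect_conj_eq)

lemma continuous_map_Palais_ideal:
  "continuous_map (Palais_topology I N) (ideal_topology I N) (\<lambda>W. W - id_blinfun)"
  unfolding Palais_topology_def
  using continuous_map_pullback[OF continuous_map_id, of "Palais_group I" "\<lambda>W. W - id_blinfun" "ideal_topology I N"]
  by (simp add: o_def)

lemma continuous_map_Palais_euclidean: "continuous_map (Palais_topology I N) euclidean (\<lambda>W. W)"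
proof -
  have "continuous_map (Palais_topology I N) euclidean (\<lambda>W. W - id_blinfun)"
    using continuous_map_compose[OF continuous_map_Palais_ideal continuous_map_ideal_euclidean] by (simp add: o_def)
  moreover have "continuous_map euclidean euclidean (\<lambda>A :: 'a \<Rightarrow>\<^sub>L 'a. A + id_blinfun)"
    by (simp add: continuous_on_add continuous_on_id continuous_on_const)
  ultimately have "continuous_map (Palais_topology I N) euclidean ((\<lambda>A. A + id_blinfun) \<circ> (\<lambda>W. W - id_blinfun))"
    by (rule continuous_map_compose)
  then show ?thesis by (simp add: o_def)
qed

lemma continuous_map_into_Palais:
  assumes "continuous_map Z (ideal_topology I N) (\<lambda>z. f z - id_blinfun)"
    and "\<And>z. z \<in> topspace Z \<Longrightarrow> f z \<in> unitary_ops"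
  shows "continuous_map Z (Palais_topology I N) f"
  unfolding Palais_topology_def
proof (rule continuous_map_pullback')
  show "continuous_map Z (ideal_topology I N) ((\<lambda>W. W - id_blinfun) \<circ> f)" using assms(1) by (simp add: o_def)
  show "topspace Z \<subseteq> f -` Palais_group I"
    using assms(2) continuous_map_funspace[OF assms(1)] by (auto simp: Palais_group_def topspace_ideal)
qed

text \<open>A nonzero ideal contains every operator of rank one: pick \<open>A\<close> in it with
  \<open>A x0\<close> nonzero, feed \<open>cinner x v *\<^sub>C x0\<close> into \<open>A\<close> and
  map \<open>A x0\<close> to \<open>u\<close>.\<close>

lemma rank_one_mem:
  assumes "I \<noteq> {0}" and T: "T \<in> bounded_ops" "\<And>x. T x = cinner x v *\<^sub>C u"
  shows "T \<in> I"
proof -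
  have "0 \<in> I" using ideal by (simp add: two_sided_ideal_def)
  then obtain A where A: "A \<in> I" "A \<noteq> 0" using assms(1) by blast
  then obtain x0 where x0: "A x0 \<noteq> 0" by (metis blinfun_eqI blinfun.zero_left)
  have Ab: "A \<in> bounded_ops" using A(1) ideal by (auto simp: two_sided_ideal_def)
  define R where "R = Blinfun (\<lambda>x. cinner x v *\<^sub>C x0)"
  define S where "S = Blinfun (\<lambda>y. cinner y (A x0) *\<^sub>C ((1 / cinner (A x0) (A x0)) *\<^sub>C u))"
  have bl: "bounded_linear (\<lambda>x. cinner x b *\<^sub>C c)" for b c :: 'a
    by (intro bounded_linear_compose[OF bounded_bilinear.bounded_linear_left[OF bounded_bilinear_scaleC]
          bounded_bilinear.bounded_linear_left[OF bounded_bilinear_cinner]])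
  have R: "R x = cinner x v *\<^sub>C x0" for x
    by (simp add: R_def bounded_linear_Blinfun_apply bl)
  have S: "S y = cinner y (A x0) *\<^sub>C ((1 / cinner (A x0) (A x0)) *\<^sub>C u)" for y
    unfolding S_def by (rule fun_cong[OF bounded_linear_Blinfun_apply[OF bl]])
  have "R \<in> bounded_ops" by (rule bounded_opsI) (simp add: R cinner_scaleC_left scaleC_scaleC)
  moreover have "S \<in> bounded_ops" by (rule bounded_opsI) (simp add: S cinner_scaleC_left scaleC_scaleC)
  ultimately have "S o\<^sub>L A o\<^sub>L R \<in> I" using A(1) by (intro ideal_compose)
  moreover have "S o\<^sub>L A o\<^sub>L R = T"
    by (rule blinfun_eqI) (simp add: S R T bounded_ops_scaleC[OF Ab] cinner_scaleC_left x0 scaleC_scaleC)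
  ultimately show ?thesis by simp
qed

end

lemma symmetrically_normed_ideal_normed_ideal:
  "symmetrically_normed_ideal I N \<Longrightarrow> normed_ideal I N"
  by unfold_locales (auto simp: symmetrically_normed_ideal_def)

section \<open>The Palais group of a normed ideal\<close>

context hilbert_basis
begin

lemma weakly_homotopy_equivalent_Lag_minus_ideal:
  assumes snI: "symmetrically_normed_ideal I N"
  shows "weakly_homotopy_equivalent
           (Lag_minus_ideal_topology I N :: ('a \<times> 'a) set topology) U_infinity_topology"
proof -
  interpret normed_ideal I N by (rule symmetrically_normed_ideal_normed_ideal[OF snI])
  let ?X = "Palais_topology I N"
  have top: "topspace ?X = Palais_group I" by (rule topspace_Palais_topology[OF ideal norm])
  have compact: "I \<subseteq> compact_ops" and I0: "I \<noteq> {0}" using snI by (auto simp: symmetrically_normed_ideal_def)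
  have "stage_retraction ?X stable_op (\<lambda>n. topspace ?X \<inter> stages n)
           (\<lambda>n W. op_matrix n (reduction n 1 W)) (\<lambda>n z. reduction n (fst z) (snd z))"
  proof (rule stage_retraction_unitary)
    show "topspace ?X \<subseteq> (\<Union>n. stages n)"
      unfolding top using compact_perturbation_stage compact by (auto simp: Palais_group_def)
    show "continuous_map ?X euclidean (\<lambda>W. W)" by (rule continuous_map_Palais_euclidean)
    fix n
    interpret orthogonal_projection "tail n" by (rule tail_projection)
    have cont: "continuous_on (U_fin n) stable_op"
      by (rule continuous_on_eq[OF continuous_on_matrix_op]) (simp add: stable_op_eq)
    have unit: "stable_op A \<in> unitary_ops" if "A \<in> U_fin n" for A
      using matrix_op_unitary[OF that] by (simp add: stable_op_eq[OF that])
    \<comment> \<open>A sum of rank-one projections. Membership in \<open>I\<close> is the place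
      where nontriviality of the ideal enters.\<close>
    have head: "id_blinfun - tail n \<in> I"
    proof -
      have "(\<Sum>i<n. unit_op i i 1) \<in> I"
      proof (induction n)
        case 0
        show ?case using ideal by (simp add: two_sided_ideal_def)
      next
        case (Suc n)
        have "unit_op n n 1 \<in> I"
          by (rule rank_one_mem[OF I0, of _ "e n" "e n"])
             (auto intro!: bounded_opsI simp: unit_op_apply cinner_scaleC_left scaleC_scaleC)
        then show ?case using Suc by (simp add: ideal_add)
      qed
      moreover have "id_blinfun - tail n = (\<Sum>i<n. unit_op i i 1)"
        by (rule blinfun_eqI) (simp add: blinfun.diff_left blinfun.sum_left tail_apply unit_op_apply)
      ultimately show ?thesis by simp
    qed
    show "continuous_map (top_of_set (U_fin n)) ?X stable_op"
    proof (rule continuous_map_into_Palais)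
      show "stable_op A \<in> unitary_ops" if "A \<in> topspace (top_of_set (U_fin n))" for A
        using that by (simp add: unit)
      \<comment> \<open>\<open>stable_op A - 1\<close> vanishes on the tail, so the finite-rank
        projection \<open>id_blinfun - tail n\<close> can be inserted as a constant middle factor in
        \<open>I\<close>. It converts norm continuity in \<open>A\<close> into continuity for the
        ideal norm.\<close>
      have "continuous_map (top_of_set (U_fin n)) (ideal_topology I N)
          (\<lambda>A. (stable_op A - id_blinfun) o\<^sub>L (id_blinfun - tail n) o\<^sub>L id_blinfun)"
      proof (rule continuous_ideal_compose)
        show "continuous_map (top_of_set (U_fin n)) (ideal_topology I N) (\<lambda>A. id_blinfun - tail n)"
          using head by (simp add: topspace_ideal)
        show "continuous_map (top_of_set (U_fin n)) euclidean (\<lambda>A. stable_op A - id_blinfun)"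
          using cont by (simp add: continuous_on_diff)
        show "stable_op A - id_blinfun \<in> bounded_ops" if "A \<in> topspace (top_of_set (U_fin n))" for A
          using that by (intro bounded_ops_diff bounded_ops_id unitary_bounded_ops unit) simp
      qed (rule bounded_ops_id | simp)+
      then show "continuous_map (top_of_set (U_fin n)) (ideal_topology I N) (\<lambda>A. stable_op A - id_blinfun)"
      proof (rule continuous_map_eq)
        fix A assume "A \<in> topspace (top_of_set (U_fin n))"
        then have A: "A \<in> U_fin n" by simp
        show "(stable_op A - id_blinfun) o\<^sub>L (id_blinfun - tail n) o\<^sub>L id_blinfun = stable_op A - id_blinfun"
          by (rule blinfun_eqI)
             (simp add: blinfun.diff_left blinfun.diff_right stable_op_eq[OF A] matrix_op_tail)
      qed
    qed
    let ?Z = "prod_topology (top_of_set {0..1 :: real}) (subtopology ?X stage)"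
    have Z: "fst z \<in> {0..1}" "snd z \<in> stage" "snd z - id_blinfun \<in> I" if "z \<in> topspace ?Z" for z
      using that by (auto simp: top Palais_group_def)
    have snd_X: "continuous_map ?Z ?X snd"
      by (rule continuous_map_into_fulltopology[OF continuous_map_snd])
    \<comment> \<open>The Palais topology refines the norm topology, so whatever is norm continuous
      on \<open>{0..1} \<times> stage\<close> is continuous on \<open>?Z\<close>.\<close>
    have "continuous_map ?Z (prod_topology euclidean euclidean) (\<lambda>z. (fst z, snd z))"
    proof (rule continuous_map_pairedI)
      show "continuous_map ?Z euclidean fst"
        by (rule continuous_map_into_fulltopology[OF continuous_map_fst])
      show "continuous_map ?Z euclidean snd"
        using continuous_map_compose[OF snd_X continuous_map_Palais_euclidean] by (simp add: o_def)
    qed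
    then have "continuous_map ?Z euclidean (\<lambda>z. z)" by (simp add: euclidean_product_topology)
    then have id: "continuous_map ?Z (top_of_set ({0..1} \<times> stage)) (\<lambda>z. z)"
      by (auto simp: continuous_map_in_subtopology)
    have Z_cont: "continuous_map ?Z euclidean f" if "continuous_on ({0..1} \<times> stage) f"
      for f :: "real \<times> ('a \<Rightarrow>\<^sub>L 'a) \<Rightarrow> 'a \<Rightarrow>\<^sub>L 'a"
      using continuous_map_compose[OF id, of euclidean f] that by (simp add: o_def)
    show "continuous_map ?Z ?X (\<lambda>z. reduce (fst z) (snd z))"
    proof (rule continuous_map_into_Palais)
      show "reduce (fst z) (snd z) \<in> unitary_ops" if "z \<in> topspace ?Z" for z
        using Z[OF that] by (intro reduce_unitary)
      \<comment> \<open>In this factorization \<open>W - 1\<close> varies continuously for the ideal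
        norm and the outer factors for the operator norm, as \<open>continuous_ideal_compose\<close>
        requires.\<close>
      have "reduce s W - id_blinfun = (damping (sqrt (1 - s\<^sup>2)) o\<^sub>L resolvent s W) o\<^sub>L (W - id_blinfun) o\<^sub>L
          damping (sqrt (1 - s\<^sup>2) / (1 + s))" for s W
        by (simp add: reduce_def)
      moreover have "continuous_map ?Z (ideal_topology I N)
         (\<lambda>z. (damping (sqrt (1 - (fst z)\<^sup>2)) o\<^sub>L resolvent (fst z) (snd z)) o\<^sub>L (snd z - id_blinfun) o\<^sub>L
          damping (sqrt (1 - (fst z)\<^sup>2) / (1 + fst z)))"
      proof (rule continuous_ideal_compose)
        show "continuous_map ?Z (ideal_topology I N) (\<lambda>z. snd z - id_blinfun)"
          using continuous_map_compose[OF snd_X continuous_map_Palais_ideal] by (simp add: o_def)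
        show "continuous_map ?Z euclidean (\<lambda>z. damping (sqrt (1 - (fst z)\<^sup>2)) o\<^sub>L resolvent (fst z) (snd z))"
          by (intro Z_cont bounded_bilinear.continuous_on[OF bounded_bilinear_blinfun_compose]
              continuous_on_damping_factors continuous_on_resolvent)
        show "continuous_map ?Z euclidean (\<lambda>z. damping (sqrt (1 - (fst z)\<^sup>2) / (1 + fst z)))"
          by (intro Z_cont continuous_on_damping_factors)
        show "damping (sqrt (1 - (fst z)\<^sup>2)) o\<^sub>L resolvent (fst z) (snd z) \<in> bounded_ops"
          if "z \<in> topspace ?Z" for z
          using Z[OF that] by (intro bounded_ops_compose damping_bounded resolvent_bounded)
      qed (rule damping_bounded)
      ultimately show "continuous_map ?Z (ideal_topology I N) (\<lambda>z. reduce (fst z) (snd z) - id_blinfun)" by simp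
    qed
  qed
  then have "weak_homotopy_equivalence U_infinity_topology (Lag_minus_ideal_topology I N) (Cayley \<circ> stable_op)"
    using homeomorphic_map_Cayley[OF ideal norm] by (rule stage_retraction.homeomorphic_transfer)
  then show ?thesis unfolding weakly_homotopy_equivalent_def by blast
qed

end

theorem theorem2p57:
  assumes separable: "separable_space (euclidean :: 'a::complex_hilbert topology)"
    and infinite_dimensional: "\<not> finite_dimensional (UNIV :: 'a set)"
  shows "weakly_homotopy_equivalent
           (Lag_minus_topology :: ('a \<times> 'a) set topology) U_infinity_topology \<and>
         (\<forall>(I :: ('a \<Rightarrow>\<^sub>L 'a) set) N. symmetrically_normed_ideal I N \<longrightarrow>
            weakly_homotopy_equivalent (Lag_minus_ideal_topology I N) U_infinity_topology)"
proof -
  obtain e :: "nat \<Rightarrow> 'a" where "\<And>i j. cinner (e i) (e j) = (if i = j then 1 else 0)"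
    "\<And>x. (\<forall>i. cinner x (e i) = 0) \<longrightarrow> x = 0"
    using orthonormal_basis_exists[OF separable infinite_dimensional] by blast
  then interpret hilbert_basis e by unfold_locales auto
  show ?thesis
    using weakly_homotopy_equivalent_Lag_minus weakly_homotopy_equivalent_Lag_minus_ideal by blast
qed

end
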